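(* Let $k\in\{0,1,2,\dots\}$, let $\rho\in\mathbb{C}$ with $|\rho|<1$, and let $a,b,c,d,f>0$, except for possibly a pair of complex conjugates with positive real parts. Then $$ \int_0^\infty (1-\rho)^{-d+ix}\ {}_2F_1\!\left(\begin{matrix}a+ix,\ b+ix\\ a+b\end{matrix};\rho\right)\left|\frac{\Gamma(a+ix)\Gamma(d+ix)\Gamma(f+ix)}{\Gamma(2ix)}\right|^2S_k(x^2;a,d,f)\,dx $$ $$ =2\pi\,\frac{\Gamma(k+a+d)\Gamma(k+a+f)\Gamma(k+d+f)}{(a+b)_k\,k!}\ {}_2F_1\!\left(\begin{matrix}b-f,\ k+a+d\\ k+a+b\end{matrix};\rho\right). $$
   Context: $\Gamma$ is the gamma function. The Pochhammer symbol is $(z)_n=\prod_{i=1}^n(z+i-1)$ for $z\in\mathbb{C}$, $n\in\{0,1,2,\dots\}$ (so $(z)_0=1$). For $a_1,\dots,a_p\in\mathbb{C}$ and $b_1,\dots,b_q\in\mathbb{C}\setminus\{0,-1,-2,\dots\}$ the generalized hypergeometric function is ${}_pF_q(a_1,\dots,a_p;b_1,\dots,b_q;z)=\sum_{n\ge0}\frac{(a_1)_n\cdots(a_p)_n}{(b_1)_n\cdots(b_q)_n}\frac{z^n}{n!}$. The continuous dual Hahn polynomials are $$S_n(x^2;a,b,c)=(a+b)_n(a+c)_n\ {}_3F_2\!\left(\begin{matrix}-n,\ a+ix,\ a-ix\\ a+b,\ a+c\end{matrix};1\right),$$ where the three parameters are positive except for possibly a pair of complex conjugates with positive real parts. (The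 parameter $c$ of the hypothesis does not occur in the displayed identity.)
   Formalization: The displayed right-hand side is false for k ≥ 1 (at ρ=0, k=1 the integral is 0); the proved formula has an extra factor ρ^k and no k! in the denominator. Also a,d,f themselves are assumed positive except for possibly a conjugate pair among them, as S_k(x²;a,d,f) requires. *)

theory Defs
  imports "HOL-Analysis.Analysis"
begin

text \<open>
  The generalized hypergeometric function, as the sum of its defining power series.  The lists
  hold the upper and the lower parameters.
\<close>
definition hypergeometric :: "complex list \<Rightarrow> complex list \<Rightarrow> complex \<Rightarrow> complex" where
  "hypergeometric as bs z = eval_fps (fps_hypergeo as bs 1) z"

lemma hypergeometric_eq_suminf:
  "hypergeometric as bs z =
     (\<Sum>n. (\<Prod>a\<leftarrow>as. pochhammer a n) / (\<Prod>b\<leftarrow>bs. pochhammer b n) * (z ^ n / fact n))"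
proof -
  have "foldl (\<lambda>r a. r * pochhammer a n) v xs = v * (\<Prod>a\<leftarrow>xs. pochhammer a n)"
    for n v and xs :: "complex list"
    by (induction xs arbitrary: v) (simp_all add: mult.assoc)
  then show ?thesis
    by (simp add: hypergeometric_def eval_fps_def)
qed

text \<open>
  The value \<open>S\<^sub>n(x\<^sup>2; a, b, c)\<close> of the continuous dual Hahn polynomial; the argument is
  \<open>x\<close>, not its square.
\<close>
definition continuous_dual_Hahn :: "nat \<Rightarrow> real \<Rightarrow> complex \<Rightarrow> complex \<Rightarrow> complex \<Rightarrow> complex" where
  "continuous_dual_Hahn n x a b c =
     pochhammer (a + b) n * pochhammer (a + c) n *
     hypergeometric [- of_nat n, a + \<i> * of_real x, a - \<i> * of_real x] [a + b, a + c] 1"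

text \<open>
  Positive real parameters, except for possibly one pair (two entries at distinct positions) of
  complex conjugates with positive real parts.
\<close>
definition positive_up_to_conjugate_pair :: "complex list \<Rightarrow> bool" where
  "positive_up_to_conjugate_pair ps \<longleftrightarrow>
     (\<forall>p\<in>set ps. Re p > 0) \<and>
     ((\<forall>p\<in>set ps. p \<in> \<real>) \<or>
      (\<exists>i<length ps. \<exists>j<length ps. i \<noteq> j \<and> ps ! j = cnj (ps ! i) \<and>
         (\<forall>l<length ps. l \<noteq> i \<and> l \<noteq> j \<longrightarrow> ps ! l \<in> \<real>)))"

end

theory Submission
  imports Defs "HOL-Complex_Analysis.Complex_Analysis" "HOL-Real_Asymp.Real_Asymp"
begin

text \<open>
  Write \<open>s = ix\<close>. The function \<open>(1 - \<rho>)\<^bsup>s - d\<^esup> \<^sub>2F\<^sub>1(a + s, b + s; a + b; \<rho>)\<close> generates the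
  polynomials \<open>S\<^sub>n(x\<^sup>2; a, b, d)\<close>, so the integral becomes a power series in \<open>\<rho>\<close> whose coefficients
  pair \<open>S\<^sub>n(x\<^sup>2; a, b, d)\<close> with \<open>S\<^sub>k(x\<^sup>2; a, d, f)\<close>. Expanding the first polynomial in
  \<open>(a + s)\<^sub>j (a - s)\<^sub>j\<close> and, by symmetry in the parameters, the second in \<open>(d + s)\<^sub>m (d - s)\<^sub>m\<close>, every
  term only shifts parameters of the weight; two Chu-Vandermonde sums then evaluate the pairing
  from the total mass of the weight.

  The total mass \<open>I(a, b, c)\<close> satisfies \<open>I(a + 1, b, c) = (a + b) (a + c) I(a, b, c)\<close> by a shift of
  contour. An asymptotic form of logarithmic convexity in \<open>a\<close> makes \<open>I(a, b, c)\<close> a constant multiple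
  of \<open>\<Gamma>(a + b) \<Gamma>(a + c) \<Gamma>(b + c)\<close> for real parameters; the constant is read off at
  \<open>a = b = c = 1/2\<close>, where the integrand is elementary, and analytic continuation gives complex parameters.

  Summation and integration may be interchanged because the norms of \<open>S\<^sub>n(x\<^sup>2; a, b, d) / n!\<^sup>2\<close> grow
  polynomially in \<open>n\<close>, in the \<open>L\<^sup>2\<close> space of a weight with three equal parameters. For the orthogonal
  polynomials of that weight this is the norm formula, and changing one parameter at a time is a
  convolution in \<open>n\<close>.
\<close>

subsection \<open>Continuous dual Hahn polynomials\<close>

text \<open>The weight belongs to the triple a, d, f, while the generating function yields
  polynomials for a, b, d, so orthogonality does not apply directly. Expanding the two factors about
  the shared parameters a and d keeps the pairing triangular: it vanishes for n < k, and for n >= k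
  its dependence on n - k is carried by Pochhammer symbols and factorials, one of them the symbol of
  b - f. Hence the resummed series is again hypergeometric. Termwise integration needs control of
  the polynomials in n and x together. Square integrals give it without pointwise asymptotics,
  because for matching parameters they are themselves pairings. Powers of n lost on the way are
  harmless against |\<rho>|^n. For the total mass, log-convexity of Gamma is replaced off the real
  axis by an estimate whose correction factor tends to 1 as Re z grows. This is enough because the
  shift relation makes the normalised mass periodic in a, so that it may be examined arbitrarily far
  to the right.\<close>

lemma pochhammer_diff_sum:
  fixes C D :: "'a::comm_ring_1"
  shows "pochhammer (D - C) n =
    (\<Sum>m\<le>n. (-1) ^ m * of_nat (n choose m) * pochhammer C m * pochhammer (D + of_nat m) (n - m))"
proof -
  \<comment> \<open>Reversing the symbol turns the difference into the sum C + (1 - D - n), to which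
    the binomial (Vandermonde) expansion applies; reversing the factors in D afterwards leaves an
    identity without denominators.\<close>
  have "pochhammer (D - C) n = (-1) ^ n * pochhammer (C + (1 - D - of_nat n)) n"
    using pochhammer_minus[of "C - D" n] by (simp add: algebra_simps)
  also have "\<dots> = (\<Sum>m\<le>n. (-1) ^ m * of_nat (n choose m) * pochhammer C m *
      pochhammer (D + of_nat m) (n - m))"
    unfolding pochhammer_binomial_sum[of C "1 - D - of_nat n"] sum_distrib_left
  proof (rule sum.cong[OF refl])
    fix m assume m: "m \<in> {..n}"
    then have "pochhammer (1 - D - of_nat n) (n - m) =
        (-1) ^ (n - m) * pochhammer (D + of_nat m) (n - m)"
      using pochhammer_minus[of "D + of_nat n - 1" "n - m"] by (simp add: of_nat_diff algebra_simps)
    moreover have "(-1) ^ n * (-1) ^ (n - m) = ((-1) ^ m :: 'a)"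
      using m by (simp add: minus_one_power_iff)
    moreover have "(-1) ^ n * (of_nat (n choose m) * pochhammer C m *
        ((-1) ^ (n - m) * pochhammer (D + of_nat m) (n - m))) =
      ((-1) ^ n * (-1) ^ (n - m)) *
        (of_nat (n choose m) * pochhammer C m * pochhammer (D + of_nat m) (n - m))"
      by (simp only: mult_ac)
    ultimately show "(-1) ^ n * (of_nat (n choose m) * pochhammer C m *
        pochhammer (1 - D - of_nat n) (n - m)) =
      (-1) ^ m * of_nat (n choose m) * pochhammer C m * pochhammer (D + of_nat m) (n - m)"
      by (simp add: mult.assoc)
  qed
  finally show ?thesis .
qed

text \<open>The normalising symbols are multiplied into the terminating 3F2. The result is a
  polynomial in \<open>s\<close> and all parameters, so identities between different parameter
  triples need no side conditions. The argument \<open>s\<close> stands for ix.\<close>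

definition dual_Hahn :: "nat \<Rightarrow> complex \<Rightarrow> complex \<Rightarrow> complex \<Rightarrow> complex \<Rightarrow> complex" where
  "dual_Hahn n a b d s =
    (\<Sum>j\<le>n. (-1) ^ j * of_nat (n choose j) * (pochhammer (a + s) j * pochhammer (a - s) j) *
      pochhammer (a + b + of_nat j) (n - j) * pochhammer (a + d + of_nat j) (n - j))"

lemma dual_Hahn_swap23: "dual_Hahn n a b d s = dual_Hahn n a d b s"
  by (simp add: dual_Hahn_def mult_ac)

lemma sum_triangle_swap:
  "(\<Sum>j\<le>n. \<Sum>m\<le>j. f j m) = (\<Sum>m\<le>n. \<Sum>i\<le>n - m. f (m + i) m)"
  for f :: "nat \<Rightarrow> nat \<Rightarrow> 'a::comm_monoid_add"
  unfolding sum.Sigma[OF finite_atMost ballI[OF finite_atMost]]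
  by (rule sum.reindex_bij_witness[where i = "\<lambda>(m, i). (m + i, m)" and j = "\<lambda>(j, m). (m, j - m)"])
    auto

text \<open>
  The coefficient of the generating function \<open>(1 - t)\<^bsup>s - d\<^esup> \<cdot> \<^sub>2F\<^sub>1(a + s, b + s; a + b; t)\<close>, multiplied
  by \<open>n! (a + b)\<^sub>n\<close>.
\<close>
lemma dual_Hahn_eq_convolution:
  "dual_Hahn n a b d s =
    (\<Sum>j\<le>n. of_nat (n choose j) * (pochhammer (a + s) j * pochhammer (b + s) j) *
      pochhammer (a + b + of_nat j) (n - j) * pochhammer (d - s) (n - j))"
proof -
  \<comment> \<open>Here a - s is read as (a + b) - (b + s), and its Pochhammer symbol is expanded
    by Chu-Vandermonde.\<close>
  have "dual_Hahn n a b d s = (\<Sum>j\<le>n. \<Sum>m\<le>j.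
      (-1) ^ j * of_nat (n choose j) * pochhammer (a + s) j *
      pochhammer (a + b + of_nat j) (n - j) * pochhammer (a + d + of_nat j) (n - j) *
      ((-1) ^ m * of_nat (j choose m) * pochhammer (b + s) m *
        pochhammer (a + b + of_nat m) (j - m)))"
    unfolding dual_Hahn_def
    using pochhammer_diff_sum[of "a + b" "b + s"]
    by (intro sum.cong refl) (simp add: sum_distrib_left mult_ac add_diff_eq)
  also have "\<dots> = (\<Sum>m\<le>n. \<Sum>i\<le>n - m.
      (-1) ^ (m + i) * of_nat (n choose (m + i)) * pochhammer (a + s) (m + i) *
      pochhammer (a + b + of_nat (m + i)) (n - (m + i)) *
      pochhammer (a + d + of_nat (m + i)) (n - (m + i)) *
      ((-1) ^ m * of_nat ((m + i) choose m) * pochhammer (b + s) m *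
        pochhammer (a + b + of_nat m) i))"
    by (subst sum_triangle_swap) simp
  also have "\<dots> = (\<Sum>m\<le>n. of_nat (n choose m) * (pochhammer (a + s) m * pochhammer (b + s) m) *
      pochhammer (a + b + of_nat m) (n - m) * pochhammer (d - s) (n - m))"
  proof (rule sum.cong[OF refl])
    fix m assume m: "m \<in> {..n}"
    have "(\<Sum>i\<le>n - m.
      (-1) ^ (m + i) * of_nat (n choose (m + i)) * pochhammer (a + s) (m + i) *
      pochhammer (a + b + of_nat (m + i)) (n - (m + i)) *
      pochhammer (a + d + of_nat (m + i)) (n - (m + i)) *
      ((-1) ^ m * of_nat ((m + i) choose m) * pochhammer (b + s) m *
        pochhammer (a + b + of_nat m) i)) =
      (\<Sum>i\<le>n - m. (of_nat (n choose m) * (pochhammer (a + s) m * pochhammer (b + s) m) *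
      pochhammer (a + b + of_nat m) (n - m)) *
      ((-1) ^ i * of_nat ((n - m) choose i) * pochhammer (a + s + of_nat m) i *
      pochhammer (a + d + of_nat m + of_nat i) (n - m - i)))"
    proof (rule sum.cong[OF refl])
      fix i assume i: "i \<in> {..n - m}"
      have "(n choose (m + i)) * ((m + i) choose m) = (n choose m) * ((n - m) choose i)"
        using choose_mult[of m "m + i" n] m i by simp
      then have *: "of_nat (n choose (m + i)) * of_nat ((m + i) choose m) =
          (of_nat (n choose m) * of_nat ((n - m) choose i) :: complex)"
        by (metis of_nat_mult)
      have **: "pochhammer (a + b + of_nat m) (n - m) =
          pochhammer (a + b + of_nat m) i * pochhammer (a + b + of_nat (m + i)) (n - (m + i))"
        using pochhammer_product[of i "n - m" "a + b + of_nat m"] i by (simp add: add_ac)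
      have ***: "(-1) ^ (m + i) * (-1) ^ m = ((-1) ^ i :: complex)"
        by (simp add: minus_one_power_iff)
      show "(-1) ^ (m + i) * of_nat (n choose (m + i)) * pochhammer (a + s) (m + i) *
        pochhammer (a + b + of_nat (m + i)) (n - (m + i)) *
        pochhammer (a + d + of_nat (m + i)) (n - (m + i)) *
        ((-1) ^ m * of_nat ((m + i) choose m) * pochhammer (b + s) m *
          pochhammer (a + b + of_nat m) i) =
        (of_nat (n choose m) * (pochhammer (a + s) m * pochhammer (b + s) m) *
        pochhammer (a + b + of_nat m) (n - m)) *
        ((-1) ^ i * of_nat ((n - m) choose i) * pochhammer (a + s + of_nat m) i *
        pochhammer (a + d + of_nat m + of_nat i) (n - m - i))" (is "?l = ?r")
      proof -
        have "?l = ((-1) ^ (m + i) * (-1) ^ m) *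
          (of_nat (n choose (m + i)) * of_nat ((m + i) choose m)) *
          (pochhammer (a + s) (m + i) * pochhammer (b + s) m *
          (pochhammer (a + b + of_nat m) i * pochhammer (a + b + of_nat (m + i)) (n - (m + i))) *
          pochhammer (a + d + of_nat (m + i)) (n - (m + i)))"
          by (simp only: mult_ac)
        also have "\<dots> = ?r"
          unfolding * *** **[symmetric] pochhammer_product'[of "a + s" m i]
          by (simp add: mult_ac add_ac)
        finally show ?thesis .
      qed
    qed
    \<comment> \<open>The inner sum is Chu-Vandermonde again, now collapsing (a + d + m) - (a + s +
      m) to d - s.\<close>
    also have "\<dots> = of_nat (n choose m) * (pochhammer (a + s) m * pochhammer (b + s) m) *
      pochhammer (a + b + of_nat m) (n - m) *
      pochhammer ((a + d + of_nat m) - (a + s + of_nat m)) (n - m)"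
      unfolding pochhammer_diff_sum sum_distrib_left ..
    finally show "(\<Sum>i\<le>n - m.
      (-1) ^ (m + i) * of_nat (n choose (m + i)) * pochhammer (a + s) (m + i) *
      pochhammer (a + b + of_nat (m + i)) (n - (m + i)) *
      pochhammer (a + d + of_nat (m + i)) (n - (m + i)) *
      ((-1) ^ m * of_nat ((m + i) choose m) * pochhammer (b + s) m *
        pochhammer (a + b + of_nat m) i)) =
      of_nat (n choose m) * (pochhammer (a + s) m * pochhammer (b + s) m) *
      pochhammer (a + b + of_nat m) (n - m) * pochhammer (d - s) (n - m)"
      by simp
  qed
  finally show ?thesis .
qed

text \<open>The convolution form is visibly symmetric in the first two parameters, the defining sum
  in the last two; together they give symmetry under all permutations.\<close>

lemma dual_Hahn_swap12: "dual_Hahn n a b d s = dual_Hahn n b a d s"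
  by (simp add: dual_Hahn_eq_convolution mult_ac add_ac)

text \<open>In the convolution form only the symbol of d - s contains \<open>d\<close>, and
  Vandermonde splits it along (d - e) + (e - s). On generating functions this is multiplication by
  (1 - t)^(e - d).\<close>

lemma dual_Hahn_shift3:
  "dual_Hahn n a b d s =
    (\<Sum>m\<le>n. of_nat (n choose m) * pochhammer (d - e) m * pochhammer (a + b + of_nat (n - m)) m *
      dual_Hahn (n - m) a b e s)"
proof -
  have "dual_Hahn n a b d s = (\<Sum>j\<le>n. \<Sum>m\<le>n - j.
      of_nat (n choose j) * (pochhammer (a + s) j * pochhammer (b + s) j) *
      pochhammer (a + b + of_nat j) (n - j) *
      (of_nat ((n - j) choose m) * pochhammer (d - e) m * pochhammer (e - s) (n - j - m)))"
    unfolding dual_Hahn_eq_convolution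
  proof (intro sum.cong refl)
    fix j
    have "pochhammer (d - s) (n - j) = (\<Sum>m\<le>n - j.
      of_nat ((n - j) choose m) * pochhammer (d - e) m * pochhammer (e - s) (n - j - m))"
      using pochhammer_binomial_sum[of "d - e" "e - s" "n - j"] by simp
    then show "of_nat (n choose j) * (pochhammer (a + s) j * pochhammer (b + s) j) *
         pochhammer (a + b + of_nat j) (n - j) * pochhammer (d - s) (n - j) = (\<Sum>m\<le>n - j.
      of_nat (n choose j) * (pochhammer (a + s) j * pochhammer (b + s) j) *
      pochhammer (a + b + of_nat j) (n - j) *
      (of_nat ((n - j) choose m) * pochhammer (d - e) m * pochhammer (e - s) (n - j - m)))"
      by (simp add: sum_distrib_left)
  qed
  also have "\<dots> = (\<Sum>m\<le>n. \<Sum>j\<le>n - m.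
      of_nat (n choose j) * (pochhammer (a + s) j * pochhammer (b + s) j) *
      pochhammer (a + b + of_nat j) (n - j) *
      (of_nat ((n - j) choose m) * pochhammer (d - e) m * pochhammer (e - s) (n - j - m)))"
    unfolding sum.Sigma[OF finite_atMost ballI[OF finite_atMost]]
    by (rule sum.reindex_bij_witness[where i = "\<lambda>(m, i). (i, m)" and j = "\<lambda>(j, m). (m, j)"]) auto
  also have "\<dots> = (\<Sum>m\<le>n. of_nat (n choose m) * pochhammer (d - e) m *
      pochhammer (a + b + of_nat (n - m)) m * dual_Hahn (n - m) a b e s)"
    unfolding dual_Hahn_eq_convolution sum_distrib_left
  proof (intro sum.cong refl)
    fix m j assume m: "m \<in> {..n}" and j: "j \<in> {..n - m}"
    have "(n choose j) * ((n - j) choose m) = (n choose m) * ((n - m) choose j)"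
    proof -
      have "(n choose (m + j)) * ((m + j) choose j) = (n choose j) * ((n - j) choose m)"
        using choose_mult[of j "m + j" n] m j by simp
      moreover have "(n choose (m + j)) * ((m + j) choose m) = (n choose m) * ((n - m) choose j)"
        using choose_mult[of m "m + j" n] m j by simp
      moreover have "(m + j) choose m = (m + j) choose j"
        using binomial_symmetric[of m "m + j"] by simp
      ultimately show ?thesis by simp
    qed
    then have *: "of_nat (n choose j) * of_nat ((n - j) choose m) =
        (of_nat (n choose m) * of_nat ((n - m) choose j) :: complex)"
      by (metis of_nat_mult)
    have **: "pochhammer (a + b + of_nat j) (n - j) =
        pochhammer (a + b + of_nat j) (n - m - j) * pochhammer (a + b + of_nat (n - m)) m"
      using pochhammer_product[of "n - m - j" "n - j" "a + b + of_nat j"] m j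
      by (simp add: of_nat_diff algebra_simps)
    have ***: "n - j - m = n - m - j" by simp
    show "of_nat (n choose j) * (pochhammer (a + s) j * pochhammer (b + s) j) *
      pochhammer (a + b + of_nat j) (n - j) *
      (of_nat ((n - j) choose m) * pochhammer (d - e) m * pochhammer (e - s) (n - j - m)) =
      of_nat (n choose m) * pochhammer (d - e) m * pochhammer (a + b + of_nat (n - m)) m *
      (of_nat ((n - m) choose j) * (pochhammer (a + s) j * pochhammer (b + s) j) *
      pochhammer (a + b + of_nat j) (n - m - j) * pochhammer (e - s) (n - m - j))" (is "?l = ?r")
    proof -
      have "?l = (of_nat (n choose j) * of_nat ((n - j) choose m)) *
        ((pochhammer (a + s) j * pochhammer (b + s) j) *
        pochhammer (a + b + of_nat j) (n - j) *
        (pochhammer (d - e) m * pochhammer (e - s) (n - j - m)))"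
        by (simp only: mult_ac)
      also have "\<dots> = ?r"
        unfolding * ** *** by (simp only: mult_ac)
      finally show ?thesis .
    qed
  qed
  finally show ?thesis .
qed

text \<open>Positive real parts keep the lower parameters off the poles, so a quotient (z)_n / (z)_j
  may be rewritten as the symbol (z + j)_(n - j).\<close>

lemma continuous_dual_Hahn_eq:
  assumes "Re (a + b) > 0" "Re (a + c) > 0"
  shows "continuous_dual_Hahn n x a b c = dual_Hahn n a b c (\<i> * of_real x)"
proof -
  define s where "s = \<i> * of_real x"
  have nz: "pochhammer z m \<noteq> 0" if "Re z > 0" for z :: complex and m
    using that by (auto simp: pochhammer_eq_0_iff)
  have split: "pochhammer z n / pochhammer z j = pochhammer (z + of_nat j) (n - j)"
    if "Re z > 0" "j \<le> n" for z :: complex and j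
    using nz[OF that(1)] pochhammer_product[OF that(2), of z] by (simp add: field_simps)
  have "hypergeometric [- of_nat n, a + s, a - s] [a + b, a + c] 1 =
      (\<Sum>j. pochhammer (- of_nat n) j * (pochhammer (a + s) j * pochhammer (a - s) j) /
        (pochhammer (a + b) j * pochhammer (a + c) j) * (1 ^ j / fact j))"
    by (simp add: hypergeometric_eq_suminf)
  also have "\<dots> = (\<Sum>j\<le>n. pochhammer (- of_nat n) j * (pochhammer (a + s) j * pochhammer (a - s) j) /
        (pochhammer (a + b) j * pochhammer (a + c) j) * (1 ^ j / fact j))"
    by (rule suminf_finite) (auto simp: pochhammer_of_nat_eq_0_lemma)
  finally have "continuous_dual_Hahn n x a b c = (\<Sum>j\<le>n. pochhammer (a + b) n * pochhammer (a + c) n *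
      (pochhammer (- of_nat n) j * (pochhammer (a + s) j * pochhammer (a - s) j) /
        (pochhammer (a + b) j * pochhammer (a + c) j) * (1 ^ j / fact j)))"
    by (simp add: continuous_dual_Hahn_def s_def sum_distrib_left)
  also have "\<dots> = dual_Hahn n a b c s"
    unfolding dual_Hahn_def
  proof (rule sum.cong[OF refl])
    fix j assume j: "j \<in> {..n}"
    have "(of_nat (n choose j) :: complex) = of_nat n gchoose j"
      by (simp add: binomial_gbinomial)
    also have "\<dots> = (-1) ^ j * (pochhammer (- of_nat n) j / fact j)"
      by (simp add: gbinomial_pochhammer)
    finally have bin: "(-1) ^ j * of_nat (n choose j) = pochhammer (- of_nat n) j / (fact j :: complex)"
      by (simp add: power_mult_distrib[symmetric] mult.assoc[symmetric])
    show "pochhammer (a + b) n * pochhammer (a + c) n *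
      (pochhammer (- of_nat n) j * (pochhammer (a + s) j * pochhammer (a - s) j) /
        (pochhammer (a + b) j * pochhammer (a + c) j) * (1 ^ j / fact j)) =
      (-1) ^ j * of_nat (n choose j) * (pochhammer (a + s) j * pochhammer (a - s) j) *
      pochhammer (a + b + of_nat j) (n - j) * pochhammer (a + c + of_nat j) (n - j)"
      using j unfolding bin split[OF assms(1), of j, symmetric, OF j[simplified]]
        split[OF assms(2), of j, symmetric, OF j[simplified]]
      by (simp add: mult_ac)
  qed
  finally show ?thesis by (simp add: s_def)
qed

subsection \<open>The Gamma function on vertical lines\<close>

text \<open>Weighted AM-GM for 1 and \<open>y\<close>: convexity of exp between 0 and ln y.\<close>

lemma powr_le_affine:
  fixes y \<theta> :: real
  assumes "y > 0" "0 \<le> \<theta>" "\<theta> \<le> 1"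
  shows "y powr \<theta> \<le> 1 - \<theta> + \<theta> * y"
proof -
  have "y powr \<theta> = exp ((1 - \<theta>) *\<^sub>R 0 + \<theta> *\<^sub>R ln y)"
    using assms by (simp add: powr_def)
  also have "\<dots> \<le> (1 - \<theta>) * exp 0 + \<theta> * exp (ln y)"
    using convex_onD[OF exp_convex, of \<theta> 0 "ln y"] assms by simp
  finally show ?thesis using assms by simp
qed

text \<open>
  After weighted AM-GM, the error factor \<open>1 + 1/(4 t\<^sup>2)\<close> with \<open>t = Re u\<close> is absorbed by the
  telescoping factor \<open>t / (t - 1/2)\<close>.
\<close>
lemma norm_interpolation:
  fixes u :: complex
  assumes "Re u > 1/2" "0 \<le> \<theta>" "\<theta> \<le> 1"
  shows "(norm u)\<^sup>2 * (norm (u + 1))\<^sup>2 powr \<theta> * ((Re u + 1) / (Re u + 1/2)) \<le>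
    (norm (u + of_real \<theta>))\<^sup>2 * (norm u)\<^sup>2 powr \<theta> * (Re u / (Re u - 1/2))"
proof -
  define t where "t = Re u"
  have t: "t > 1/2" using assms by (simp add: t_def)
  have sq: "(norm (u + of_real r))\<^sup>2 = (t + r)\<^sup>2 + (Im u)\<^sup>2" for r :: real
    by (simp add: cmod_power2 t_def)
  have pos: "(norm u)\<^sup>2 > 0" "(norm (u + 1))\<^sup>2 > 0"
    using sq[of 0] sq[of 1] t by (simp_all add: sum_power2_gt_zero_iff)
  have "(norm (u + 1))\<^sup>2 powr \<theta> = (norm u)\<^sup>2 powr \<theta> * ((norm (u + 1))\<^sup>2 / (norm u)\<^sup>2) powr \<theta>"
    using pos by (simp add: powr_mult[symmetric])
  also have "\<dots> \<le> (norm u)\<^sup>2 powr \<theta> * (1 - \<theta> + \<theta> * ((norm (u + 1))\<^sup>2 / (norm u)\<^sup>2))"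
    using pos assms by (intro mult_left_mono powr_le_affine) auto
  finally have "(norm u)\<^sup>2 * (norm (u + 1))\<^sup>2 powr \<theta> \<le>
      (norm u)\<^sup>2 powr \<theta> * ((norm u)\<^sup>2 * (1 - \<theta> + \<theta> * ((norm (u + 1))\<^sup>2 / (norm u)\<^sup>2)))"
    using pos by (simp add: mult_left_mono mult.left_commute)
  also have "(norm u)\<^sup>2 * (1 - \<theta> + \<theta> * ((norm (u + 1))\<^sup>2 / (norm u)\<^sup>2)) =
      (1 - \<theta>) * (norm u)\<^sup>2 + \<theta> * (norm (u + 1))\<^sup>2"
    using pos by (simp add: field_simps)
  \<comment> \<open>The averaged squared modulus exceeds the squared modulus of the average by a
    variance, here that of a Bernoulli variable, hence at most 1/4.\<close>
  also have "\<dots> = (norm (u + of_real \<theta>))\<^sup>2 + \<theta> * (1 - \<theta>)"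
    using sq[of 0] sq[of 1] sq[of \<theta>] by (simp add: power2_eq_square algebra_simps)
  also have "\<dots> \<le> (norm (u + of_real \<theta>))\<^sup>2 * (1 + 1 / (4 * t\<^sup>2))"
  proof -
    have "\<theta> * (1 - \<theta>) \<le> 1/4"
      using zero_le_power2[of "\<theta> - 1/2"] by (simp add: power2_eq_square algebra_simps)
    also have "1/4 = t\<^sup>2 * (1 / (4 * t\<^sup>2))" using t by simp
    also have "\<dots> \<le> (norm (u + of_real \<theta>))\<^sup>2 * (1 / (4 * t\<^sup>2))"
    proof (rule mult_right_mono)
      have "t\<^sup>2 \<le> (t + \<theta>)\<^sup>2" using t assms by (intro power_mono) auto
      then show "t\<^sup>2 \<le> (norm (u + of_real \<theta>))\<^sup>2" unfolding sq by (simp add: add_increasing2)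
    qed simp
    finally show ?thesis by (simp add: algebra_simps)
  qed
  finally have le: "(norm u)\<^sup>2 * (norm (u + 1))\<^sup>2 powr \<theta> \<le>
      (norm u)\<^sup>2 powr \<theta> * ((norm (u + of_real \<theta>))\<^sup>2 * (1 + 1 / (4 * t\<^sup>2)))"
    using pos by (simp add: mult_left_mono)
  \<comment> \<open>After clearing denominators the gap between the two sides is t^2 - t/2 + 1/2,
    which is positive.\<close>
  have h: "(1 + 1 / (4 * t\<^sup>2)) * ((t + 1) / (t + 1/2)) \<le> t / (t - 1/2)"
  proof -
    have p: "(t - 1/2) * ((4 * t\<^sup>2) * (t + 1/2)) > 0" using t by (intro mult_pos_pos) auto
    have "((4 * t\<^sup>2 + 1) * (t + 1)) * (t - 1/2) \<le> t * ((4 * t\<^sup>2) * (t + 1/2))"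
      using t zero_le_power2[of "t - 1/2"]
      by (simp add: power2_eq_square algebra_simps)
    then have "((4 * t\<^sup>2 + 1) * (t + 1)) / ((4 * t\<^sup>2) * (t + 1/2)) \<le> t / (t - 1/2)"
      using t by (subst divide_le_eq; simp) (simp add: field_simps)
    moreover have "(1 + 1 / (4 * t\<^sup>2)) = (4 * t\<^sup>2 + 1) / (4 * t\<^sup>2)" using t by (simp add: field_simps)
    ultimately show ?thesis by simp
  qed
  have "(norm u)\<^sup>2 * (norm (u + 1))\<^sup>2 powr \<theta> * ((t + 1) / (t + 1/2)) \<le>
      (norm u)\<^sup>2 powr \<theta> * ((norm (u + of_real \<theta>))\<^sup>2 * (1 + 1 / (4 * t\<^sup>2))) * ((t + 1) / (t + 1/2))"
    using t by (intro mult_right_mono le) auto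
  also have "\<dots> = (norm u)\<^sup>2 powr \<theta> * (norm (u + of_real \<theta>))\<^sup>2 *
      ((1 + 1 / (4 * t\<^sup>2)) * ((t + 1) / (t + 1/2)))" by simp
  also have "\<dots> \<le> (norm u)\<^sup>2 powr \<theta> * (norm (u + of_real \<theta>))\<^sup>2 * (t / (t - 1/2))"
    by (intro mult_left_mono h) auto
  finally show ?thesis by (simp add: t_def mult_ac)
qed

text \<open>\<open>norm_interpolation\<close> is multiplied over u = z, z + 1, ...; the powers of
  |u| telescope, and so do the correction factors, which is why both sides carry one.\<close>

lemma norm_pochhammer_interpolation:
  fixes z :: complex
  assumes "Re z > 1/2" "0 \<le> \<theta>" "\<theta> \<le> 1"
  shows "(norm (pochhammer z n))\<^sup>2 * (norm (z + of_nat n))\<^sup>2 powr \<theta> *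
      ((Re z + n) / (Re z + n - 1/2)) \<le>
    (norm (pochhammer (z + of_real \<theta>) n))\<^sup>2 * (norm z)\<^sup>2 powr \<theta> * (Re z / (Re z - 1/2))"
proof (induction n)
  case (Suc n)
  define u where "u = z + of_nat n"
  have "(norm (pochhammer z (Suc n)))\<^sup>2 * (norm (z + of_nat (Suc n)))\<^sup>2 powr \<theta> *
      ((Re z + Suc n) / (Re z + Suc n - 1/2)) =
    (norm (pochhammer z n))\<^sup>2 * ((norm u)\<^sup>2 * (norm (u + 1))\<^sup>2 powr \<theta> * ((Re u + 1) / (Re u + 1/2)))"
    by (simp add: pochhammer_Suc u_def norm_mult power_mult_distrib add_ac)
  also have "\<dots> \<le> (norm (pochhammer z n))\<^sup>2 *
      ((norm (u + of_real \<theta>))\<^sup>2 * (norm u)\<^sup>2 powr \<theta> * (Re u / (Re u - 1/2)))"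
    using assms by (intro mult_left_mono norm_interpolation) (auto simp: u_def)
  also have "\<dots> = (norm (u + of_real \<theta>))\<^sup>2 * ((norm (pochhammer z n))\<^sup>2 *
      (norm (z + of_nat n))\<^sup>2 powr \<theta> * ((Re z + n) / (Re z + n - 1/2)))"
    by (simp add: u_def mult_ac)
  also have "\<dots> \<le> (norm (u + of_real \<theta>))\<^sup>2 *
      ((norm (pochhammer (z + of_real \<theta>) n))\<^sup>2 * (norm z)\<^sup>2 powr \<theta> * (Re z / (Re z - 1/2)))"
    by (intro mult_left_mono Suc.IH) auto
  also have "\<dots> = (norm (pochhammer (z + of_real \<theta>) (Suc n)))\<^sup>2 * (norm z)\<^sup>2 powr \<theta> *
      (Re z / (Re z - 1/2))"
    by (simp add: pochhammer_Suc u_def norm_mult power_mult_distrib add_ac mult_ac)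
  finally show ?case .
qed simp

text \<open>The Pochhammer estimate is passed to the limit in Euler's formula for Gamma. For complex
  z this plays the part of log-convexity, at the price of a factor that tends to 1 as Re z
  grows.\<close>

lemma norm_Gamma_add_le:
  fixes z :: complex
  assumes "Re z > 1/2" "0 \<le> \<theta>" "\<theta> \<le> 1"
  shows "(norm (Gamma (z + of_real \<theta>)))\<^sup>2 \<le>
    Re z / (Re z - 1/2) * (norm (Gamma z))\<^sup>2 * (norm z)\<^sup>2 powr \<theta>"
proof (rule LIMSEQ_le)
  have pochnz: "pochhammer w m \<noteq> 0" if "Re w > 0" for w :: complex and m
    using that by (auto simp: pochhammer_eq_0_iff)
  show "(\<lambda>n. (norm (Gamma_series (z + of_real \<theta>) n))\<^sup>2) \<longlonglongrightarrow> (norm (Gamma (z + of_real \<theta>)))\<^sup>2"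
    by (intro tendsto_intros)
  define r where "r = (\<lambda>n::nat. (real n)\<^sup>2 powr \<theta> / (norm (z + of_nat (Suc n)))\<^sup>2 powr \<theta>)"
  have rlim: "r \<longlonglongrightarrow> 1"
  proof -
    have "(\<lambda>n. z * of_real (1 / real n) + (1 + of_real (1 / real n))) \<longlonglongrightarrow> z * of_real 0 + (1 + of_real 0)"
      by (intro tendsto_intros lim_1_over_n)
    then have "(\<lambda>n. norm (z * of_real (1 / real n) + (1 + of_real (1 / real n)))) \<longlonglongrightarrow> 1"
      using tendsto_norm by fastforce
    then have "(\<lambda>n. 1 / (norm (z * of_real (1 / real n) + (1 + of_real (1 / real n))))\<^sup>2 powr \<theta>) \<longlonglongrightarrow> 1 / 1\<^sup>2 powr \<theta>"
      by (intro tendsto_intros) auto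
    moreover have "\<forall>\<^sub>F n in sequentially. 1 / (norm (z * of_real (1 / real n) + (1 + of_real (1 / real n))))\<^sup>2 powr \<theta> = r n"
    proof (rule eventually_sequentiallyI[of 1])
      fix n :: nat assume n: "1 \<le> n"
      have "z * of_real (1 / real n) + (1 + of_real (1 / real n)) = (z + of_nat (Suc n)) / of_nat n"
        using n by (simp add: field_simps)
      then have "(norm (z * of_real (1 / real n) + (1 + of_real (1 / real n))))\<^sup>2 =
          (norm (z + of_nat (Suc n)))\<^sup>2 / (real n)\<^sup>2"
        by (simp add: norm_divide power_divide)
      then show "1 / (norm (z * of_real (1 / real n) + (1 + of_real (1 / real n))))\<^sup>2 powr \<theta> = r n"
        by (simp add: r_def powr_divide)
    qed
    ultimately show ?thesis using tendsto_cong by fastforce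
  qed
  have "(\<lambda>n. Re z / (Re z - 1/2) * (norm (Gamma_series z n))\<^sup>2 * (norm z)\<^sup>2 powr \<theta> * r n)
    \<longlonglongrightarrow> Re z / (Re z - 1/2) * (norm (Gamma z))\<^sup>2 * (norm z)\<^sup>2 powr \<theta> * 1"
    by (intro tendsto_intros rlim)
  then show "(\<lambda>n. Re z / (Re z - 1/2) * (norm (Gamma_series z n))\<^sup>2 * (norm z)\<^sup>2 powr \<theta> * r n)
    \<longlonglongrightarrow> Re z / (Re z - 1/2) * (norm (Gamma z))\<^sup>2 * (norm z)\<^sup>2 powr \<theta>"
    by simp
  show "\<exists>N. \<forall>n\<ge>N. (norm (Gamma_series (z + of_real \<theta>) n))\<^sup>2 \<le>
    Re z / (Re z - 1/2) * (norm (Gamma_series z n))\<^sup>2 * (norm z)\<^sup>2 powr \<theta> * r n"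
  proof (intro exI[of _ 1] allI impI)
    fix n :: nat assume n: "1 \<le> n"
    define A where "A = (norm (pochhammer z (Suc n)))\<^sup>2"
    define B where "B = (norm (pochhammer (z + of_real \<theta>) (Suc n)))\<^sup>2"
    define P where "P = (norm (z + of_nat (Suc n)))\<^sup>2 powr \<theta>"
    define h where "h = Re z / (Re z - 1/2)"
    define E where "E = (fact n :: real)\<^sup>2 * (exp (Re z * ln n))\<^sup>2"
    have A: "A > 0" and B: "B > 0"
      using pochnz[of z] pochnz[of "z + of_real \<theta>"] assms by (simp_all add: A_def B_def del: pochhammer_Suc)
    have "z + of_nat (Suc n) \<noteq> 0" using assms by (auto simp: complex_eq_iff)
    then have P: "P > 0" by (simp add: P_def)
    \<comment> \<open>The surviving correction factor at index n + 1 is at least 1 and is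
      dropped.\<close>
    have "A * P * 1 \<le> A * P * ((Re z + Suc n) / (Re z + Suc n - 1/2))"
      using A P assms by (intro mult_left_mono) (auto simp: field_simps)
    also have "\<dots> \<le> B * (norm z)\<^sup>2 powr \<theta> * h"
      unfolding A_def B_def P_def h_def by (rule norm_pochhammer_interpolation) fact+
    finally have *: "A * P \<le> B * (norm z)\<^sup>2 powr \<theta> * h" by simp
    have g1: "(norm (Gamma_series (z + of_real \<theta>) n))\<^sup>2 = E * (real n)\<^sup>2 powr \<theta> / B"
    proof -
      have "(exp ((Re z + \<theta>) * ln n))\<^sup>2 = (exp (Re z * ln n))\<^sup>2 * (real n)\<^sup>2 powr \<theta>"
        using n by (simp add: powr_def ln_mult power2_eq_square exp_add[symmetric] algebra_simps)
      then show ?thesis using n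
        by (simp add: Gamma_series_def norm_divide norm_mult power_divide power_mult_distrib B_def E_def
             norm_exp_eq_Re)
    qed
    have g2: "(norm (Gamma_series z n))\<^sup>2 = E / A"
      using n by (simp add: Gamma_series_def norm_divide norm_mult power_divide power_mult_distrib
          A_def E_def norm_exp_eq_Re)
    have "E * (real n)\<^sup>2 powr \<theta> / B \<le> E * (real n)\<^sup>2 powr \<theta> * ((norm z)\<^sup>2 powr \<theta> * h / (A * P))"
    proof -
      have "1 / B \<le> (norm z)\<^sup>2 powr \<theta> * h / (A * P)"
        using * A B P by (simp add: field_simps)
      from mult_left_mono[OF this, of "E * (real n)\<^sup>2 powr \<theta>"] show ?thesis
        by (simp add: E_def)
    qed
    then show "(norm (Gamma_series (z + of_real \<theta>) n))\<^sup>2 \<le>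
        Re z / (Re z - 1/2) * (norm (Gamma_series z n))\<^sup>2 * (norm z)\<^sup>2 powr \<theta> * r n"
      unfolding g1 g2 r_def P_def[symmetric] h_def[symmetric] by (simp add: mult_ac)
  qed
qed


section \<open>Exponential decay of Gamma along vertical lines\<close>

lemma Re_pos_not_nonpos_Int: "Re z > 0 \<Longrightarrow> z \<notin> \<int>\<^sub>\<le>\<^sub>0"
  by (auto elim!: nonpos_Ints_cases)

text \<open>On the line Re z = 1/2 the point 1 - z is the conjugate of z, so the reflection formula
  yields the modulus exactly. The two bounds then enclose cosh between half an exponential and the
  whole of it.\<close>

lemma norm_Gamma_half_line_le: "norm (Gamma (1/2 + \<i> * of_real t)) \<le> sqrt (2 * pi) * exp (- (pi * \<bar>t\<bar> / 2))"
  and norm_Gamma_half_line_ge: "norm (Gamma (1/2 + \<i> * of_real t)) \<ge> sqrt pi * exp (- (pi * \<bar>t\<bar> / 2))"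
  and norm_Gamma_half_line: "(norm (Gamma (1/2 + \<i> * of_real t)))\<^sup>2 = pi / cosh (pi * t)"
proof -
  have cnj: "1 - (1/2 + \<i> * of_real t) = cnj (1/2 + \<i> * of_real t)" by (simp add: complex_eq_iff)
  have "of_real ((norm (Gamma (1/2 + \<i> * of_real t)))\<^sup>2) =
      Gamma (1/2 + \<i> * of_real t) * cnj (Gamma (1/2 + \<i> * of_real t))"
    by (rule complex_norm_square)
  also have "\<dots> = Gamma (1/2 + \<i> * of_real t) * Gamma (1 - (1/2 + \<i> * of_real t))"
    unfolding cnj by (simp only: cnj_Gamma)
  also have "\<dots> = of_real pi / sin (of_real pi * (1/2 + \<i> * of_real t))"
    by (rule Gamma_reflection_complex)
  also have "of_real pi * (1/2 + \<i> * of_real t) = \<i> * of_real (pi * t) + of_real pi / 2"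
    by (simp add: algebra_simps)
  also have "sin (\<i> * of_real (pi * t) + of_real pi / 2) = cosh (of_real (pi * t))"
    by (simp add: sin_add cosh_conv_cos)
  also have "of_real pi / cosh (of_real (pi * t)) = complex_of_real (pi / cosh (pi * t))"
    by (simp add: cosh_def scaleR_conv_of_real exp_of_real[symmetric])
  finally show eq: "(norm (Gamma (1/2 + \<i> * of_real t)))\<^sup>2 = pi / cosh (pi * t)"
    using of_real_eq_iff by blast
  have c1: "cosh (pi * t) \<ge> exp (pi * \<bar>t\<bar>) / 2" and c2: "cosh (pi * t) \<le> exp (pi * \<bar>t\<bar>)"
    by (cases "t \<ge> 0"; simp add: cosh_def mult_nonneg_nonneg mult_le_0_iff)+
  have e: "(exp (- (pi * \<bar>t\<bar> / 2)))\<^sup>2 = 1 / exp (pi * \<bar>t\<bar>)"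
  proof -
    have "(exp (- (pi * \<bar>t\<bar> / 2)))\<^sup>2 = exp (- (pi * \<bar>t\<bar> / 2) + - (pi * \<bar>t\<bar> / 2))"
      by (simp only: power2_eq_square exp_add)
    also have "\<dots> = 1 / exp (pi * \<bar>t\<bar>)" by (simp add: exp_minus inverse_eq_divide)
    finally show ?thesis .
  qed
  have "(norm (Gamma (1/2 + \<i> * of_real t)))\<^sup>2 \<le> (sqrt (2 * pi) * exp (- (pi * \<bar>t\<bar> / 2)))\<^sup>2"
    unfolding eq power_mult_distrib e using c1 by (simp add: field_simps)
  then show "norm (Gamma (1/2 + \<i> * of_real t)) \<le> sqrt (2 * pi) * exp (- (pi * \<bar>t\<bar> / 2))"
    by (rule power2_le_imp_le) auto
  have "(sqrt pi * exp (- (pi * \<bar>t\<bar> / 2)))\<^sup>2 \<le> (norm (Gamma (1/2 + \<i> * of_real t)))\<^sup>2"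
    unfolding eq power_mult_distrib e using c2 by (simp add: field_simps)
  then show "norm (Gamma (1/2 + \<i> * of_real t)) \<ge> sqrt pi * exp (- (pi * \<bar>t\<bar> / 2))"
    by (rule power2_le_imp_le) auto
qed

text \<open>The modulus is known exactly on Re z = 1/2, but there the interpolation factor has its
  pole. One use of the recurrence moves to Re z = 3/2, interpolation fills the strip up to 5/2, and
  further recurrences widen it. The constants are generous; only the exponential rate matters
  later.\<close>

lemma norm_Gamma_bound_strip:
  fixes z :: complex
  assumes "3/2 \<le> Re z" "Re z \<le> 5/2 + real m"
  shows "norm (Gamma z) \<le> (5 + real m) ^ (m + 5) * (1 + \<bar>Im z\<bar>) ^ (m + 2) * exp (- (pi * \<bar>Im z\<bar> / 2))"
  using assms
proof (induction m arbitrary: z)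
  case 0
  define \<theta> where "\<theta> = Re z - 3/2"
  define w where "w = 1/2 + \<i> * of_real (Im z)"
  define e where "e = exp (- (pi * \<bar>Im z\<bar> / 2))"
  have th: "0 \<le> \<theta>" "\<theta> \<le> 1" using 0 by (auto simp: \<theta>_def)
  have z: "z = (w + 1) + of_real \<theta>" by (simp add: w_def \<theta>_def complex_eq_iff)
  have w: "norm w \<le> 1 + \<bar>Im z\<bar>" "norm (w + 1) \<le> 3/2 * (1 + \<bar>Im z\<bar>)" "norm (w + 1) \<ge> 1"
    using cmod_le[of w] cmod_le[of "w + 1"] abs_Re_le_cmod[of "w + 1"] by (auto simp: w_def)
  have G: "Gamma (w + 1) = w * Gamma w"
    by (intro Gamma_plus1 Re_pos_not_nonpos_Int) (simp add: w_def)
  have g0: "norm (Gamma (w + 1)) \<le> (1 + \<bar>Im z\<bar>) * (3 * e)"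
  proof -
    have "sqrt (2 * pi) \<le> sqrt 9" using pi_less_4 by (intro real_sqrt_le_mono) auto
    then have "sqrt (2 * pi) * e \<le> 3 * e" by (simp add: e_def)
    then have "norm (Gamma w) \<le> 3 * e"
      using norm_Gamma_half_line_le[of "Im z"] unfolding w_def e_def by linarith
    then show ?thesis unfolding G norm_mult by (intro mult_mono w) auto
  qed
  have "(norm (Gamma z))\<^sup>2 \<le>
      Re (w + 1) / (Re (w + 1) - 1/2) * (norm (Gamma (w + 1)))\<^sup>2 * (norm (w + 1))\<^sup>2 powr \<theta>"
    unfolding z by (rule norm_Gamma_add_le) (use th in \<open>auto simp: w_def\<close>)
  also have "Re (w + 1) / (Re (w + 1) - 1/2) = 3/2" by (simp add: w_def)
  also have "3/2 * (norm (Gamma (w + 1)))\<^sup>2 * (norm (w + 1))\<^sup>2 powr \<theta> \<le>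
      3/2 * (norm (Gamma (w + 1)))\<^sup>2 * (3/2 * (1 + \<bar>Im z\<bar>))\<^sup>2"
  proof (rule mult_left_mono)
    have "(norm (w + 1))\<^sup>2 powr \<theta> \<le> (norm (w + 1))\<^sup>2 powr 1"
      using w(3) th by (intro powr_mono) (auto simp: one_le_power)
    also have "\<dots> \<le> (3/2 * (1 + \<bar>Im z\<bar>))\<^sup>2" using w(2) by (simp add: power_mono)
    finally show "(norm (w + 1))\<^sup>2 powr \<theta> \<le> (3/2 * (1 + \<bar>Im z\<bar>))\<^sup>2" .
  qed simp
  also have "\<dots> \<le>
      3/2 * ((1 + \<bar>Im z\<bar>) * (3 * e))\<^sup>2 * (3/2 * (1 + \<bar>Im z\<bar>))\<^sup>2"
    by (intro mult_right_mono mult_left_mono power_mono g0) auto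
  also have "\<dots> = 243/8 * ((1 + \<bar>Im z\<bar>)\<^sup>2 * e)\<^sup>2"
    by (simp add: power2_eq_square field_simps)
  \<comment> \<open>A generous constant, chosen as a square that fits the shape (5 + m)^(m + 5) at m
    = 0.\<close>
  also have "\<dots> \<le> 5 ^ 10 * ((1 + \<bar>Im z\<bar>)\<^sup>2 * e)\<^sup>2"
    by (intro mult_right_mono) auto
  also have "\<dots> = (5 ^ 5 * (1 + \<bar>Im z\<bar>)\<^sup>2 * e)\<^sup>2"
    by (simp add: power_mult_distrib)
  finally have "norm (Gamma z) \<le> 5 ^ 5 * (1 + \<bar>Im z\<bar>)\<^sup>2 * e"
    by (rule power2_le_imp_le) (auto simp: e_def)
  then show ?case by (simp add: e_def power2_eq_square)
next
  case (Suc m)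
  define e where "e = exp (- (pi * \<bar>Im z\<bar> / 2))"
  have mono: "(5 + real m) ^ (m + 5) * (1 + \<bar>Im z\<bar>) ^ (m + 2) * e \<le>
      (5 + real (Suc m)) ^ (m + 5) * (1 + \<bar>Im z\<bar>) ^ (m + 2) * e"
    by (intro mult_right_mono power_mono) (auto simp: e_def)
  have big: "1 \<le> (5 + real (Suc m)) * (1 + \<bar>Im z\<bar>)"
    using mult_mono[of 1 "5 + real (Suc m)" 1 "1 + \<bar>Im z\<bar>"] by simp
  have r: "(5 + real (Suc m)) ^ (Suc m + 5) * (1 + \<bar>Im z\<bar>) ^ (Suc m + 2) * e =
     ((5 + real (Suc m)) * (1 + \<bar>Im z\<bar>)) * ((5 + real (Suc m)) ^ (m + 5) * (1 + \<bar>Im z\<bar>) ^ (m + 2) * e)"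
    by (simp only: add_Suc power_Suc mult_ac)
  show ?case
  proof (cases "Re z \<le> 5/2 + real m")
    case True
    have "norm (Gamma z) \<le> 1 * ((5 + real (Suc m)) ^ (m + 5) * (1 + \<bar>Im z\<bar>) ^ (m + 2) * e)"
      using Suc.IH[OF Suc.prems(1) True] mono unfolding e_def by linarith
    also have "\<dots> \<le> ((5 + real (Suc m)) * (1 + \<bar>Im z\<bar>)) * ((5 + real (Suc m)) ^ (m + 5) * (1 + \<bar>Im z\<bar>) ^ (m + 2) * e)"
      by (intro mult_right_mono big) (auto simp: e_def)
    finally show ?thesis unfolding e_def[symmetric] r .
  next
    case False
    have "z - 1 \<notin> \<int>\<^sub>\<le>\<^sub>0" using False by (intro Re_pos_not_nonpos_Int) auto
    from Gamma_plus1[OF this] have "norm (Gamma z) = norm (z - 1) * norm (Gamma (z - 1))"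
      by (simp add: norm_mult)
    also have "\<dots> \<le> ((5 + real (Suc m)) * (1 + \<bar>Im z\<bar>)) *
        ((5 + real (Suc m)) ^ (m + 5) * (1 + \<bar>Im z\<bar>) ^ (m + 2) * e)"
    proof (rule mult_mono)
      have "norm (z - 1) \<le> \<bar>Re (z - 1)\<bar> + \<bar>Im (z - 1)\<bar>" by (rule cmod_le)
      also have "\<dots> \<le> (5 + real (Suc m)) + (5 + real (Suc m)) * \<bar>Im z\<bar>"
        using Suc.prems False mult_right_mono[of 1 "5 + real (Suc m)" "\<bar>Im z\<bar>"] by (intro add_mono) auto
      finally show "norm (z - 1) \<le> (5 + real (Suc m)) * (1 + \<bar>Im z\<bar>)" by (simp add: algebra_simps)
      show "norm (Gamma (z - 1)) \<le> (5 + real (Suc m)) ^ (m + 5) * (1 + \<bar>Im z\<bar>) ^ (m + 2) * e"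
        using Suc.IH[of "z - 1"] Suc.prems False mono by (simp add: e_def)
    qed auto
    finally show ?thesis unfolding e_def[symmetric] r .
  qed
qed

text \<open>A shift by 2 moves any z with Re z > 0 into the strips already treated; going back
  divides by |z + 1| >= 1 and |z| >= \<sigma>, so the pole at 0 costs only 1/\<sigma>.\<close>

lemma norm_Gamma_vertical_bound:
  fixes \<sigma> \<tau> :: real
  assumes "\<sigma> > 0"
  obtains C M where "C > 0"
    "\<And>z. \<sigma> \<le> Re z \<Longrightarrow> Re z \<le> \<tau> \<Longrightarrow> norm (Gamma z) \<le> C * (1 + \<bar>Im z\<bar>) ^ M * exp (- (pi * \<bar>Im z\<bar> / 2))"
proof -
  define m where "m = nat \<lceil>\<tau>\<rceil>"
  show ?thesis
  proof (rule that)
    show "(5 + real m) ^ (m + 5) / \<sigma> > 0" using assms by simp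
    fix z assume z: "\<sigma> \<le> Re z" "Re z \<le> \<tau>"
    have "Re (z + 2) \<le> 5/2 + real m" using z unfolding m_def by simp linarith
    then have *: "norm (Gamma (z + 2)) \<le>
        (5 + real m) ^ (m + 5) * (1 + \<bar>Im z\<bar>) ^ (m + 2) * exp (- (pi * \<bar>Im z\<bar> / 2))"
      using norm_Gamma_bound_strip[of "z + 2" m] z assms by simp
    have nz: "z \<notin> \<int>\<^sub>\<le>\<^sub>0" "z + 1 \<notin> \<int>\<^sub>\<le>\<^sub>0"
      using z assms by (auto intro!: Re_pos_not_nonpos_Int)
    have "Gamma (z + 2) = (z + 1) * (z * Gamma z)"
      using Gamma_plus1[OF nz(1)] Gamma_plus1[OF nz(2)] by (simp add: add.assoc)
    then have "norm (Gamma (z + 2)) = norm (z + 1) * (norm z * norm (Gamma z))"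
      by (simp add: norm_mult)
    moreover have "1 * (\<sigma> * norm (Gamma z)) \<le> norm (z + 1) * (norm z * norm (Gamma z))"
      using z assms complex_Re_le_cmod[of z] complex_Re_le_cmod[of "z + 1"]
      by (intro mult_mono) auto
    ultimately show "norm (Gamma z) \<le> (5 + real m) ^ (m + 5) / \<sigma> * (1 + \<bar>Im z\<bar>) ^ (m + 2) * exp (- (pi * \<bar>Im z\<bar> / 2))"
      using * assms by (simp add: field_simps)
  qed
qed

subsection \<open>The weight function\<close>

lemma integrable_one_over_one_plus_square: "integrable lborel (\<lambda>x::real. 1 / (1 + x\<^sup>2))"
proof -
  have "set_integrable lborel (einterval (-\<infinity>) \<infinity>) (\<lambda>x. 1 / (1 + x\<^sup>2))"
  proof (rule interval_integral_FTC_nonneg[where F = arctan and A = "- pi / 2" and B = "pi / 2"])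
    show "DERIV arctan x :> 1 / (1 + x\<^sup>2)" for x
      using DERIV_arctan[of x] by (simp add: inverse_eq_divide)
    show "isCont (\<lambda>x. 1 / (1 + x\<^sup>2)) x" for x :: real
      by (intro continuous_intros) (simp add: add_nonneg_eq_0_iff)
    show "((arctan \<circ> real_of_ereal) \<longlongrightarrow> - pi / 2) (at_right (-\<infinity>))"
      using tendsto_arctan_at_bot by (simp add: ereal_tendsto_simps)
    show "((arctan \<circ> real_of_ereal) \<longlongrightarrow> pi / 2) (at_left \<infinity>)"
      using tendsto_arctan_at_top by (simp add: ereal_tendsto_simps)
  qed (auto simp: add_nonneg_nonneg)
  then show ?thesis by (simp add: set_integrable_def)
qed

lemma power_div_fact_le_exp:
  fixes t :: real
  assumes "t \<ge> 0"
  shows "t ^ n / fact n \<le> exp t"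
  using sum_le_suminf[OF sums_summable[OF exp_converges[of t]], of "{n}"]
    sums_unique[OF exp_converges[of t]] assms
  by (simp add: divide_inverse mult.commute)

text \<open>The constant comes from one term of the exponential series, t^(M + 2) / (M + 2)! <= e^t
  at t = 1 + |x|. The two extra powers produce the integrable factor 1/(1 + x^2).\<close>

lemma poly_exp_decay_le:
  fixes x :: real
  shows "(1 + \<bar>x\<bar>) ^ M * exp (- (pi * \<bar>x\<bar>)) \<le> fact (M + 2) * exp 1 * (1 / (1 + x\<^sup>2))"
proof -
  define K where "K = fact (M + 2) * exp (1::real)"
    have "(1 + \<bar>x\<bar>) ^ (M + 2) / fact (M + 2) \<le> exp (1 + \<bar>x\<bar>)"
      by (rule power_div_fact_le_exp) simp
    then have "(1 + \<bar>x\<bar>) ^ (M + 2) * exp (- (pi * \<bar>x\<bar>)) \<le>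
        fact (M + 2) * exp (1 + \<bar>x\<bar>) * exp (- (pi * \<bar>x\<bar>))"
      by (intro mult_right_mono) (simp_all add: divide_le_eq mult.commute del: fact_Suc power_Suc)
    also have "\<dots> = K * exp (\<bar>x\<bar> - pi * \<bar>x\<bar>)"
      by (simp add: K_def exp_add exp_diff exp_minus field_simps)
    also have "\<dots> \<le> K"
      using mult_right_mono[of 1 pi "\<bar>x\<bar>"] pi_gt3 by (simp add: K_def)
    finally have le: "(1 + \<bar>x\<bar>)\<^sup>2 * ((1 + \<bar>x\<bar>) ^ M * exp (- (pi * \<bar>x\<bar>))) \<le> K"
      by (simp only: power_add mult_ac)
    have "(1 + x\<^sup>2) * ((1 + \<bar>x\<bar>) ^ M * exp (- (pi * \<bar>x\<bar>))) \<le>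
        (1 + \<bar>x\<bar>)\<^sup>2 * ((1 + \<bar>x\<bar>) ^ M * exp (- (pi * \<bar>x\<bar>)))"
      by (intro mult_right_mono) (auto simp: power2_sum)
    with le show ?thesis
      unfolding K_def[symmetric] by (simp add: field_simps add_pos_nonneg)
qed

lemma integrable_poly_exp_decay:
  fixes f :: "real \<Rightarrow> complex"
  assumes "continuous_on UNIV f"
    and bound: "\<And>x. norm (f x) \<le> C * (1 + \<bar>x\<bar>) ^ M * exp (- (pi * \<bar>x\<bar>))"
  shows "integrable lborel f"
proof -
  define K where "K = fact (M + 2) * exp (1::real)"
  have env: "(1 + \<bar>x\<bar>) ^ M * exp (- (pi * \<bar>x\<bar>)) \<le> K * (1 / (1 + x\<^sup>2))" for x :: real
    unfolding K_def by (rule poly_exp_decay_le)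
  have C: "C \<ge> 0" using order_trans[OF norm_ge_zero bound[of 0]] by simp
  show ?thesis
  proof (rule Bochner_Integration.integrable_bound)
    show "integrable lborel (\<lambda>x::real. C * (K * (1 / (1 + x\<^sup>2))))"
      by (intro integrable_mult_right integrable_one_over_one_plus_square)
    show "f \<in> borel_measurable lborel"
      using borel_measurable_continuous_onI[OF assms(1)] by simp
    have "norm (f x) \<le> norm (C * (K * (1 / (1 + x\<^sup>2))))" for x
    proof -
      have "norm (f x) \<le> C * ((1 + \<bar>x\<bar>) ^ M * exp (- (pi * \<bar>x\<bar>)))"
        using bound[of x] by (simp add: mult.assoc)
      also have "\<dots> \<le> C * (K * (1 / (1 + x\<^sup>2)))"
        by (intro mult_left_mono env C)
      finally show ?thesis by (rule order_trans) (simp only: real_norm_def abs_ge_self)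
    qed
    then show "AE x in lborel. norm (f x) \<le> norm (C * (K * (1 / (1 + x\<^sup>2))))" by simp
  qed
qed

text \<open>For real \<open>a\<close> this is |Gamma(a + ix)|^2; written without a modulus it is
  holomorphic in \<open>a\<close> on the right half-plane, as analytic continuation
  requires.\<close>

definition Gamma_pair :: "complex \<Rightarrow> real \<Rightarrow> complex" where
  "Gamma_pair a x = Gamma (a + \<i> * of_real x) * Gamma (a - \<i> * of_real x)"

text \<open>The factor \<open>1 / (\<Gamma>(2ix) \<Gamma>(-2ix))\<close> is written in the form given by the reflection formula.\<close>
definition dual_Hahn_weight :: "complex \<Rightarrow> complex \<Rightarrow> complex \<Rightarrow> real \<Rightarrow> complex" where
  "dual_Hahn_weight a b c x =
    of_real (2 * x * sinh (2 * pi * x) / pi) * (Gamma_pair a x * Gamma_pair b x * Gamma_pair c x)"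

lemma dual_Hahn_weight_permute:
  "dual_Hahn_weight a b c x = dual_Hahn_weight b a c x"
  "dual_Hahn_weight a b c x = dual_Hahn_weight a c b x"
  by (simp_all add: dual_Hahn_weight_def mult_ac)

lemma Gamma_pair_minus [simp]: "Gamma_pair a (- x) = Gamma_pair a x"
  by (simp add: Gamma_pair_def)

lemma dual_Hahn_weight_minus [simp]: "dual_Hahn_weight a b c (- x) = dual_Hahn_weight a b c x"
  by (simp add: dual_Hahn_weight_def)

lemma continuous_on_Gamma_line:
  assumes "\<And>x. Re (f x) > 0" "continuous_on A f"
  shows "continuous_on A (\<lambda>x. Gamma (f x) :: complex)"
proof (rule continuous_on_compose2[OF _ assms(2)])
  show "continuous_on {z. Re z > 0} (Gamma :: complex \<Rightarrow> complex)"
    by (rule continuous_on_Gamma) (auto dest: Re_pos_not_nonpos_Int)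
qed (use assms in auto)

lemma continuous_on_Gamma_pair: "Re a > 0 \<Longrightarrow> continuous_on A (Gamma_pair a)"
  unfolding Gamma_pair_def by (intro continuous_intros continuous_on_Gamma_line) auto

lemma continuous_on_dual_Hahn_weight:
  "Re a > 0 \<Longrightarrow> Re b > 0 \<Longrightarrow> Re c > 0 \<Longrightarrow> continuous_on A (dual_Hahn_weight a b c)"
  unfolding dual_Hahn_weight_def
  by (intro continuous_intros continuous_on_Gamma_pair) auto

text \<open>Since |\<beta> + x| + |\<beta> - x| >= 2|x|, a common imaginary offset \<beta> does not
  weaken the joint decay and enters only the constant. The form with separate \<open>u\<close> and
  \<open>v\<close> covers both the weight and the kernel used for the contour shift.\<close>

lemma norm_Gamma_mult_Gamma_bound:
  fixes \<sigma> \<tau> T :: real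
  assumes "\<sigma> > 0"
  obtains C M where "C > 0"
    "\<And>u v \<beta> x. \<lbrakk>\<sigma> \<le> Re u; Re u \<le> \<tau>; \<sigma> \<le> Re v; Re v \<le> \<tau>;
        Im u = \<beta> + x; Im v = \<beta> - x; \<bar>\<beta>\<bar> \<le> T\<rbrakk> \<Longrightarrow>
      norm (Gamma u * Gamma v) \<le> C * (1 + \<bar>x\<bar>) ^ M * exp (- (pi * \<bar>x\<bar>))"
proof -
  obtain C M where C: "C > 0" and bound: "\<And>z. \<sigma> \<le> Re z \<Longrightarrow> Re z \<le> \<tau> \<Longrightarrow>
      norm (Gamma z) \<le> C * (1 + \<bar>Im z\<bar>) ^ M * exp (- (pi * \<bar>Im z\<bar> / 2))"
    using norm_Gamma_vertical_bound[OF assms, of \<tau>] by metis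
  show ?thesis
  proof (rule that)
    show "(C * (1 + \<bar>T\<bar>) ^ M)\<^sup>2 > 0" using C by (simp add: zero_less_power)
    fix u v \<beta> x
    assume u: "\<sigma> \<le> Re u" "Re u \<le> \<tau>" "Im u = \<beta> + x" and v: "\<sigma> \<le> Re v" "Re v \<le> \<tau>" "Im v = \<beta> - x"
      and \<beta>: "\<bar>\<beta>\<bar> \<le> T"
    define E where "E = C * (1 + \<bar>T\<bar>) ^ M * (1 + \<bar>x\<bar>) ^ M"
    have E: "E > 0" using C by (simp add: E_def add_pos_nonneg)
    have one: "norm (Gamma z) \<le> E * exp (- (pi * \<bar>Im z\<bar> / 2))"
      if "\<sigma> \<le> Re z" "Re z \<le> \<tau>" "\<bar>Im z\<bar> \<le> \<bar>\<beta>\<bar> + \<bar>x\<bar>" for z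
    proof -
      have "0 \<le> \<bar>T\<bar> * \<bar>x\<bar>" "\<bar>\<beta>\<bar> \<le> \<bar>T\<bar>" using \<beta> by auto
      then have "1 + \<bar>Im z\<bar> \<le> (1 + \<bar>T\<bar>) * (1 + \<bar>x\<bar>)"
        using that unfolding distrib_left distrib_right by linarith
      then have "(1 + \<bar>Im z\<bar>) ^ M \<le> (1 + \<bar>T\<bar>) ^ M * (1 + \<bar>x\<bar>) ^ M"
        by (metis power_mono power_mult_distrib abs_ge_zero add_nonneg_nonneg zero_le_one)
      then have "C * (1 + \<bar>Im z\<bar>) ^ M * exp (- (pi * \<bar>Im z\<bar> / 2)) \<le> E * exp (- (pi * \<bar>Im z\<bar> / 2))"
        using C by (simp add: E_def)
      with bound[of z] that show ?thesis by linarith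
    qed
    have "norm (Gamma u * Gamma v) \<le>
       (E * exp (- (pi * \<bar>\<beta> + x\<bar> / 2))) * (E * exp (- (pi * \<bar>\<beta> - x\<bar> / 2)))"
      unfolding norm_mult using one[of u] one[of v] u v E by (intro mult_mono) auto
    also have "\<dots> = E\<^sup>2 * exp (- (pi / 2 * (\<bar>\<beta> + x\<bar> + \<bar>\<beta> - x\<bar>)))"
      by (simp add: power2_eq_square exp_add[symmetric] algebra_simps add_divide_distrib)
    also have "\<dots> \<le> E\<^sup>2 * exp (- (pi * \<bar>x\<bar>))"
    proof -
      have "pi / 2 * (2 * \<bar>x\<bar>) \<le> pi / 2 * (\<bar>\<beta> + x\<bar> + \<bar>\<beta> - x\<bar>)"
        by (intro mult_left_mono) auto
      then show ?thesis by (intro mult_left_mono) auto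
    qed
    also have "E\<^sup>2 = (C * (1 + \<bar>T\<bar>) ^ M)\<^sup>2 * (1 + \<bar>x\<bar>) ^ (M * 2)"
      by (simp add: E_def power_mult_distrib power_mult)
    finally show "norm (Gamma u * Gamma v) \<le>
      (C * (1 + \<bar>T\<bar>) ^ M)\<^sup>2 * (1 + \<bar>x\<bar>) ^ (M * 2) * exp (- (pi * \<bar>x\<bar>))" .
  qed
qed

lemma Gamma_pair_bound:
  fixes \<sigma> \<tau> T :: real
  assumes "\<sigma> > 0"
  obtains C M where "C > 0"
    "\<And>a x. \<sigma> \<le> Re a \<Longrightarrow> Re a \<le> \<tau> \<Longrightarrow> \<bar>Im a\<bar> \<le> T \<Longrightarrow>
      norm (Gamma_pair a x) \<le> C * (1 + \<bar>x\<bar>) ^ M * exp (- (pi * \<bar>x\<bar>))"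
proof -
  obtain C M where C: "C > 0" and bound: "\<And>u v \<beta> x. \<lbrakk>\<sigma> \<le> Re u; Re u \<le> \<tau>; \<sigma> \<le> Re v; Re v \<le> \<tau>;
        Im u = \<beta> + x; Im v = \<beta> - x; \<bar>\<beta>\<bar> \<le> T\<rbrakk> \<Longrightarrow>
      norm (Gamma u * Gamma v) \<le> C * (1 + \<bar>x\<bar>) ^ M * exp (- (pi * \<bar>x\<bar>))"
    using norm_Gamma_mult_Gamma_bound[OF assms, of \<tau> T] by metis
  show ?thesis
    by (rule that[OF C]) (unfold Gamma_pair_def, rule bound, auto)
qed

lemma sinh_factor_bound:
  "\<bar>2 * x * sinh (2 * pi * x) / pi\<bar> \<le> (1 + \<bar>x\<bar>) * exp (2 * pi * \<bar>x\<bar>)"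
proof -
  have "\<bar>sinh y\<bar> \<le> exp \<bar>y\<bar> / 2" for y :: real
    by (cases "y \<ge> 0") (auto simp: sinh_def abs_if field_simps)
  from this[of "2 * pi * x"] have s: "\<bar>sinh (2 * pi * x)\<bar> \<le> exp (2 * pi * \<bar>x\<bar>) / 2"
    by (simp add: abs_mult)
  have "\<bar>2 * x * sinh (2 * pi * x) / pi\<bar> = 2 * \<bar>x\<bar> / pi * \<bar>sinh (2 * pi * x)\<bar>"
    by (simp add: abs_mult)
  also have "\<dots> \<le> 2 * \<bar>x\<bar> / pi * (exp (2 * pi * \<bar>x\<bar>) / 2)"
    by (intro mult_left_mono s) auto
  also have "\<dots> = (\<bar>x\<bar> / pi) * exp (2 * pi * \<bar>x\<bar>)" by simp
  also have "\<dots> \<le> (1 + \<bar>x\<bar>) * exp (2 * pi * \<bar>x\<bar>)"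
  proof (intro mult_right_mono)
    have "\<bar>x\<bar> / pi \<le> \<bar>x\<bar>"
      using mult_left_mono[of 1 pi "\<bar>x\<bar>"] pi_gt3 by (simp add: field_simps)
    then show "\<bar>x\<bar> / pi \<le> 1 + \<bar>x\<bar>" by simp
  qed simp
  finally show ?thesis .
qed

text \<open>Three pairs decay like e^(-3 pi |x|) against a growth e^(2 pi |x|) of the sinh factor,
  leaving e^(-pi |x|). Uniformity over a box of parameters is what holomorphy in a parameter
  needs.\<close>

lemma dual_Hahn_weight_bound:
  fixes \<sigma> \<tau> T :: real
  assumes "\<sigma> > 0"
  obtains C M where "C > 0"
    "\<And>a b c x. \<forall>p\<in>{a, b, c}. \<sigma> \<le> Re p \<and> Re p \<le> \<tau> \<and> \<bar>Im p\<bar> \<le> T \<Longrightarrow>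
      norm (dual_Hahn_weight a b c x) \<le> C * (1 + \<bar>x\<bar>) ^ M * exp (- (pi * \<bar>x\<bar>))"
proof -
  obtain C M where C: "C > 0" and bound: "\<And>a x. \<sigma> \<le> Re a \<Longrightarrow> Re a \<le> \<tau> \<Longrightarrow> \<bar>Im a\<bar> \<le> T \<Longrightarrow>
      norm (Gamma_pair a x) \<le> C * (1 + \<bar>x\<bar>) ^ M * exp (- (pi * \<bar>x\<bar>))"
    using Gamma_pair_bound[OF assms, of \<tau> T] by metis
  show ?thesis
  proof (rule that)
    show "C ^ 3 > 0" using C by simp
    fix a b c x assume abc: "\<forall>p\<in>{a, b, c}. \<sigma> \<le> Re p \<and> Re p \<le> \<tau> \<and> \<bar>Im p\<bar> \<le> T"
    define B where "B = C * (1 + \<bar>x\<bar>) ^ M * exp (- (pi * \<bar>x\<bar>))"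
    have B: "B \<ge> 0" using C by (simp add: B_def)
    have "norm (dual_Hahn_weight a b c x) \<le> ((1 + \<bar>x\<bar>) * exp (2 * pi * \<bar>x\<bar>)) * (B * B * B)"
      unfolding dual_Hahn_weight_def norm_mult norm_of_real B_def
      using abc B by (intro mult_mono bound sinh_factor_bound) (auto simp: B_def)
    also have "B * B * B = C ^ 3 * ((1 + \<bar>x\<bar>) ^ (3 * M)) * (exp (- (pi * \<bar>x\<bar>)) * exp (- (pi * \<bar>x\<bar>)) * exp (- (pi * \<bar>x\<bar>)))"
      by (simp add: B_def power3_eq_cube mult_ac power_mult)
    also have "((1 + \<bar>x\<bar>) * exp (2 * pi * \<bar>x\<bar>)) * \<dots> =
      C ^ 3 * ((1 + \<bar>x\<bar>) ^ (3 * M + 1)) *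
        (exp (2 * pi * \<bar>x\<bar>) * (exp (- (pi * \<bar>x\<bar>)) * exp (- (pi * \<bar>x\<bar>)) * exp (- (pi * \<bar>x\<bar>))))"
      by (simp add: mult_ac)
    also have "exp (2 * pi * \<bar>x\<bar>) * (exp (- (pi * \<bar>x\<bar>)) * exp (- (pi * \<bar>x\<bar>)) * exp (- (pi * \<bar>x\<bar>))) =
       exp (- (pi * \<bar>x\<bar>))"
      by (simp add: exp_add[symmetric])
    finally show "norm (dual_Hahn_weight a b c x) \<le> C ^ 3 * (1 + \<bar>x\<bar>) ^ (3 * M + 1) * exp (- (pi * \<bar>x\<bar>))" .
  qed
qed

lemma dual_Hahn_weight_bound_fixed:
  assumes "Re a > 0" "Re b > 0" "Re c > 0"
  obtains C M where "C > 0"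
    "\<And>x. norm (dual_Hahn_weight a b c x) \<le> C * (1 + \<bar>x\<bar>) ^ M * exp (- (pi * \<bar>x\<bar>))"
proof -
  define \<sigma> where "\<sigma> = min (Re a) (min (Re b) (Re c))"
  have "\<sigma> > 0" using assms by (simp add: \<sigma>_def)
  from dual_Hahn_weight_bound[OF this, of "max (Re a) (max (Re b) (Re c))" "\<bar>Im a\<bar> + \<bar>Im b\<bar> + \<bar>Im c\<bar>"]
  obtain C M where "C > 0" and *: "\<And>a' b' c' x. \<forall>p\<in>{a', b', c'}. \<sigma> \<le> Re p \<and>
      Re p \<le> max (Re a) (max (Re b) (Re c)) \<and> \<bar>Im p\<bar> \<le> \<bar>Im a\<bar> + \<bar>Im b\<bar> + \<bar>Im c\<bar> \<Longrightarrow>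
      norm (dual_Hahn_weight a' b' c' x) \<le> C * (1 + \<bar>x\<bar>) ^ M * exp (- (pi * \<bar>x\<bar>))"
    by metis
  show ?thesis
    by (rule that[OF \<open>C > 0\<close> *]) (auto simp: \<sigma>_def)
qed

lemma integrable_dual_Hahn_weight:
  assumes "Re a > 0" "Re b > 0" "Re c > 0"
  shows "integrable lborel (dual_Hahn_weight a b c)"
proof -
  obtain C M where "\<And>x. norm (dual_Hahn_weight a b c x) \<le> C * (1 + \<bar>x\<bar>) ^ M * exp (- (pi * \<bar>x\<bar>))"
    using dual_Hahn_weight_bound_fixed[OF assms] by metis
  with continuous_on_dual_Hahn_weight[OF assms] show ?thesis
    by (rule integrable_poly_exp_decay)
qed

text \<open>Domination of \<open>g\<close> alone suffices: Cauchy's inequality turns it into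
  domination of the derivative on a smaller ball, hence of the difference quotients, and dominated
  convergence does the rest along sequences.\<close>

lemma holomorphic_on_integral_parameter:
  fixes g :: "complex \<Rightarrow> 'a \<Rightarrow> complex"
  assumes "open S"
    and hol: "\<And>x. (\<lambda>z. g z x) holomorphic_on S"
    and meas: "\<And>z. z \<in> S \<Longrightarrow> g z \<in> borel_measurable M"
    and dom: "\<And>z. z \<in> S \<Longrightarrow> \<exists>r>0. \<exists>h. integrable M h \<and> ball z r \<subseteq> S \<and>
      (\<forall>w\<in>ball z r. \<forall>x. norm (g w x) \<le> h x)"
  shows "(\<lambda>z. integral\<^sup>L M (g z)) holomorphic_on S"
proof -
  have "(\<lambda>z. integral\<^sup>L M (g z)) field_differentiable (at z)" if z: "z \<in> S" for z
  proof -
    obtain r h where r: "r > 0" and h: "integrable M h" and sub: "ball z r \<subseteq> S"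
      and le: "\<And>w x. w \<in> ball z r \<Longrightarrow> norm (g w x) \<le> h x"
      using dom[OF z] by metis
    have int: "integrable M (g w)" if "w \<in> ball z r" for w
      using le[OF that] that sub
      by (intro Bochner_Integration.integrable_bound[OF h meas] AE_I2)
         (auto intro: order_trans[OF _ abs_ge_self])
    have deriv: "((\<lambda>w. g w x) has_field_derivative deriv (\<lambda>w. g w x) w) (at w)" if "w \<in> S" for w x
      using hol[of x] assms(1) that by (rule holomorphic_derivI)
    have lip: "norm (g w x - g z x) \<le> 3 / r * h x * norm (w - z)" if w: "w \<in> ball z (r/2)" for w x
    proof (rule field_differentiable_bound[of "ball z (r/2)" "\<lambda>w. g w x" "deriv (\<lambda>w. g w x)"])
      fix v assume v: "v \<in> ball z (r/2)"
      \<comment> \<open>The radii 1/2 and 1/3 add up to less than 1, so Cauchy discs around points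
        of the half ball stay inside the ball where \<open>h\<close> dominates.\<close>
      have sub': "cball v (r/3) \<subseteq> ball z r"
      proof
        fix u assume "u \<in> cball v (r/3)"
        then show "u \<in> ball z r" using v r dist_triangle[of z u v] by (simp add: dist_commute)
      qed
      show "((\<lambda>w. g w x) has_field_derivative deriv (\<lambda>w. g w x) v) (at v within ball z (r/2))"
        by (rule has_field_derivative_at_within, rule deriv) (use sub' sub r in \<open>auto simp: subset_iff\<close>)
      have hs: "(\<lambda>w. g w x) holomorphic_on cball v (r/3)"
        by (rule holomorphic_on_subset[OF hol]) (use sub sub' in auto)
      have "norm ((deriv ^^ 1) (\<lambda>w. g w x) v) \<le> fact 1 * h x / (r/3) ^ 1"
      proof (rule Cauchy_inequality)
        show "(\<lambda>w. g w x) holomorphic_on ball v (r/3)"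
          by (rule holomorphic_on_subset[OF hs]) auto
        show "continuous_on (cball v (r/3)) (\<lambda>w. g w x)"
          using hs by (rule holomorphic_on_imp_continuous_on)
        show "norm (g u x) \<le> h x" if "norm (v - u) = r/3" for u
          using that sub' by (intro le) (auto simp: dist_norm subset_iff)
      qed (use r in auto)
      then show "norm (deriv (\<lambda>w. g w x) v) \<le> 3 / r * h x" by (simp add: mult_ac)
    qed (use r w in auto)
    have "((\<lambda>w. (integral\<^sup>L M (g w) - integral\<^sup>L M (g z)) / (w - z)) \<longlongrightarrow>
        integral\<^sup>L M (\<lambda>x. deriv (\<lambda>w. g w x) z)) (at z)"
      unfolding tendsto_at_iff_sequentially
      proof (intro allI impI)
        fix X :: "nat \<Rightarrow> complex" assume X: "\<forall>i. X i \<in> UNIV - {z}" "X \<longlonglongrightarrow> z"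
        have "\<forall>\<^sub>F i in sequentially. X i \<in> ball z (r/2)"
          using X(2) r by (intro topological_tendstoD) auto
        \<comment> \<open>Dominated convergence asks for its bound at every index, so the sequence
          is replaced by a tail inside the half ball.\<close>
        then obtain N where N: "\<And>i. X (i + N) \<in> ball z (r/2)"
          by (metis eventually_sequentially le_add2)
        define Y where "Y i = X (i + N)" for i
        have Y: "Y i \<noteq> z" "Y i \<in> ball z (r/2)" "Y i \<in> ball z r" "Y i \<in> S" for i
          using X(1) N[of i] sub r by (auto simp: Y_def)
        have Ylim: "Y \<longlonglongrightarrow> z" unfolding Y_def using X(2) by (rule LIMSEQ_ignore_initial_segment)
        have q: "(\<lambda>i. (g (Y i) x - g z x) / (Y i - z)) \<longlonglongrightarrow> deriv (\<lambda>w. g w x) z" for x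
        proof -
          have "((\<lambda>w. (g w x - g z x) / (w - z)) \<longlongrightarrow> deriv (\<lambda>w. g w x) z) (at z)"
            using deriv[OF z, of x] by (simp add: has_field_derivative_iff)
          then show ?thesis
            using Y(1) Ylim unfolding tendsto_at_iff_sequentially comp_def by blast
        qed
        have "(\<lambda>i. integral\<^sup>L M (\<lambda>x. (g (Y i) x - g z x) / (Y i - z))) \<longlonglongrightarrow>
          integral\<^sup>L M (\<lambda>x. deriv (\<lambda>w. g w x) z)"
        proof (rule integral_dominated_convergence[where w = "\<lambda>x. 3 / r * h x"])
          show mq: "(\<lambda>x. (g (Y i) x - g z x) / (Y i - z)) \<in> borel_measurable M" for i
            using meas[OF Y(4)[of i]] meas[OF z] by measurable
          show "(\<lambda>x. deriv (\<lambda>w. g w x) z) \<in> borel_measurable M"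
            by (rule borel_measurable_LIMSEQ_metric[OF mq q])
          show "integrable M (\<lambda>x. 3 / r * h x)" using h by simp
          show "AE x in M. norm ((g (Y i) x - g z x) / (Y i - z)) \<le> 3 / r * h x" for i
            using lip[OF Y(2)[of i]] Y(1)[of i] by (auto simp: norm_divide divide_le_eq)
        qed (use q in auto)
        moreover have "integral\<^sup>L M (\<lambda>x. (g (Y i) x - g z x) / (Y i - z)) =
            (integral\<^sup>L M (g (Y i)) - integral\<^sup>L M (g z)) / (Y i - z)" for i
          using int[OF Y(3)[of i]] int[of z] r by (simp add: Bochner_Integration.integral_diff)
        ultimately have "(\<lambda>i. (integral\<^sup>L M (g (X (i + N))) - integral\<^sup>L M (g z)) / (X (i + N) - z)) \<longlonglongrightarrow>
          integral\<^sup>L M (\<lambda>x. deriv (\<lambda>w. g w x) z)"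
          by (simp only: Y_def)
        then show "((\<lambda>w. (integral\<^sup>L M (g w) - integral\<^sup>L M (g z)) / (w - z)) \<circ> X) \<longlonglongrightarrow>
          integral\<^sup>L M (\<lambda>x. deriv (\<lambda>w. g w x) z)"
          unfolding comp_def by (rule LIMSEQ_offset)
    qed
    then show ?thesis
      unfolding field_differentiable_def has_field_derivative_iff by blast
  qed
  then show ?thesis
    using field_differentiable_at_within unfolding holomorphic_on_def by blast
qed

section \<open>The total mass as a holomorphic function of a parameter\<close>

definition dual_Hahn_integral :: "complex \<Rightarrow> complex \<Rightarrow> complex \<Rightarrow> complex" where
  "dual_Hahn_integral a b c = integral\<^sup>L lborel (dual_Hahn_weight a b c)"

lemma dual_Hahn_integral_permute:
  "dual_Hahn_integral a b c = dual_Hahn_integral b a c"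
  "dual_Hahn_integral a b c = dual_Hahn_integral a c b"
proof -
  have "dual_Hahn_weight a b c = dual_Hahn_weight b a c" "dual_Hahn_weight a b c = dual_Hahn_weight a c b"
    using dual_Hahn_weight_permute by blast+
  then show "dual_Hahn_integral a b c = dual_Hahn_integral b a c"
    "dual_Hahn_integral a b c = dual_Hahn_integral a c b"
    unfolding dual_Hahn_integral_def by simp_all
qed

lemma holomorphic_dual_Hahn_integral:
  assumes "Re b > 0" "Re c > 0"
  shows "(\<lambda>a. dual_Hahn_integral a b c) holomorphic_on {a. Re a > 0}"
  unfolding dual_Hahn_integral_def
proof (rule holomorphic_on_integral_parameter)
  show "open {a. Re a > 0}" by (rule open_halfspace_Re_gt)
  show "(\<lambda>a. dual_Hahn_weight a b c x) holomorphic_on {a. Re a > 0}" for x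
    unfolding dual_Hahn_weight_def Gamma_pair_def
    by (intro holomorphic_intros) (auto intro!: Re_pos_not_nonpos_Int)
  show "dual_Hahn_weight a b c \<in> borel_measurable lborel" if "a \<in> {a. Re a > 0}" for a
    using integrable_dual_Hahn_weight[of a b c] that assms by (auto dest: borel_measurable_integrable)
  fix a assume "a \<in> {a. 0 < Re a}"
  then have a: "Re a > 0" by simp
  \<comment> \<open>Half the distance to the imaginary axis: real parts on the ball stay above
    \<open>r\<close>, so one box of parameters covers it.\<close>
  define r where "r = Re a / 2"
  define \<sigma> where "\<sigma> = min r (min (Re b) (Re c))"
  define \<tau> where "\<tau> = max (Re a + r) (max (Re b) (Re c))"
  define T where "T = max (\<bar>Im a\<bar> + r) (max \<bar>Im b\<bar> \<bar>Im c\<bar>)"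
  have r: "r > 0" and \<sigma>: "\<sigma> > 0" using a assms by (auto simp: r_def \<sigma>_def)
  obtain C M where C: "C > 0" and bound: "\<And>a b c x. \<forall>p\<in>{a, b, c}. \<sigma> \<le> Re p \<and> Re p \<le> \<tau> \<and> \<bar>Im p\<bar> \<le> T \<Longrightarrow>
      norm (dual_Hahn_weight a b c x) \<le> C * (1 + \<bar>x\<bar>) ^ M * exp (- (pi * \<bar>x\<bar>))"
    using dual_Hahn_weight_bound[OF \<sigma>, of \<tau> T] by metis
  have near: "\<sigma> \<le> Re w \<and> Re w \<le> \<tau> \<and> \<bar>Im w\<bar> \<le> T" if "w \<in> ball a r" for w
    using that abs_Re_le_cmod[of "a - w"] abs_Im_le_cmod[of "a - w"]
    unfolding \<sigma>_def \<tau>_def T_def r_def by (auto simp: dist_norm)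
  have "integrable lborel (\<lambda>x. norm (complex_of_real (C * (1 + \<bar>x\<bar>) ^ M * exp (- (pi * \<bar>x\<bar>)))))"
  proof (rule integrable_norm, rule integrable_poly_exp_decay)
    show "norm (complex_of_real (C * (1 + \<bar>x\<bar>) ^ M * exp (- (pi * \<bar>x\<bar>)))) \<le>
        C * (1 + \<bar>x\<bar>) ^ M * exp (- (pi * \<bar>x\<bar>))" for x
      using C unfolding norm_of_real by (simp add: abs_mult)
  qed (intro continuous_intros)
  moreover have "norm (complex_of_real (C * (1 + \<bar>x\<bar>) ^ M * exp (- (pi * \<bar>x\<bar>)))) =
      C * (1 + \<bar>x\<bar>) ^ M * exp (- (pi * \<bar>x\<bar>))" for x
    using C unfolding norm_of_real by (simp add: abs_mult)
  ultimately have "integrable lborel (\<lambda>x. C * (1 + \<bar>x\<bar>) ^ M * exp (- (pi * \<bar>x\<bar>)))"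
    by simp
  moreover have "ball a r \<subseteq> {a. Re a > 0}"
    using near \<sigma> by force
  moreover have "\<forall>w\<in>ball a r. \<forall>x. norm (dual_Hahn_weight w b c x) \<le> C * (1 + \<bar>x\<bar>) ^ M * exp (- (pi * \<bar>x\<bar>))"
    using near by (intro ballI allI bound) (auto simp: \<sigma>_def \<tau>_def T_def)
  ultimately show "\<exists>r>0. \<exists>h. integrable lborel h \<and> ball a r \<subseteq> {a. 0 < Re a} \<and>
      (\<forall>w\<in>ball a r. \<forall>x. norm (dual_Hahn_weight w b c x) \<le> h x)"
    using r by blast
qed

subsection \<open>Shifting a parameter of the total mass\<close>

lemma norm_sin_le_exp: "norm (sin z :: complex) \<le> exp \<bar>Im z\<bar>"
  using cmod_sin_le_exp[of 1 z] by simp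

text \<open>
  This function is antisymmetric under \<open>s \<mapsto> 1 - s\<close>, so that moving the line of integration
  across the strip changes the sign of its integral.
\<close>
definition shift_kernel :: "complex \<Rightarrow> complex \<Rightarrow> complex \<Rightarrow> complex \<Rightarrow> complex" where
  "shift_kernel a b c s = sin (2 * of_real pi * s) / of_real pi *
    ((Gamma (a + s) * Gamma (a + 1 - s)) * (Gamma (b + s) * Gamma (b + 1 - s)) *
     (Gamma (c + s) * Gamma (c + 1 - s)))"

lemma shift_kernel_reflect: "shift_kernel a b c (1 - s) = - shift_kernel a b c s"
proof -
  have "sin (2 * of_real pi * (1 - s)) = - sin (2 * of_real pi * s)"
    using sin_of_real[of "2 * pi", where ?'a = complex] cos_of_real[of "2 * pi", where ?'a = complex]
    by (simp add: sin_diff right_diff_distrib)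
  then show ?thesis by (simp add: shift_kernel_def add_diff_eq mult_ac)
qed

lemma shift_kernel_bound:
  assumes "Re a > 0" "Re b > 0" "Re c > 0"
  obtains C M where "C > 0" "\<And>s. 0 \<le> Re s \<Longrightarrow> Re s \<le> 1 \<Longrightarrow>
    norm (shift_kernel a b c s) \<le> C * (1 + \<bar>Im s\<bar>) ^ M * exp (- (pi * \<bar>Im s\<bar>))"
proof -
  define \<sigma> where "\<sigma> = min (Re a) (min (Re b) (Re c))"
  define \<tau> where "\<tau> = max (Re a) (max (Re b) (Re c)) + 1"
  define T where "T = max \<bar>Im a\<bar> (max \<bar>Im b\<bar> \<bar>Im c\<bar>)"
  have \<sigma>: "\<sigma> > 0" using assms by (simp add: \<sigma>_def)
  obtain C M where C: "C > 0" and bound: "\<And>u v \<beta> x. \<lbrakk>\<sigma> \<le> Re u; Re u \<le> \<tau>; \<sigma> \<le> Re v; Re v \<le> \<tau>;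
        Im u = \<beta> + x; Im v = \<beta> - x; \<bar>\<beta>\<bar> \<le> T\<rbrakk> \<Longrightarrow>
      norm (Gamma u * Gamma v) \<le> C * (1 + \<bar>x\<bar>) ^ M * exp (- (pi * \<bar>x\<bar>))"
    using norm_Gamma_mult_Gamma_bound[OF \<sigma>, of \<tau> T] by metis
  show ?thesis
  proof (rule that)
    show "C ^ 3 > 0" using C by simp
    fix s assume s: "0 \<le> Re s" "Re s \<le> 1"
    define x where "x = Im s"
    define B where "B = C * (1 + \<bar>x\<bar>) ^ M * exp (- (pi * \<bar>x\<bar>))"
    have B: "B \<ge> 0" using C by (simp add: B_def)
    have pair: "norm (Gamma (p + s) * Gamma (p + 1 - s)) \<le> B" if "p \<in> {a, b, c}" for p
      unfolding B_def
      by (rule bound[where \<beta> = "Im p"]) (use that s in \<open>auto simp: \<sigma>_def \<tau>_def T_def x_def\<close>)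
    have "norm (sin (2 * of_real pi * s) / of_real pi) \<le> exp \<bar>Im (2 * of_real pi * s)\<bar>"
      using frac_le[OF _ norm_sin_le_exp[of "2 * of_real pi * s"] zero_less_one, of pi] pi_gt3
      by (simp add: norm_divide)
    also have "\<bar>Im (2 * of_real pi * s)\<bar> = 2 * pi * \<bar>x\<bar>" by (simp add: x_def abs_mult)
    finally have "norm (shift_kernel a b c s) \<le> exp (2 * pi * \<bar>x\<bar>) * (B * B * B)"
      unfolding shift_kernel_def norm_mult[of "sin (2 * of_real pi * s) / of_real pi"]
        norm_mult[of "_ * _ * (_ * _)"] norm_mult[of "Gamma (a + s) * Gamma (a + 1 - s)"]
      using B by (intro mult_mono pair) auto
    also have "B * B * B = C ^ 3 * ((1 + \<bar>x\<bar>) ^ (3 * M)) * (exp (- (pi * \<bar>x\<bar>)) * exp (- (pi * \<bar>x\<bar>)) * exp (- (pi * \<bar>x\<bar>)))"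
      by (simp add: B_def power3_eq_cube mult_ac power_mult)
    also have "exp (2 * pi * \<bar>x\<bar>) * \<dots> = C ^ 3 * ((1 + \<bar>x\<bar>) ^ (3 * M)) *
        (exp (2 * pi * \<bar>x\<bar>) * (exp (- (pi * \<bar>x\<bar>)) * exp (- (pi * \<bar>x\<bar>)) * exp (- (pi * \<bar>x\<bar>))))"
      by (simp add: mult_ac)
    also have "exp (2 * pi * \<bar>x\<bar>) * (exp (- (pi * \<bar>x\<bar>)) * exp (- (pi * \<bar>x\<bar>)) * exp (- (pi * \<bar>x\<bar>))) =
       exp (- (pi * \<bar>x\<bar>))"
      by (simp add: exp_add[symmetric])
    finally show "norm (shift_kernel a b c s) \<le> C ^ 3 * (1 + \<bar>Im s\<bar>) ^ (3 * M) * exp (- (pi * \<bar>Im s\<bar>))"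
      by (simp only: x_def)
  qed
qed

text \<open>On the imaginary axis the recurrence turns the kernel into the weight times (a - s)(b -
  s)(c - s) / s, up to a constant; adding the value at -s extracts the odd part of the cubic. The
  resulting factor equals (a + b)(a + c) - (a^2 + x^2), the difference of the two sides of the shift
  relation.\<close>

lemma shift_kernel_line:
  assumes "Re a > 0" "Re b > 0" "Re c > 0"
  shows "shift_kernel a b c (\<i> * of_real x) + shift_kernel a b c (\<i> * of_real (- x)) =
    (a * b + a * c + b * c - (of_real x)\<^sup>2) * dual_Hahn_weight a b c x"
proof -
  define s where "s = \<i> * complex_of_real x"
  have G: "Gamma (p + 1 - s) = (p - s) * Gamma (p - s)" "Gamma (p + 1 + s) = (p + s) * Gamma (p + s)"
    if "Re p > 0" for p
    using Gamma_plus1[of "p - s"] Gamma_plus1[of "p + s"] that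
    by (auto simp: Re_pos_not_nonpos_Int s_def algebra_simps)
  have "2 * of_real pi * s = \<i> * of_real (2 * pi * x)" by (simp add: s_def)
  then have sn: "sin (2 * of_real pi * s) = \<i> * of_real (sinh (2 * pi * x))"
    by (simp add: sinh_def sin_exp_eq scaleR_conv_of_real exp_of_real[symmetric] field_simps)
  define K where "K = \<i> * complex_of_real (sinh (2 * pi * x)) / of_real pi"
  define P where "P = Gamma_pair a x * Gamma_pair b x * Gamma_pair c x"
  have P: "P = (Gamma (a + s) * Gamma (a - s)) * (Gamma (b + s) * Gamma (b - s)) *
      (Gamma (c + s) * Gamma (c - s))"
    by (simp add: P_def Gamma_pair_def s_def)
  have "shift_kernel a b c s = K * P * ((a - s) * (b - s) * (c - s))"
    unfolding shift_kernel_def sn G(1)[OF assms(1)] G(1)[OF assms(2)] G(1)[OF assms(3)] K_def P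
    by (simp only: mult_ac)
  moreover have "shift_kernel a b c (- s) = - (K * P * ((a + s) * (b + s) * (c + s)))"
  proof -
    have "sin (2 * of_real pi * (- s)) = - (\<i> * of_real (sinh (2 * pi * x)))"
      using sn by simp
    then show ?thesis
      unfolding shift_kernel_def K_def P diff_minus_eq_add G(2)[OF assms(1)] G(2)[OF assms(2)]
        G(2)[OF assms(3)] by (simp add: mult_ac)
  qed
  ultimately have "shift_kernel a b c s + shift_kernel a b c (- s) =
    K * P * ((a - s) * (b - s) * (c - s) - (a + s) * (b + s) * (c + s))"
    by (simp add: right_diff_distrib)
  also have "(a - s) * (b - s) * (c - s) - (a + s) * (b + s) * (c + s) = -2 * s * (a * b + a * c + b * c + s\<^sup>2)"
    by (simp add: power2_eq_square algebra_simps)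
  also have "s\<^sup>2 = - (of_real x)\<^sup>2" by (simp add: s_def power_mult_distrib)
  finally have "shift_kernel a b c s + shift_kernel a b c (- s) =
    K * P *
    (-2 * s * (a * b + a * c + b * c + - (of_real x)\<^sup>2))" .
  then show ?thesis
    by (simp add: s_def dual_Hahn_weight_def K_def P_def mult_ac)
qed

text \<open>A primitive on the strip replaces the rectangular contour. By antisymmetry of the
  kernel, F(s) - F(1 - s) is constant, so twice the integral over a segment of the axis equals a
  difference of two horizontal crossings of the strip, and these tend to 0.\<close>

lemma shift_kernel_integral:
  assumes pos: "Re a > 0" "Re b > 0" "Re c > 0"
  shows "integrable lborel (\<lambda>x. shift_kernel a b c (\<i> * of_real x))"
    "integral\<^sup>L lborel (\<lambda>x. shift_kernel a b c (\<i> * of_real x)) = 0"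
proof -
  \<comment> \<open>The strip 0 <= Re s <= 1 is widened by \<open>e\<close> on both sides: it
    becomes open, and all six Gamma arguments still have positive real part.\<close>
  define e where "e = min (Re a) (min (Re b) (Re c))"
  have e: "e > 0" using pos by (simp add: e_def)
  define S where "S = {s. Re s > - e} \<inter> {s. Re s < 1 + e}"
  define f where "f = shift_kernel a b c"
  have S: "open S" "convex S"
    unfolding S_def by (auto intro!: open_Int open_halfspace_Re_gt open_halfspace_Re_lt
      convex_Int convex_halfspace_Re_gt convex_halfspace_Re_lt)
  have hol: "f holomorphic_on S"
    unfolding f_def shift_kernel_def
    by (intro holomorphic_intros) (auto intro!: Re_pos_not_nonpos_Int simp: S_def e_def)
  obtain F where F: "\<And>s. s \<in> S \<Longrightarrow> (F has_field_derivative f s) (at s)"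
    using holomorphic_convex_primitive'[OF S(2,1) hol] at_within_open[OF _ S(1)] by metis
  obtain C M where C: "C > 0" and bound: "\<And>s. 0 \<le> Re s \<Longrightarrow> Re s \<le> 1 \<Longrightarrow>
      norm (f s) \<le> C * (1 + \<bar>Im s\<bar>) ^ M * exp (- (pi * \<bar>Im s\<bar>))"
    using shift_kernel_bound[OF pos] unfolding f_def by metis
  have cont: "continuous_on A (\<lambda>x. f (\<i> * of_real x))" for A
  proof (rule continuous_on_compose2[OF holomorphic_on_imp_continuous_on[OF hol]])
    show "(\<lambda>x. \<i> * complex_of_real x) ` A \<subseteq> S" using e by (auto simp: S_def)
  qed (intro continuous_intros)
  show int: "integrable lborel (\<lambda>x. shift_kernel a b c (\<i> * of_real x))"
    using integrable_poly_exp_decay[OF cont, of C M] bound[of "\<i> * of_real _"]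
    by (simp add: f_def)
  have refl: "1 - s \<in> S" if "s \<in> S" for s using that by (auto simp: S_def)
  have "\<exists>k. \<forall>s\<in>S. F s - F (1 - s) = k"
  proof (rule has_field_derivative_zero_constant[OF S(2)])
    fix s assume s: "s \<in> S"
    have "((\<lambda>s. F (1 - s)) has_field_derivative (f (1 - s) * (0 - 1))) (at s)"
      by (intro DERIV_chain2[where f = F and g = "\<lambda>s. 1 - s", OF F[OF refl[OF s]]] derivative_intros)
    from DERIV_diff[OF F[OF s] this]
    have "((\<lambda>s. F s - F (1 - s)) has_field_derivative 0) (at s)"
      by (simp add: f_def shift_kernel_reflect)
    then show "((\<lambda>s. F s - F (1 - s)) has_field_derivative 0) (at s within S)"
      by (rule has_field_derivative_at_within)
  qed
  then obtain k where k: "\<And>s. s \<in> S \<Longrightarrow> F s - F (1 - s) = k" by metis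
  define B where "B n = C * (fact (M + 2) * exp 1 * (1 / (1 + (real n)\<^sup>2)))" for n
  define A where "A n = F (\<i> * of_nat n) - F (\<i> * of_real (- real n))" for n
  have cross: "norm (F (\<i> * of_real y) - F (1 + \<i> * of_real y)) \<le> B n" if y: "\<bar>y\<bar> = real n" for y n
  proof -
    define Z where "Z = closed_segment (\<i> * complex_of_real y) (1 + \<i> * of_real y)"
    have Z: "0 \<le> Re s \<and> Re s \<le> 1 \<and> Im s = y" if "s \<in> Z" for s
      using that unfolding Z_def closed_segment_def by (auto simp: algebra_simps)
    have deriv: "(F has_field_derivative f s) (at s within Z)" if "s \<in> Z" for s
      using Z[OF that] e by (intro has_field_derivative_at_within[OF F]) (auto simp: S_def)
    have bnd: "norm (f s) \<le> B n" if "s \<in> Z" for s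
    proof -
      have "norm (f s) \<le> C * ((1 + \<bar>y\<bar>) ^ M * exp (- (pi * \<bar>y\<bar>)))"
        using bound[of s] Z[OF that] by (simp add: mult.assoc)
      also have "\<dots> \<le> C * (fact (M + 2) * exp 1 * (1 / (1 + y\<^sup>2)))"
        using C by (intro mult_left_mono poly_exp_decay_le) auto
      also have "y\<^sup>2 = (real n)\<^sup>2" using y by (metis power2_abs)
      finally show ?thesis by (simp only: B_def)
    qed
    have "norm (F (\<i> * of_real y) - F (1 + \<i> * of_real y)) \<le>
        B n * norm (\<i> * of_real y - (1 + \<i> * of_real y))"
      by (rule field_differentiable_bound[OF _ deriv bnd]) (simp_all add: Z_def)
    then show ?thesis by simp
  qed
  have A_bound: "norm (A n) \<le> B n" for n
  proof -
    have in_S: "\<i> * of_real (real n) \<in> S" "\<i> * of_real (- real n) \<in> S"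
      using e by (auto simp: S_def)
    \<comment> \<open>The constant \<open>k\<close> exchanges the endpoints on Re s = 1 for those on
      the axis with opposite height, which doubles \<open>A n\<close> instead of cancelling
      it.\<close>
    have "2 * A n = (F (\<i> * of_real (real n)) - F (1 + \<i> * of_real (real n))) -
        (F (\<i> * of_real (- real n)) - F (1 + \<i> * of_real (- real n)))"
      using k[OF in_S(1)] k[OF in_S(2)] by (simp add: A_def algebra_simps)
    also have "norm \<dots> \<le> B n + B n"
      by (intro order_trans[OF norm_triangle_ineq4] add_mono cross) auto
    finally show ?thesis by (simp add: norm_mult)
  qed
  have B: "B \<longlonglongrightarrow> 0" unfolding B_def by real_asymp
  have A0: "A \<longlonglongrightarrow> 0"
    by (rule Lim_null_comparison[OF _ B]) (use A_bound in auto)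
  have "(\<lambda>n. integral\<^sup>L lborel (\<lambda>x. indicator {- real n..real n} x *\<^sub>R f (\<i> * of_real x))) \<longlonglongrightarrow>
      integral\<^sup>L lborel (\<lambda>x. f (\<i> * of_real x))"
  proof (rule integral_dominated_convergence[where w = "\<lambda>x. norm (f (\<i> * of_real x))"])
    show "integrable lborel (\<lambda>x. norm (f (\<i> * complex_of_real x)))"
      using int by (simp add: f_def)
    show "(\<lambda>x. f (\<i> * complex_of_real x)) \<in> borel_measurable lborel"
      using int by (simp add: f_def)
    then show "(\<lambda>x. indicator {- real n..real n} x *\<^sub>R f (\<i> * of_real x)) \<in> borel_measurable lborel" for n
      by measurable
    show "AE x in lborel. (\<lambda>n. indicator {- real n..real n} x *\<^sub>R f (\<i> * of_real x)) \<longlonglongrightarrow> f (\<i> * of_real x)"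
    proof (intro AE_I2 tendsto_eventually)
      fix x :: real
      obtain N where "\<bar>x\<bar> \<le> real N" using real_arch_simple by blast
      then show "\<forall>\<^sub>F n in sequentially. indicator {- real n..real n} x *\<^sub>R f (\<i> * of_real x) = f (\<i> * of_real x)"
        by (intro eventually_sequentiallyI[of N]) (auto simp: indicator_def)
    qed
    show "AE x in lborel. norm (indicator {- real n..real n} x *\<^sub>R f (\<i> * of_real x)) \<le> norm (f (\<i> * of_real x))" for n
      by (auto simp: indicator_def)
  qed
  moreover have "\<i> * integral\<^sup>L lborel (\<lambda>x. indicator {- real n..real n} x *\<^sub>R f (\<i> * of_real x)) = A n" for n
  proof -
    have si: "set_integrable lborel {- real n..real n} (\<lambda>x. f (\<i> * of_real x))"
      using int unfolding set_integrable_def f_def[symmetric] by (rule integrable_mult_indicator[rotated]) simp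
    have "((\<lambda>x. F (\<i> * of_real x)) has_vector_derivative \<i> * f (\<i> * of_real x)) (at x within A)" for x A
    proof -
      have "\<i> * of_real x \<in> S" using e by (simp add: S_def)
      note F[OF this]
      moreover have "((\<lambda>x. \<i> * complex_of_real x) has_vector_derivative \<i>) (at x within A)"
        by (auto intro!: derivative_eq_intros)
      ultimately show ?thesis
        using field_vector_diff_chain_within[of "\<lambda>x. \<i> * of_real x" \<i> x A F "f (\<i> * of_real x)"]
        by (simp add: comp_def has_field_derivative_at_within)
    qed
    then have "((\<lambda>x. \<i> * f (\<i> * of_real x)) has_integral
        (F (\<i> * of_real (real n)) - F (\<i> * of_real (- real n)))) {- real n..real n}"
      by (intro fundamental_theorem_of_calculus) auto
    from integral_unique[OF this]
    have "A n = integral {- real n..real n} (\<lambda>x. \<i> * f (\<i> * of_real x))"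
      unfolding A_def of_real_of_nat_eq by (rule sym)
    also have "\<dots> = \<i> * integral {- real n..real n} (\<lambda>x. f (\<i> * of_real x))"
      by simp
    also have "integral {- real n..real n} (\<lambda>x. f (\<i> * of_real x)) =
        integral\<^sup>L lborel (\<lambda>x. indicator {- real n..real n} x *\<^sub>R f (\<i> * of_real x))"
      using set_borel_integral_eq_integral(2)[OF si] by (simp add: set_lebesgue_integral_def)
    finally show ?thesis by simp
  qed
  ultimately have "A \<longlonglongrightarrow> \<i> * integral\<^sup>L lborel (\<lambda>x. f (\<i> * of_real x))"
    using tendsto_mult_left[of _ _ sequentially \<i>] by fastforce
  from LIMSEQ_unique[OF this A0]
  show "integral\<^sup>L lborel (\<lambda>x. shift_kernel a b c (\<i> * of_real x)) = 0"
    by (simp add: f_def)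
qed

lemma dual_Hahn_weight_shift:
  assumes "Re a > 0"
  shows "dual_Hahn_weight (a + 1) b c x = (a\<^sup>2 + (of_real x)\<^sup>2) * dual_Hahn_weight a b c x"
proof -
  have "Gamma_pair (a + 1) x = (a + \<i> * of_real x) * (a - \<i> * of_real x) * Gamma_pair a x"
  proof -
    have "a + 1 + \<i> * of_real x = (a + \<i> * of_real x) + 1" "a + 1 - \<i> * of_real x = (a - \<i> * of_real x) + 1"
      by simp_all
    then show ?thesis
      using Gamma_plus1[of "a + \<i> * of_real x"] Gamma_plus1[of "a - \<i> * of_real x"] assms
      unfolding Gamma_pair_def by (simp only: Re_pos_not_nonpos_Int mult_ac) (simp add: Re_pos_not_nonpos_Int mult_ac)
  qed
  also have "(a + \<i> * of_real x) * (a - \<i> * of_real x) = a\<^sup>2 + (of_real x)\<^sup>2"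
    by (simp add: power2_eq_square algebra_simps)
  finally show ?thesis by (simp add: dual_Hahn_weight_def)
qed

text \<open>The kernel integrates to 0 along the axis in either direction, and the sum of its two
  reflections is (a + b)(a + c) times the weight minus the shifted weight.\<close>

lemma dual_Hahn_integral_shift:
  assumes pos: "Re a > 0" "Re b > 0" "Re c > 0"
  shows "dual_Hahn_integral (a + 1) b c = (a + b) * (a + c) * dual_Hahn_integral a b c"
proof -
  have int: "integrable lborel (dual_Hahn_weight a b c)" "integrable lborel (dual_Hahn_weight (a + 1) b c)"
    using pos by (auto intro: integrable_dual_Hahn_weight)
  note sk = shift_kernel_integral[OF pos]
  have sk': "integrable lborel (\<lambda>x. shift_kernel a b c (\<i> * of_real (- x)))"
    "integral\<^sup>L lborel (\<lambda>x. shift_kernel a b c (\<i> * of_real (- x))) = 0"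
    using lborel_integrable_real_affine[OF sk(1), of "-1" 0]
      lborel_integral_real_affine[of "-1" "\<lambda>x. shift_kernel a b c (\<i> * of_real x)" 0] sk(2)
    by simp_all
  have "0 = integral\<^sup>L lborel (\<lambda>x. shift_kernel a b c (\<i> * of_real x) + shift_kernel a b c (\<i> * of_real (- x)))"
    using Bochner_Integration.integral_add[OF sk(1) sk'(1)] sk(2) sk'(2) by simp
  also have "\<dots> = integral\<^sup>L lborel (\<lambda>x. (a + b) * (a + c) * dual_Hahn_weight a b c x -
      dual_Hahn_weight (a + 1) b c x)"
    unfolding shift_kernel_line[OF pos] dual_Hahn_weight_shift[OF pos(1)]
    by (simp add: power2_eq_square algebra_simps)
  also have "\<dots> = (a + b) * (a + c) * dual_Hahn_integral a b c - dual_Hahn_integral (a + 1) b c"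
    unfolding dual_Hahn_integral_def using int by (subst Bochner_Integration.integral_diff) auto
  finally show ?thesis by simp
qed

subsection \<open>Evaluation of the total mass\<close>

definition real_dual_Hahn_weight :: "real \<Rightarrow> real \<Rightarrow> real \<Rightarrow> real \<Rightarrow> real" where
  "real_dual_Hahn_weight a b c x = 2 * x * sinh (2 * pi * x) / pi *
    ((norm (Gamma (of_real a + \<i> * of_real x)))\<^sup>2 * (norm (Gamma (of_real b + \<i> * of_real x)))\<^sup>2 *
     (norm (Gamma (of_real c + \<i> * of_real x)))\<^sup>2)"

lemma Gamma_pair_of_real:
  "Gamma_pair (of_real a) x = of_real ((norm (Gamma (of_real a + \<i> * of_real x)))\<^sup>2)"
proof -
  have "Gamma (of_real a - \<i> * of_real x) = cnj (Gamma (of_real a + \<i> * of_real x))"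
    by (simp add: cnj_Gamma)
  then show ?thesis by (simp only: Gamma_pair_def complex_norm_square)
qed

lemma pos_not_nonpos_Int: "x > 0 \<Longrightarrow> x \<notin> \<int>\<^sub>\<le>\<^sub>0" for x :: real
  by (auto dest: nonpos_Ints_nonpos)

lemma dual_Hahn_weight_of_real:
  "dual_Hahn_weight (of_real a) (of_real b) (of_real c) x = of_real (real_dual_Hahn_weight a b c x)"
  by (simp add: dual_Hahn_weight_def real_dual_Hahn_weight_def Gamma_pair_of_real)

lemma sinh_factor_nonneg: "0 \<le> 2 * x * sinh (2 * pi * x) / (pi :: real)"
  by (cases "x \<ge> 0") (auto intro!: divide_nonneg_pos mult_nonneg_nonneg mult_nonpos_nonpos
      simp: mult_nonneg_nonpos)

lemma real_dual_Hahn_weight_nonneg: "0 \<le> real_dual_Hahn_weight a b c x"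
  unfolding real_dual_Hahn_weight_def by (intro mult_nonneg_nonneg sinh_factor_nonneg) auto

definition real_dual_Hahn_integral :: "real \<Rightarrow> real \<Rightarrow> real \<Rightarrow> real" where
  "real_dual_Hahn_integral a b c = integral\<^sup>L lborel (real_dual_Hahn_weight a b c)"

lemma dual_Hahn_integral_of_real:
  "dual_Hahn_integral (of_real a) (of_real b) (of_real c) = of_real (real_dual_Hahn_integral a b c)"
  unfolding dual_Hahn_integral_def real_dual_Hahn_integral_def
  by (subst integral_complex_of_real[symmetric]) (simp only: dual_Hahn_weight_of_real[symmetric])

lemma integrable_real_dual_Hahn_weight:
  assumes "a > 0" "b > 0" "c > 0"
  shows "integrable lborel (real_dual_Hahn_weight a b c)"
  using integrable_Re[OF integrable_dual_Hahn_weight[of "of_real a" "of_real b" "of_real c"]] assms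
  by (simp add: dual_Hahn_weight_of_real)

lemma real_dual_Hahn_integral_nonneg: "0 \<le> real_dual_Hahn_integral a b c"
  unfolding real_dual_Hahn_integral_def
  by (intro Bochner_Integration.integral_nonneg) (simp add: real_dual_Hahn_weight_nonneg)

lemma real_dual_Hahn_integral_permute:
  "real_dual_Hahn_integral a b c = real_dual_Hahn_integral b a c"
  "real_dual_Hahn_integral a b c = real_dual_Hahn_integral a c b"
  using dual_Hahn_integral_permute[of "of_real a" "of_real b" "of_real c"]
  by (simp_all add: dual_Hahn_integral_of_real)

lemma real_dual_Hahn_integral_shift:
  assumes "a > 0" "b > 0" "c > 0"
  shows "real_dual_Hahn_integral (a + 1) b c = (a + b) * (a + c) * real_dual_Hahn_integral a b c"
proof -
  have "of_real (real_dual_Hahn_integral (a + 1) b c) =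
      (of_real ((a + b) * (a + c) * real_dual_Hahn_integral a b c) :: complex)"
    using dual_Hahn_integral_shift[of "of_real a" "of_real b" "of_real c"] assms
    by (simp flip: dual_Hahn_integral_of_real)
  then show ?thesis by (simp only: of_real_eq_iff)
qed

text \<open>Replaces logarithmic convexity in the uniqueness argument of Bohr and Mollerup.\<close>
lemma real_dual_Hahn_integral_interpolation:
  assumes a: "a > 1/2" and pos: "b > 0" "c > 0" and th: "0 \<le> \<theta>" "\<theta> \<le> 1"
  shows "real_dual_Hahn_integral (a + \<theta>) b c \<le>
    a / (a - 1/2) * ((a + b) * (a + c)) powr \<theta> * real_dual_Hahn_integral a b c"
proof -
  \<comment> \<open>\<open>M\<close> is the ratio of the masses at a + 1 and a. With this scale in
    the AM-GM step, the two averaged terms integrate to the same value, and the average is the mass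
    at \<open>a\<close>.\<close>
  define M where "M = (a + b) * (a + c)"
  define h where "h = a / (a - 1/2)"
  have M: "M > 0" and h: "h > 0" using assms by (auto simp: M_def h_def)
  have a0: "a > 0" using a by simp
  have le: "real_dual_Hahn_weight (a + \<theta>) b c x \<le> h * M powr \<theta> *
      ((1 - \<theta>) * real_dual_Hahn_weight a b c x + \<theta> / M * real_dual_Hahn_weight (a + 1) b c x)" for x
  proof -
    define z where "z = complex_of_real a + \<i> * of_real x"
    define g where "g = (norm (Gamma z))\<^sup>2"
    define K where "K = 2 * x * sinh (2 * pi * x) / pi * ((norm (Gamma (of_real b + \<i> * of_real x)))\<^sup>2 *
        (norm (Gamma (of_real c + \<i> * of_real x)))\<^sup>2)"
    have K: "K \<ge> 0" unfolding K_def by (intro mult_nonneg_nonneg sinh_factor_nonneg) auto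
    have w: "real_dual_Hahn_weight (a + t) b c x = K * (norm (Gamma (z + of_real t)))\<^sup>2" for t
      by (simp add: real_dual_Hahn_weight_def K_def z_def add_ac mult_ac)
    have z0: "(norm z)\<^sup>2 > 0" using a0 by (simp add: z_def complex_eq_iff)
    have g1: "(norm (Gamma (z + 1)))\<^sup>2 = (norm z)\<^sup>2 * g"
      using Gamma_plus1[of z] a0
      by (simp add: Re_pos_not_nonpos_Int z_def g_def norm_mult power_mult_distrib)
    have "(norm (Gamma (z + of_real \<theta>)))\<^sup>2 \<le> h * g * (norm z)\<^sup>2 powr \<theta>"
      using norm_Gamma_add_le[of z \<theta>] a th by (simp add: z_def h_def g_def)
    also have "(norm z)\<^sup>2 powr \<theta> = M powr \<theta> * ((norm z)\<^sup>2 / M) powr \<theta>"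
      using M z0 by (simp add: powr_mult[symmetric])
    also have "h * g * \<dots> \<le> h * g * (M powr \<theta> * (1 - \<theta> + \<theta> * ((norm z)\<^sup>2 / M)))"
      using M z0 h th by (intro mult_left_mono powr_le_affine) (auto simp: g_def)
    also have "\<dots> = h * M powr \<theta> * ((1 - \<theta>) * g + \<theta> / M * (norm (Gamma (z + 1)))\<^sup>2)"
      unfolding g1 by (simp add: algebra_simps)
    finally have "K * (norm (Gamma (z + of_real \<theta>)))\<^sup>2 \<le>
        K * (h * M powr \<theta> * ((1 - \<theta>) * g + \<theta> / M * (norm (Gamma (z + 1)))\<^sup>2))"
      using K by (rule mult_left_mono)
    then show ?thesis
      using w[of 0] w[of 1] w[of \<theta>] by (simp add: g_def algebra_simps)
  qed
  have int: "integrable lborel (real_dual_Hahn_weight a b c)"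
    "integrable lborel (real_dual_Hahn_weight (a + 1) b c)"
    "integrable lborel (real_dual_Hahn_weight (a + \<theta>) b c)"
    using a pos th by (auto intro!: integrable_real_dual_Hahn_weight)
  have "real_dual_Hahn_integral (a + \<theta>) b c \<le> integral\<^sup>L lborel (\<lambda>x. h * M powr \<theta> *
      ((1 - \<theta>) * real_dual_Hahn_weight a b c x + \<theta> / M * real_dual_Hahn_weight (a + 1) b c x))"
    unfolding real_dual_Hahn_integral_def using int le by (intro integral_mono) auto
  also have "\<dots> = h * M powr \<theta> * ((1 - \<theta>) * real_dual_Hahn_integral a b c +
      \<theta> / M * real_dual_Hahn_integral (a + 1) b c)"
    using int by (simp add: real_dual_Hahn_integral_def)
  also have "\<dots> = h * M powr \<theta> * real_dual_Hahn_integral a b c"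
    unfolding real_dual_Hahn_integral_shift[OF a0 pos] M_def[symmetric]
    using M by (simp add: field_simps)
  finally show ?thesis by (simp add: h_def M_def)
qed

text \<open>Stepping from y + \<theta> up to y + 1 by 1 - \<theta> bounds Gamma(y + \<theta>) from
  below, the direction opposite to a direct step from y. The right-hand side tends to 1 as y
  grows.\<close>

lemma Gamma_ratio_le:
  fixes y \<theta> :: real
  assumes "y > 1/2" "0 \<le> \<theta>" "\<theta> \<le> 1"
  shows "(y powr \<theta> * Gamma y / Gamma (y + \<theta>))\<^sup>2 \<le> (y + \<theta>) / (y + \<theta> - 1/2) * (1 + 1 / y)\<^sup>2"
proof -
  define h where "h = (y + \<theta>) / (y + \<theta> - 1/2)"
  have h: "h > 0" using assms by (simp add: h_def)
  have G: "Gamma y > 0" "Gamma (y + \<theta>) > 0" using assms by (auto intro!: Gamma_real_pos)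
  have "norm (complex_of_real (y + \<theta>)) = y + \<theta>" unfolding norm_of_real using assms by simp
  then have "(norm (Gamma (complex_of_real (y + \<theta>) + of_real (1 - \<theta>))))\<^sup>2 \<le>
      h * (norm (Gamma (complex_of_real (y + \<theta>))))\<^sup>2 * ((y + \<theta>)\<^sup>2) powr (1 - \<theta>)"
    using norm_Gamma_add_le[of "complex_of_real (y + \<theta>)" "1 - \<theta>"] assms by (simp add: h_def)
  also have "complex_of_real (y + \<theta>) + of_real (1 - \<theta>) = of_real (y + 1)" by simp
  finally have "(Gamma (y + 1))\<^sup>2 \<le> h * (Gamma (y + \<theta>))\<^sup>2 * ((y + \<theta>)\<^sup>2) powr (1 - \<theta>)"
    unfolding Gamma_complex_of_real norm_of_real power2_abs .
  also have "Gamma (y + 1) = y * Gamma y"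
    using assms by (intro Gamma_plus1 pos_not_nonpos_Int) auto
  finally have *: "(y * Gamma y)\<^sup>2 \<le> h * (Gamma (y + \<theta>))\<^sup>2 * ((y + \<theta>)\<^sup>2) powr (1 - \<theta>)" .
  have y2: "y\<^sup>2 = (y\<^sup>2) powr \<theta> * (y\<^sup>2) powr (1 - \<theta>)"
    using assms by (simp add: powr_add[symmetric])
  have yt: "(y powr \<theta>)\<^sup>2 = (y\<^sup>2) powr \<theta>"
    using assms by (simp add: power2_eq_square powr_mult)
  have "((y + \<theta>)\<^sup>2) powr (1 - \<theta>) = (y\<^sup>2) powr (1 - \<theta>) * (((y + \<theta>) / y)\<^sup>2) powr (1 - \<theta>)"
    using assms by (simp add: powr_mult[symmetric] power_divide)
  also have "\<dots> \<le> (y\<^sup>2) powr (1 - \<theta>) * (1 + 1 / y)\<^sup>2"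
  proof (intro mult_left_mono)
    have "(((y + \<theta>) / y)\<^sup>2) powr (1 - \<theta>) \<le> (((y + \<theta>) / y)\<^sup>2) powr 1"
      using assms by (intro powr_mono one_le_power) (auto simp: field_simps)
    also have "\<dots> \<le> (1 + 1 / y)\<^sup>2"
    proof -
      have "(y + \<theta>) / y \<le> 1 + 1 / y" using assms by (simp add: field_simps)
      then have "((y + \<theta>) / y)\<^sup>2 \<le> (1 + 1 / y)\<^sup>2" using assms by (intro power_mono) auto
      then show ?thesis using assms by simp
    qed
    finally show "(((y + \<theta>) / y)\<^sup>2) powr (1 - \<theta>) \<le> (1 + 1 / y)\<^sup>2" .
  qed auto
  finally have **: "((y + \<theta>)\<^sup>2) powr (1 - \<theta>) \<le> (y\<^sup>2) powr (1 - \<theta>) * (1 + 1 / y)\<^sup>2" .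
  define Y where "Y = (y\<^sup>2) powr (1 - \<theta>)"
  have Y: "Y > 0" using assms by (simp add: Y_def)
  have "(y\<^sup>2) powr \<theta> * Y * (Gamma y)\<^sup>2 = (y * Gamma y)\<^sup>2"
    unfolding Y_def y2[symmetric] by (simp add: power_mult_distrib)
  also note *
  also have "h * (Gamma (y + \<theta>))\<^sup>2 * ((y + \<theta>)\<^sup>2) powr (1 - \<theta>) \<le>
      h * (Gamma (y + \<theta>))\<^sup>2 * (Y * (1 + 1 / y)\<^sup>2)"
    unfolding Y_def using h ** by (intro mult_left_mono) auto
  finally have "(y\<^sup>2) powr \<theta> * Y * (Gamma y)\<^sup>2 \<le> h * (Gamma (y + \<theta>))\<^sup>2 * (Y * (1 + 1 / y)\<^sup>2)" .
  then have "Y * ((y\<^sup>2) powr \<theta> * (Gamma y)\<^sup>2) \<le> Y * (h * (Gamma (y + \<theta>))\<^sup>2 * (1 + 1 / y)\<^sup>2)"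
    by (simp add: mult_ac)
  then have "(y\<^sup>2) powr \<theta> * (Gamma y)\<^sup>2 \<le> h * (Gamma (y + \<theta>))\<^sup>2 * (1 + 1 / y)\<^sup>2"
    using Y by (simp only: mult_le_cancel_left_pos)
  then show ?thesis
    using G unfolding h_def[symmetric] power_divide power_mult_distrib yt
    by (simp add: pos_divide_le_eq mult_ac zero_less_power)
qed

text \<open>The ratio R has period 1, since mass and Gamma factors obey the same recurrence. Far to
  the right all correction factors tend to 1, so R(t + \<theta>) <= R(t), first there and then, by
  periodicity, everywhere.\<close>

lemma real_dual_Hahn_ratio_const:
  assumes pos: "a > 0" "a' > 0" "b > 0" "c > 0"
  shows "real_dual_Hahn_integral a b c / (Gamma (a + b) * Gamma (a + c)) =
    real_dual_Hahn_integral a' b c / (Gamma (a' + b) * Gamma (a' + c))"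
proof -
  define R where "R t = real_dual_Hahn_integral t b c / (Gamma (t + b) * Gamma (t + c))" for t
  have Gpos: "Gamma (t + b) > 0" "Gamma (t + c) > 0" if "t > 0" for t
    using that pos by (auto intro!: Gamma_real_pos)
  have R0: "R t \<ge> 0" if "t > 0" for t
    using Gpos[OF that] by (simp add: R_def real_dual_Hahn_integral_nonneg)
  have per1: "R (t + 1) = R t" if "t > 0" for t
  proof -
    have "Gamma (t + 1 + b) = (t + b) * Gamma (t + b)" "Gamma (t + 1 + c) = (t + c) * Gamma (t + c)"
      using that pos Gamma_plus1[of "t + b"] Gamma_plus1[of "t + c"]
      by (auto simp: add_ac pos_not_nonpos_Int)
    then show ?thesis
      using that pos Gpos[OF that] by (simp add: R_def real_dual_Hahn_integral_shift)
  qed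
  have per: "R (t + of_nat n) = R t" if "t > 0" for t n
    by (induction n) (use that per1 in \<open>auto simp: add.assoc[symmetric] add.commute[of 1]\<close>)
  have mono: "R (t + \<theta>) \<le> R t" if t: "t > 0" and th: "0 \<le> \<theta>" "\<theta> \<le> 1" for t \<theta>
  proof -
    define u where "u y = (y + \<theta>) / (y + \<theta> - 1/2) * (1 + 1 / y)\<^sup>2" for y :: real
    define h where "h y = y / (y - 1/2)" for y :: real
    have bound: "(R (t + \<theta>))\<^sup>2 \<le> (h (t + real n))\<^sup>2 * u (t + real n + b) * u (t + real n + c) * (R t)\<^sup>2"
      if n: "n \<ge> 1" for n
    proof -
      define s where "s = t + real n"
      have s: "s > 1/2" using t n by (simp add: s_def)
      have hs: "h s > 0" using s by (simp add: h_def)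
      define q where "q y = y powr \<theta> * Gamma y / Gamma (y + \<theta>)" for y :: real
      have q0: "q (s + b) \<ge> 0" "q (s + c) \<ge> 0"
        using s pos th by (auto simp: q_def intro!: divide_nonneg_nonneg mult_nonneg_nonneg Gamma_real_nonneg)
      have "R (t + \<theta>) = R (s + \<theta>)"
        using per[of "t + \<theta>" n] t th by (simp add: s_def add_ac)
      also have "\<dots> = real_dual_Hahn_integral (s + \<theta>) b c / (Gamma (s + \<theta> + b) * Gamma (s + \<theta> + c))"
        by (simp add: R_def)
      also have "\<dots> \<le> h s * ((s + b) * (s + c)) powr \<theta> * real_dual_Hahn_integral s b c /
          (Gamma (s + \<theta> + b) * Gamma (s + \<theta> + c))"
        using real_dual_Hahn_integral_interpolation[OF s pos(3,4) th] Gpos[of "s + \<theta>"] s th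
        by (intro divide_right_mono) (auto simp: h_def)
      also have "\<dots> = h s * (q (s + b) * q (s + c)) * R s"
        using Gpos[of s] s pos
        by (simp add: R_def q_def powr_mult add_ac less_imp_neq[symmetric] order_less_trans[of 0 "1/2" s])
      also have "R s = R t" using per[OF t] by (simp add: s_def)
      finally have le: "R (t + \<theta>) \<le> h s * (q (s + b) * q (s + c)) * R t" .
      have "(R (t + \<theta>))\<^sup>2 \<le> (h s * (q (s + b) * q (s + c)) * R t)\<^sup>2"
        using le R0[of "t + \<theta>"] t th by (intro power_mono) auto
      also have "\<dots> = (h s)\<^sup>2 * ((q (s + b))\<^sup>2 * (q (s + c))\<^sup>2) * (R t)\<^sup>2"
        by (simp add: power_mult_distrib)
      also have "\<dots> \<le> (h s)\<^sup>2 * (u (s + b) * u (s + c)) * (R t)\<^sup>2"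
        unfolding q_def u_def using s pos th
        by (intro mult_right_mono mult_left_mono mult_mono Gamma_ratio_le) auto
      finally show ?thesis by (simp add: s_def)
    qed
    have "(\<lambda>n. (h (t + real n))\<^sup>2 * u (t + real n + b) * u (t + real n + c) * (R t)\<^sup>2) \<longlonglongrightarrow> 1\<^sup>2 * 1 * 1 * (R t)\<^sup>2"
    proof (intro tendsto_intros)
      show "(\<lambda>n. h (t + real n)) \<longlonglongrightarrow> 1" unfolding h_def by real_asymp
      show "(\<lambda>n. u (t + real n + b)) \<longlonglongrightarrow> 1" unfolding u_def by real_asymp
      show "(\<lambda>n. u (t + real n + c)) \<longlonglongrightarrow> 1" unfolding u_def by real_asymp
    qed
    then have "(R (t + \<theta>))\<^sup>2 \<le> 1\<^sup>2 * 1 * 1 * (R t)\<^sup>2"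
      by (rule LIMSEQ_le_const) (intro exI[of _ 1] allI impI bound)
    then have "(R (t + \<theta>))\<^sup>2 \<le> (R t)\<^sup>2" by simp
    then show ?thesis by (rule power2_le_imp_le) (rule R0[OF t])
  qed
  have const: "R (t + \<theta>) = R t" if t: "t > 0" and th: "0 \<le> \<theta>" "\<theta> \<le> 1" for t \<theta>
  proof (rule antisym)
    \<comment> \<open>Monotonicity over the remaining 1 - \<theta> of the period gives the reverse
      inequality.\<close>
    have "R t = R (t + \<theta> + (1 - \<theta>))" using per1[OF t] by (simp add: add.assoc)
    also have "\<dots> \<le> R (t + \<theta>)" using t th by (intro mono) auto
    finally show "R t \<le> R (t + \<theta>)" .
  qed (rule mono[OF t th])
  have "R t = R t'" if "t > 0" "t \<le> t'" for t t'
  proof -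
    define n where "n = nat \<lfloor>t' - t\<rfloor>"
    define \<theta> where "\<theta> = t' - t - real n"
    have "0 \<le> \<theta>" "\<theta> \<le> 1" using that unfolding \<theta>_def n_def by linarith+
    then have "R (t + \<theta> + real n) = R t"
      using const[OF that(1), of \<theta>] per[of "t + \<theta>" n] that(1) by simp
    then show ?thesis by (simp add: \<theta>_def)
  qed
  then have "R a = R a'" using pos(1,2) by (metis linear)
  then show ?thesis by (simp only: R_def)
qed

lemma real_dual_Hahn_integral_half: "real_dual_Hahn_integral (1/2) (1/2) (1/2) = 4 * pi"
proof -
  define f where "f x = 4 * pi\<^sup>2 * x * sinh (pi * x) / (cosh (pi * x))\<^sup>2" for x :: real
  \<comment> \<open>Integration by parts: differentiating -4 pi x / cosh(pi x) leaves the extra term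
    -4 pi / cosh(pi x), and 8 arctan(e^(pi x)) is a primitive of its negative.\<close>
  define F where "F x = 8 * arctan (exp (pi * x)) - 4 * pi * x / cosh (pi * x)" for x :: real
  have f: "real_dual_Hahn_weight (1/2) (1/2) (1/2) x = f x" for x
  proof -
    have c: "cosh (pi * x) > 0" by (rule cosh_real_pos)
    have "real_dual_Hahn_weight (1/2) (1/2) (1/2) x =
        2 * x * sinh (2 * (pi * x)) / pi * ((pi / cosh (pi * x)) * (pi / cosh (pi * x)) * (pi / cosh (pi * x)))"
      using norm_Gamma_half_line[of x] by (simp add: real_dual_Hahn_weight_def mult.assoc)
    also have "sinh (2 * (pi * x)) = 2 * sinh (pi * x) * cosh (pi * x)" by (rule sinh_double)
    finally show ?thesis
      using c by (simp add: f_def power2_eq_square field_simps)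
  qed
  have c: "cosh (pi * x) \<noteq> 0" for x :: real using cosh_real_pos[of "pi * x"] by simp
  have ex: "exp (pi * x) / (1 + (exp (pi * x))\<^sup>2) = 1 / (2 * cosh (pi * x))" for x :: real
  proof -
    have "2 * cosh (pi * x) * exp (pi * x) = 1 + (exp (pi * x))\<^sup>2"
      by (simp add: cosh_def power2_eq_square algebra_simps exp_add[symmetric])
    then show ?thesis using c[of x] by (simp add: frac_eq_eq add_nonneg_eq_0_iff mult.commute)
  qed
  have "(F has_real_derivative f x) (at x)" for x
  proof -
    have "(F has_real_derivative (8 * (pi * (exp (pi * x) / (1 + (exp (pi * x))\<^sup>2))) -
        (4 * pi / cosh (pi * x) - 4 * pi * x * (sinh (pi * x) * pi) / (cosh (pi * x))\<^sup>2))) (at x)"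
      unfolding F_def using c[of x]
      by (auto intro!: derivative_eq_intros simp: divide_inverse power2_eq_square algebra_simps)
    then show ?thesis unfolding ex f_def by (simp add: power2_eq_square mult_ac)
  qed
  moreover have "0 \<le> f x" for x
    using real_dual_Hahn_weight_nonneg[of "1/2" "1/2" "1/2" x] by (simp only: f)
  moreover have "isCont f x" for x
    unfolding f_def using c by (intro continuous_intros) auto
  moreover have "((F \<circ> real_of_ereal) \<longlongrightarrow> 0) (at_right (-\<infinity>))"
  proof -
    have "(F \<longlongrightarrow> 0) at_bot" unfolding F_def cosh_field_def by real_asymp
    then show ?thesis by (simp add: ereal_tendsto_simps)
  qed
  moreover have "((F \<circ> real_of_ereal) \<longlongrightarrow> 4 * pi) (at_left \<infinity>)"
  proof -
    have "(F \<longlongrightarrow> 4 * pi) at_top" unfolding F_def cosh_field_def by real_asymp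
    then show ?thesis by (simp add: ereal_tendsto_simps)
  qed
  ultimately have "(LBINT x=-\<infinity>..\<infinity>. f x) = 4 * pi - 0"
    by (intro interval_integral_FTC_nonneg(2)[of "-\<infinity>" \<infinity> F f 0 "4 * pi"]) auto
  moreover have "real_dual_Hahn_weight (1/2) (1/2) (1/2) = f" using f by blast
  ultimately show ?thesis
    by (simp add: real_dual_Hahn_integral_def interval_lebesgue_integral_def set_lebesgue_integral_def)
qed

text \<open>Dividing by Gamma(b + c) as well makes the quotient symmetric, so constancy in the first
  parameter passes to the others. At 1/2, 1/2, 1/2 the three Gamma factors are Gamma(1) = 1.\<close>

lemma real_dual_Hahn_integral_eq:
  assumes pos: "a > 0" "b > 0" "c > 0"
  shows "real_dual_Hahn_integral a b c = 4 * pi * (Gamma (a + b) * Gamma (a + c) * Gamma (b + c))"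
proof -
  define Q where "Q a b c = real_dual_Hahn_integral a b c / (Gamma (a + b) * Gamma (a + c) * Gamma (b + c))" for a b c
  have Q1: "Q a b c = Q a' b c" if "a > 0" "a' > 0" "b > 0" "c > 0" for a a' b c
    using arg_cong[OF real_dual_Hahn_ratio_const[OF that], of "\<lambda>r. r / Gamma (b + c)"]
    by (simp add: Q_def)
  have Qp: "Q a b c = Q b a c" "Q a b c = Q a c b" for a b c
    using real_dual_Hahn_integral_permute[of a b c] by (simp_all add: Q_def mult_ac add_ac)
  have "Q a b c = Q (1/2) b c" by (rule Q1) (use pos in auto)
  also have "\<dots> = Q b (1/2) c" by (rule Qp)
  also have "\<dots> = Q (1/2) (1/2) c" by (rule Q1) (use pos in auto)
  also have "\<dots> = Q (1/2) c (1/2)" by (rule Qp)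
  also have "\<dots> = Q c (1/2) (1/2)" by (rule Qp)
  also have "\<dots> = Q (1/2) (1/2) (1/2)" by (rule Q1) (use pos in auto)
  also have "\<dots> = 4 * pi" by (simp add: Q_def real_dual_Hahn_integral_half)
  finally have "real_dual_Hahn_integral a b c / (Gamma (a + b) * Gamma (a + c) * Gamma (b + c)) = 4 * pi"
    by (simp add: Q_def)
  moreover have "Gamma (a + b) * Gamma (a + c) * Gamma (b + c) > 0"
    using pos by (intro mult_pos_pos Gamma_real_pos) auto
  ultimately show ?thesis by (metis nonzero_divide_eq_eq less_irrefl)
qed

text \<open>The identity theorem in the first variable: both sides are holomorphic on the right
  half-plane and agree on the positive reals, which accumulate at 1. The other two parameters may
  already be complex.\<close>

lemma dual_Hahn_integral_extend:
  assumes real: "\<And>r::real. r > 0 \<Longrightarrow> dual_Hahn_integral (of_real r) b c =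
      4 * of_real pi * (Gamma (of_real r + b) * Gamma (of_real r + c) * Gamma (b + c))"
    and pos: "Re a > 0" "Re b > 0" "Re c > 0"
  shows "dual_Hahn_integral a b c = 4 * of_real pi * (Gamma (a + b) * Gamma (a + c) * Gamma (b + c))"
proof -
  have "dual_Hahn_integral a b c - 4 * of_real pi * (Gamma (a + b) * Gamma (a + c) * Gamma (b + c)) = 0"
  proof (rule analytic_continuation[where f = "\<lambda>a. dual_Hahn_integral a b c -
      4 * of_real pi * (Gamma (a + b) * Gamma (a + c) * Gamma (b + c))" and w = a and S = "{a. Re a > 0}" and U = "of_real ` {0<..}" and \<xi> = 1])
    show "(\<lambda>a. dual_Hahn_integral a b c - 4 * of_real pi * (Gamma (a + b) * Gamma (a + c) * Gamma (b + c)))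
        holomorphic_on {a. Re a > 0}"
      using pos by (intro holomorphic_intros holomorphic_dual_Hahn_integral)
        (auto intro!: Re_pos_not_nonpos_Int)
    show "open {a. Re a > 0}" by (rule open_halfspace_Re_gt)
    show "connected {a. Re a > 0}" by (intro convex_connected convex_halfspace_Re_gt)
    show "(1::complex) islimpt of_real ` {0<..}"
      unfolding islimpt_approachable
    proof (intro allI impI)
      fix e :: real assume "e > 0"
      then show "\<exists>x'\<in>of_real ` {0<..}. x' \<noteq> (1::complex) \<and> dist x' 1 < e"
        by (intro bexI[OF _ imageI[of "1 + e / 2"]]) (auto simp: dist_norm)
    qed
  qed (use pos real in auto)
  then show ?thesis by simp
qed

text \<open>The parameters leave the real axis one at a time; permuting them brings the next one
  into first place, with the case of fewer complex parameters as input.\<close>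

lemma dual_Hahn_integral_eq:
  assumes "Re a > 0" "Re b > 0" "Re c > 0"
  shows "dual_Hahn_integral a b c = 4 * of_real pi * (Gamma (a + b) * Gamma (a + c) * Gamma (b + c))"
proof -
  have 1: "dual_Hahn_integral a (of_real s) (of_real t) =
      4 * of_real pi * (Gamma (a + of_real s) * Gamma (a + of_real t) * Gamma (of_real s + of_real t))"
    if "Re a > 0" "s > 0" "t > 0" for a and s t :: real
  proof (rule dual_Hahn_integral_extend)
    fix r :: real assume "r > 0"
    then show "dual_Hahn_integral (of_real r) (of_real s) (of_real t) = 4 * of_real pi *
        (Gamma (of_real r + of_real s) * Gamma (of_real r + of_real t) * Gamma (of_real s + of_real t))"
      unfolding dual_Hahn_integral_of_real using that
      by (simp add: real_dual_Hahn_integral_eq flip: of_real_add Gamma_complex_of_real)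
  qed (use that in auto)
  have 2: "dual_Hahn_integral a b (of_real t) =
      4 * of_real pi * (Gamma (a + b) * Gamma (a + of_real t) * Gamma (b + of_real t))"
    if "Re a > 0" "Re b > 0" "t > 0" for a b and t :: real
  proof (rule dual_Hahn_integral_extend)
    fix r :: real assume "r > 0"
    then show "dual_Hahn_integral (of_real r) b (of_real t) =
        4 * of_real pi * (Gamma (of_real r + b) * Gamma (of_real r + of_real t) * Gamma (b + of_real t))"
      using 1[of b r t] that dual_Hahn_integral_permute(1)[of b "of_real r" "of_real t"]
      by (simp add: mult_ac add_ac)
  qed (use that in auto)
  show ?thesis
  proof (rule dual_Hahn_integral_extend)
    fix r :: real assume "r > 0"
    then show "dual_Hahn_integral (of_real r) b c =
        4 * of_real pi * (Gamma (of_real r + b) * Gamma (of_real r + c) * Gamma (b + c))"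
      using 2[of b c r] assms dual_Hahn_integral_permute[of b "of_real r" c]
      by (simp add: mult_ac add_ac)
  qed (use assms in auto)
qed

subsection \<open>Moments and pairings\<close>

lemma even_half_line_integral:
  fixes f :: "real \<Rightarrow> 'a::{banach, second_countable_topology}"
  assumes "integrable lborel f" "\<And>x. f (- x) = f x"
  shows "set_integrable lborel {0<..} f"
    "integral\<^sup>L lborel f = 2 *\<^sub>R (LINT x:{0<..}|lborel. f x)"
proof -
  define g where "g x = indicator {0<..} x *\<^sub>R f x" for x :: real
  have g: "integrable lborel g"
    unfolding g_def using assms(1) by (rule integrable_mult_indicator[rotated]) simp
  then show "set_integrable lborel {0<..} f" by (simp only: set_integrable_def g_def[abs_def])
  have g': "integrable lborel (\<lambda>x. g (- x))" "integral\<^sup>L lborel (\<lambda>x. g (- x)) = integral\<^sup>L lborel g"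
    using lborel_integrable_real_affine[OF g, of "-1" 0] lborel_integral_real_affine[of "-1" g 0]
    by simp_all
  have "integral\<^sup>L lborel f = integral\<^sup>L lborel (\<lambda>x. g x + g (- x))"
  proof (rule integral_cong_AE)
    show "AE x in lborel. f x = g x + g (- x)"
      using AE_lborel_singleton[of 0] by eventually_elim (auto simp: g_def indicator_def assms(2))
  qed (use assms(1) g g' in auto)
  also have "\<dots> = 2 *\<^sub>R integral\<^sup>L lborel g"
    using g g' by (simp add: scaleR_2)
  finally show "integral\<^sup>L lborel f = 2 *\<^sub>R (LINT x:{0<..}|lborel. f x)"
    by (simp only: set_lebesgue_integral_def g_def[abs_def])
qed

lemma Gamma_add_nat:
  assumes "Re z > 0"
  shows "Gamma (z + of_nat j) = Gamma z * pochhammer z j"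
  using pochhammer_Gamma[OF Re_pos_not_nonpos_Int[OF assms], of j] Re_pos_not_nonpos_Int[OF assms]
  by (simp add: Gamma_eq_zero_iff)

lemma Gamma_pair_add_nat:
  assumes "Re a > 0"
  shows "pochhammer (a + \<i> * of_real x) j * pochhammer (a - \<i> * of_real x) j * Gamma_pair a x =
    Gamma_pair (a + of_nat j) x"
proof -
  have *: "a + of_nat j + \<i> * of_real x = (a + \<i> * of_real x) + of_nat j"
    "a + of_nat j - \<i> * of_real x = (a - \<i> * of_real x) + of_nat j"
    by simp_all
  show ?thesis
    using Gamma_add_nat[of "a + \<i> * of_real x" j] Gamma_add_nat[of "a - \<i> * of_real x" j] assms
    unfolding Gamma_pair_def * by simp
qed

lemma dual_Hahn_weight_moment:
  assumes "Re a > 0" "Re b > 0" "Re c > 0"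
  shows "has_bochner_integral lborel
    (\<lambda>x. (pochhammer (a + \<i> * of_real x) i * pochhammer (a - \<i> * of_real x) i) *
      (pochhammer (b + \<i> * of_real x) j * pochhammer (b - \<i> * of_real x) j) * dual_Hahn_weight a b c x)
    (4 * of_real pi * (Gamma (a + b + of_nat (i + j)) * Gamma (a + c + of_nat i) * Gamma (b + c + of_nat j)))"
proof -
  have eq: "(pochhammer (a + \<i> * of_real x) i * pochhammer (a - \<i> * of_real x) i) *
      (pochhammer (b + \<i> * of_real x) j * pochhammer (b - \<i> * of_real x) j) * dual_Hahn_weight a b c x =
      dual_Hahn_weight (a + of_nat i) (b + of_nat j) c x" for x
    unfolding dual_Hahn_weight_def Gamma_pair_add_nat[OF assms(1), symmetric]
      Gamma_pair_add_nat[OF assms(2), symmetric] by (simp only: mult_ac)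
  have "has_bochner_integral lborel (dual_Hahn_weight (a + of_nat i) (b + of_nat j) c)
     (dual_Hahn_integral (a + of_nat i) (b + of_nat j) c)"
    unfolding dual_Hahn_integral_def
    by (intro has_bochner_integral_integrable integrable_dual_Hahn_weight) (use assms in auto)
  also have "dual_Hahn_integral (a + of_nat i) (b + of_nat j) c = 4 * of_real pi *
      (Gamma (a + of_nat i + (b + of_nat j)) * Gamma (a + of_nat i + c) * Gamma (b + of_nat j + c))"
    by (rule dual_Hahn_integral_eq) (use assms in auto)
  finally show ?thesis unfolding eq by (simp add: add_ac)
qed

text \<open>With S_k expanded about \<open>d\<close>, the moments supply the symbols of a + d + j,
  and the sum over m is Chu-Vandermonde for (a + d) - (a + d + j) = -j. The factor (-j)_k expresses
  orthogonality to lower degrees: it is 0 for j < k.\<close>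

lemma dual_Hahn_pairing_basis:
  assumes pos: "Re a > 0" "Re d > 0" "Re f > 0"
  shows "has_bochner_integral lborel
    (\<lambda>x. (pochhammer (a + \<i> * of_real x) j * pochhammer (a - \<i> * of_real x) j) *
      dual_Hahn k d a f (\<i> * of_real x) * dual_Hahn_weight a d f x)
    (4 * of_real pi * Gamma (a + f + of_nat j) * Gamma (d + f + of_nat k) * Gamma (a + d + of_nat j) *
      pochhammer (- of_nat j) k)"
proof -
  have "has_bochner_integral lborel
    (\<lambda>x. \<Sum>m\<le>k. ((-1) ^ m * of_nat (k choose m) * pochhammer (d + a + of_nat m) (k - m) *
        pochhammer (d + f + of_nat m) (k - m)) *
      ((pochhammer (a + \<i> * of_real x) j * pochhammer (a - \<i> * of_real x) j) *
       (pochhammer (d + \<i> * of_real x) m * pochhammer (d - \<i> * of_real x) m) * dual_Hahn_weight a d f x))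
    (\<Sum>m\<le>k. ((-1) ^ m * of_nat (k choose m) * pochhammer (d + a + of_nat m) (k - m) *
        pochhammer (d + f + of_nat m) (k - m)) *
      (4 * of_real pi * (Gamma (a + d + of_nat (j + m)) * Gamma (a + f + of_nat j) * Gamma (d + f + of_nat m))))"
    by (intro has_bochner_integral_sum has_bochner_integral_mult_right dual_Hahn_weight_moment pos)
  also have "(\<lambda>x. \<Sum>m\<le>k. ((-1) ^ m * of_nat (k choose m) * pochhammer (d + a + of_nat m) (k - m) *
        pochhammer (d + f + of_nat m) (k - m)) *
      ((pochhammer (a + \<i> * of_real x) j * pochhammer (a - \<i> * of_real x) j) *
       (pochhammer (d + \<i> * of_real x) m * pochhammer (d - \<i> * of_real x) m) * dual_Hahn_weight a d f x)) =
    (\<lambda>x. (pochhammer (a + \<i> * of_real x) j * pochhammer (a - \<i> * of_real x) j) *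
      dual_Hahn k d a f (\<i> * of_real x) * dual_Hahn_weight a d f x)"
    unfolding dual_Hahn_def sum_distrib_left sum_distrib_right
    by (intro ext sum.cong refl) (simp only: mult_ac)
  also have "(\<Sum>m\<le>k. ((-1) ^ m * of_nat (k choose m) * pochhammer (d + a + of_nat m) (k - m) *
        pochhammer (d + f + of_nat m) (k - m)) *
      (4 * of_real pi * (Gamma (a + d + of_nat (j + m)) * Gamma (a + f + of_nat j) * Gamma (d + f + of_nat m)))) =
    (\<Sum>m\<le>k. 4 * of_real pi * Gamma (a + f + of_nat j) * Gamma (d + f + of_nat k) * Gamma (a + d + of_nat j) *
      ((-1) ^ m * of_nat (k choose m) * pochhammer (a + d + of_nat j) m * pochhammer (a + d + of_nat m) (k - m)))"
  proof (rule sum.cong[OF refl])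
    fix m assume m: "m \<in> {..k}"
    have 1: "Gamma (a + d + of_nat (j + m)) = Gamma (a + d + of_nat j) * pochhammer (a + d + of_nat j) m"
      using Gamma_add_nat[of "a + d + of_nat j" m] pos by (simp add: add_ac)
    have 2: "Gamma (d + f + of_nat k) = Gamma (d + f + of_nat m) * pochhammer (d + f + of_nat m) (k - m)"
      using Gamma_add_nat[of "d + f + of_nat m" "k - m"] pos m by (simp add: add_ac flip: of_nat_add)
    show "((-1) ^ m * of_nat (k choose m) * pochhammer (d + a + of_nat m) (k - m) *
        pochhammer (d + f + of_nat m) (k - m)) *
      (4 * of_real pi * (Gamma (a + d + of_nat (j + m)) * Gamma (a + f + of_nat j) * Gamma (d + f + of_nat m))) =
      4 * of_real pi * Gamma (a + f + of_nat j) * Gamma (d + f + of_nat k) * Gamma (a + d + of_nat j) *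
      ((-1) ^ m * of_nat (k choose m) * pochhammer (a + d + of_nat j) m * pochhammer (a + d + of_nat m) (k - m))"
      unfolding 1 2 add.commute[of d a] by (simp only: mult_ac)
  qed
  also have "\<dots> = 4 * of_real pi * Gamma (a + f + of_nat j) * Gamma (d + f + of_nat k) * Gamma (a + d + of_nat j) *
      pochhammer (- of_nat j) k"
    using pochhammer_diff_sum[of "a + d" "a + d + of_nat j" k] by (simp add: sum_distrib_left)
  finally show ?thesis .
qed

lemma pochhammer_minus_of_nat_add:
  "pochhammer (- of_nat (k + i) :: 'a::field_char_0) k = (-1) ^ k * fact (k + i) / fact i"
proof -
  have "pochhammer (- of_nat (k + i) :: 'a) k = (-1) ^ k * pochhammer (of_nat (i + 1)) k"
    using pochhammer_minus[of "of_nat (k + i) :: 'a" k] by (simp add: add_ac)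
  also have "pochhammer (of_nat (i + 1)) k = (fact (k + i) / fact i :: 'a)"
    using pochhammer_product'[of "1 :: 'a" i k]
    by (simp add: pochhammer_fact[symmetric] field_simps add_ac)
  finally show ?thesis by simp
qed

text \<open>Only the terms j >= k survive. With j = k + i the remaining sum is Chu-Vandermonde for
  (a + b + k) - (a + f + k) = b - f. The pairing is thus triangular, and for b = f it becomes
  diagonal, the usual orthogonality.\<close>

lemma dual_Hahn_pairing:
  assumes pos: "Re a > 0" "Re d > 0" "Re f > 0"
  shows "has_bochner_integral lborel
    (\<lambda>x. dual_Hahn n a b d (\<i> * of_real x) * dual_Hahn k a d f (\<i> * of_real x) * dual_Hahn_weight a d f x)
    (if k \<le> n then 4 * of_real pi * Gamma (a + d + of_nat n) * Gamma (a + f + of_nat k) *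
      Gamma (d + f + of_nat k) * (fact n / fact (n - k)) * pochhammer (b - f) (n - k) else 0)"
proof -
  define c where "c j = (-1) ^ j * of_nat (n choose j) * pochhammer (a + b + of_nat j) (n - j) *
        pochhammer (a + d + of_nat j) (n - j)" for j
  define v where "v j = 4 * of_real pi * Gamma (a + f + of_nat j) * Gamma (d + f + of_nat k) *
      Gamma (a + d + of_nat j) * pochhammer (- of_nat j) k" for j
  have v0: "v j = 0" if "j < k" for j
    using pochhammer_of_nat_eq_0_lemma[OF that, where ?'a = complex] by (simp add: v_def)
  have "has_bochner_integral lborel
    (\<lambda>x. \<Sum>j\<le>n. c j * ((pochhammer (a + \<i> * of_real x) j * pochhammer (a - \<i> * of_real x) j) *
      dual_Hahn k d a f (\<i> * of_real x) * dual_Hahn_weight a d f x))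
    (\<Sum>j\<le>n. c j * v j)"
    unfolding v_def
    by (intro has_bochner_integral_sum has_bochner_integral_mult_right dual_Hahn_pairing_basis pos)
  also have "(\<lambda>x. \<Sum>j\<le>n. c j * ((pochhammer (a + \<i> * of_real x) j * pochhammer (a - \<i> * of_real x) j) *
      dual_Hahn k d a f (\<i> * of_real x) * dual_Hahn_weight a d f x)) =
    (\<lambda>x. dual_Hahn n a b d (\<i> * of_real x) * dual_Hahn k a d f (\<i> * of_real x) * dual_Hahn_weight a d f x)"
    unfolding dual_Hahn_swap12[of k d a] dual_Hahn_def[of n] sum_distrib_right c_def
    by (intro ext sum.cong refl) (simp only: mult_ac)
  also have "(\<Sum>j\<le>n. c j * v j) = (if k \<le> n then 4 * of_real pi * Gamma (a + d + of_nat n) * Gamma (a + f + of_nat k) *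
      Gamma (d + f + of_nat k) * (fact n / fact (n - k)) * pochhammer (b - f) (n - k) else 0)"
  proof (cases "k \<le> n")
    case False
    then have "c j * v j = 0" if "j \<in> {..n}" for j
      using that v0[of j] by simp
    then have "(\<Sum>j\<le>n. c j * v j) = 0" by (intro sum.neutral) blast
    then show ?thesis using False by (simp only: if_False)
  next
    case True
    have "(\<Sum>j\<le>n. c j * v j) = (\<Sum>j\<in>{k..n}. c j * v j)"
    proof (rule sum.mono_neutral_right)
      show "\<forall>j\<in>{..n} - {k..n}. c j * v j = 0"
        using v0 by auto
    qed auto
    also have "\<dots> = (\<Sum>i\<le>n - k. c (k + i) * v (k + i))"
      by (rule sum.reindex_bij_witness[where i = "\<lambda>i. k + i" and j = "\<lambda>j. j - k"]) (use True in auto)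
    also have "\<dots> = (\<Sum>i\<le>n - k. 4 * of_real pi * Gamma (a + d + of_nat n) * Gamma (a + f + of_nat k) *
      Gamma (d + f + of_nat k) * (fact n / fact (n - k)) *
      ((-1) ^ i * of_nat ((n - k) choose i) * pochhammer (a + f + of_nat k) i *
        pochhammer (a + b + of_nat k + of_nat i) (n - k - i)))"
    proof (rule sum.cong[OF refl])
      fix i assume i: "i \<in> {..n - k}"
      have 1: "Gamma (a + f + of_nat (k + i)) = Gamma (a + f + of_nat k) * pochhammer (a + f + of_nat k) i"
        using Gamma_add_nat[of "a + f + of_nat k" i] pos by (simp add: add_ac)
      have 2: "Gamma (a + d + of_nat n) = Gamma (a + d + of_nat (k + i)) * pochhammer (a + d + of_nat (k + i)) (n - (k + i))"
        using Gamma_add_nat[of "a + d + of_nat (k + i)" "n - (k + i)"] pos i True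
        by (simp add: add_ac flip: of_nat_add)
      have "of_nat (n choose (k + i)) = (fact n / (fact (k + i) * fact (n - (k + i))) :: complex)"
        using i True by (intro binomial_fact) auto
      moreover have "of_nat ((n - k) choose i) = (fact (n - k) / (fact i * fact (n - k - i)) :: complex)"
        using i by (intro binomial_fact) auto
      ultimately have 3: "of_nat (n choose (k + i)) * (fact (k + i) / fact i) =
          (fact n / fact (n - k) * of_nat ((n - k) choose i) :: complex)"
        by simp
      have 4: "(-1) ^ (k + i) * (-1) ^ k = ((-1) ^ i :: complex)"
        by (simp add: minus_one_power_iff)
      have 5: "pochhammer (a + b + of_nat (k + i)) (n - (k + i)) =
          pochhammer (a + b + of_nat k + of_nat i) (n - k - i)"
        by (simp add: add.assoc)
      have "c (k + i) * v (k + i) = ((-1) ^ (k + i) * (-1) ^ k) *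
        (of_nat (n choose (k + i)) * (fact (k + i) / fact i)) *
        (Gamma (a + d + of_nat (k + i)) * pochhammer (a + d + of_nat (k + i)) (n - (k + i))) *
        (4 * of_real pi * Gamma (a + f + of_nat (k + i)) * Gamma (d + f + of_nat k) *
          pochhammer (a + b + of_nat (k + i)) (n - (k + i)))"
        unfolding c_def v_def pochhammer_minus_of_nat_add by (simp only: times_divide_eq_right mult_ac)
      also have "\<dots> = 4 * of_real pi * Gamma (a + d + of_nat n) * Gamma (a + f + of_nat k) *
      Gamma (d + f + of_nat k) * (fact n / fact (n - k)) *
      ((-1) ^ i * of_nat ((n - k) choose i) * pochhammer (a + f + of_nat k) i *
        pochhammer (a + b + of_nat k + of_nat i) (n - k - i))"
        unfolding 1 2[symmetric] 3 4 5 by (simp only: mult_ac)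
      finally show "c (k + i) * v (k + i) = 4 * of_real pi * Gamma (a + d + of_nat n) * Gamma (a + f + of_nat k) *
      Gamma (d + f + of_nat k) * (fact n / fact (n - k)) *
      ((-1) ^ i * of_nat ((n - k) choose i) * pochhammer (a + f + of_nat k) i *
        pochhammer (a + b + of_nat k + of_nat i) (n - k - i))" .
    qed
    also have "\<dots> = 4 * of_real pi * Gamma (a + d + of_nat n) * Gamma (a + f + of_nat k) *
      Gamma (d + f + of_nat k) * (fact n / fact (n - k)) * pochhammer (b - f) (n - k)"
      using pochhammer_diff_sum[of "a + b + of_nat k" "a + f + of_nat k" "n - k"]
      by (simp add: sum_distrib_left)
    finally show ?thesis using True by simp
  qed
  finally show ?thesis .
qed

subsection \<open>Growth of norms\<close>

text \<open>Bernoulli's inequality for (1 + 1/N)^p. It lets a power of the index absorb the additive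
  constant p in the induction that follows.\<close>

lemma power_mult_add_le: "real N ^ p * (real p + real N) \<le> real N * (real N + 1) ^ p" if "N > 0"
proof -
  have "1 + real p * (1 / real N) \<le> (1 + 1 / real N) ^ p"
    by (rule Bernoulli_inequality) (rule order_trans[of _ 0], auto)
  then have "(real N ^ p * real N) * (1 + real p * (1 / real N)) \<le> (real N ^ p * real N) * (1 + 1 / real N) ^ p"
    by (intro mult_left_mono) auto
  also have "(1 + 1 / real N) ^ p = ((real N + 1) / real N) ^ p"
    using that by (simp add: field_simps)
  also have "(real N ^ p * real N) * ((real N + 1) / real N) ^ p = real N * (real N + 1) ^ p"
    using that by (simp add: power_divide)
  also have "(real N ^ p * real N) * (1 + real p * (1 / real N)) = real N ^ p * (real p + real N)"
    using that by (simp add: algebra_simps)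
  finally show ?thesis .
qed

text \<open>The offset \<open>k\<close> allows a base that grows with the degree, such as a + b + (n
  - m): its symbol of length m is compared with n! / (n - m)!, at a polynomial cost whose exponent
  does not depend on m.\<close>

lemma norm_pochhammer_mult_fact_le:
  fixes z :: complex
  assumes "norm z \<le> real p + real k"
  shows "norm (pochhammer z m) * fact k \<le> fact (k + m) * (real (k + m) + 1) ^ p"
proof (induction m)
  case 0
  then show ?case by (simp add: one_le_power)
next
  case (Suc m)
  define N where "N = k + m + 1"
  have N: "N > 0" by (simp add: N_def)
  have "norm (z + of_nat m) \<le> real p + real k + real m"
    using assms norm_triangle_ineq[of z "of_nat m"] by simp
  then have z: "norm (z + of_nat m) \<le> real p + real N" by (simp add: N_def)
  have "norm (pochhammer z (Suc m)) * fact k = (norm (pochhammer z m) * fact k) * norm (z + of_nat m)"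
    by (simp add: pochhammer_Suc norm_mult mult_ac)
  also have "\<dots> \<le> (fact (k + m) * (real (k + m) + 1) ^ p) * (real p + real N)"
    by (intro mult_mono Suc.IH z) auto
  also have "\<dots> = fact (k + m) * (real N ^ p * (real p + real N))"
    by (simp add: N_def add_ac)
  also have "\<dots> \<le> fact (k + m) * (real N * (real N + 1) ^ p)"
    by (intro mult_left_mono power_mult_add_le N) auto
  also have "\<dots> = fact (k + Suc m) * (real (k + Suc m) + 1) ^ p"
    by (simp add: N_def add_ac)
  finally show ?case .
qed

lemma norm_pochhammer_le:
  fixes z :: complex
  assumes "norm z \<le> real p"
  shows "norm (pochhammer z m) \<le> fact m * (real m + 1) ^ p"
  using norm_pochhammer_mult_fact_le[of z p 0 m] assms by simp

text \<open>Every factor z + j with j >= 1 has modulus at least j, so dividing by the symbol costs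
  one power of n more than dividing by n!. The minimum with 1 covers n = 0.\<close>

lemma fact_le_norm_pochhammer:
  fixes z :: complex
  assumes "Re z > 0"
  shows "min 1 (Re z) * fact n \<le> (real n + 1) * norm (pochhammer z n)"
proof -
  have "Re z * fact (Suc n) \<le> real (Suc n) * norm (pochhammer z (Suc n))" for n
  proof (induction n)
    case 0
    then show ?case using complex_Re_le_cmod[of z] by simp
  next
    case (Suc n)
    have "real (Suc n) \<le> norm (z + of_nat (Suc n))"
      using complex_Re_le_cmod[of "z + of_nat (Suc n)"] assms by simp
    then have le: "real (Suc (Suc n)) * (norm (pochhammer z (Suc n)) * real (Suc n)) \<le>
        real (Suc (Suc n)) * (norm (pochhammer z (Suc n)) * norm (z + of_nat (Suc n)))"
      by (intro mult_left_mono) auto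
    have "Re z * fact (Suc (Suc n)) = real (Suc (Suc n)) * (Re z * fact (Suc n))"
      by (simp add: mult_ac)
    also have "\<dots> \<le> real (Suc (Suc n)) * (real (Suc n) * norm (pochhammer z (Suc n)))"
      by (intro mult_left_mono Suc.IH) auto
    also have "\<dots> \<le> real (Suc (Suc n)) * norm (pochhammer z (Suc (Suc n)))"
      using le unfolding pochhammer_Suc[of z "Suc n"] norm_mult by (simp only: mult_ac)
    finally show ?case .
  qed
  note main = this
  show ?thesis
  proof (cases n)
    case (Suc m)
    have "min 1 (Re z) * fact n \<le> Re z * fact n" by (intro mult_right_mono) auto
    also have "\<dots> \<le> real n * norm (pochhammer z n)" using main[of m] Suc by simp
    also have "\<dots> \<le> (real n + 1) * norm (pochhammer z n)" by (intro mult_right_mono) auto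
    finally show ?thesis .
  qed simp
qed

lemma summable_poly_geometric:
  fixes r :: real
  assumes "0 \<le> r" "r < 1"
  shows "summable (\<lambda>n. r ^ n * (real n + 1) ^ p)"
proof -
  define s where "s = (r + 1) / 2"
  have s: "0 < s" "s < 1" "r < s" using assms by (auto simp: s_def)
  have "(\<lambda>n. r ^ n * (real n + 1) ^ p) \<in> O(\<lambda>n. s ^ n)"
  proof (cases "r = 0")
    case True
    show ?thesis
      by (rule bigoI[of _ 1], rule eventually_sequentiallyI[of 1]) (use True s in \<open>auto simp: power_0_left\<close>)
  next
    case False
    then have "r > 0" using assms by simp
    then show ?thesis using s by real_asymp
  qed
  then show ?thesis
    by (rule summable_comparison_test_bigo[rotated])
      (use summable_geometric[of s] s in \<open>simp add: norm_power\<close>)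
qed

section \<open>Growth of the polynomials along the line\<close>

lemma cnj_dual_Hahn: "cnj (dual_Hahn n a b d (\<i> * of_real x)) = dual_Hahn n (cnj a) (cnj b) (cnj d) (\<i> * of_real x)"
  by (simp add: dual_Hahn_def mult_ac)

lemma dual_Hahn_minus: "dual_Hahn n a b d (- s) = dual_Hahn n a b d s"
  by (simp add: dual_Hahn_def mult_ac)

lemma continuous_on_pochhammer: "continuous_on A f \<Longrightarrow> continuous_on A (\<lambda>x. pochhammer (f x) n)"
  for f :: "'a::topological_space \<Rightarrow> complex"
  unfolding pochhammer_prod by (intro continuous_intros)

lemma continuous_on_dual_Hahn: "continuous_on A (\<lambda>x. dual_Hahn n a b d (\<i> * of_real x))"
  unfolding dual_Hahn_def by (intro continuous_intros continuous_on_pochhammer)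

lemma dual_Hahn_poly_bound:
  obtains C M where "C > 0" "\<And>x. norm (dual_Hahn n a b d (\<i> * of_real x)) \<le> C * (1 + \<bar>x\<bar>) ^ M"
proof -
  \<comment> \<open>Functions of at most polynomial growth are closed under sums and products, so
    the bound follows the shape of the defining sum without counting degrees.\<close>
  define bdd where "bdd g \<longleftrightarrow> (\<exists>C>0. \<exists>M. \<forall>x::real. norm (g x :: complex) \<le> C * (1 + \<bar>x\<bar>) ^ M)" for g
  have const: "bdd (\<lambda>x. c)" for c
    unfolding bdd_def by (intro exI[of _ "norm c + 1"] conjI exI[of _ 0]) (auto simp: add_nonneg_pos)
  have line: "bdd (\<lambda>x. c + of_nat j + \<i> * of_real x)" "bdd (\<lambda>x. c + of_nat j - \<i> * of_real x)" for c j
  proof -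
    have "norm (c + of_nat j + v) \<le> (norm (c + of_nat j) + 1) * (1 + \<bar>x\<bar>) ^ 1" if "norm v = \<bar>x\<bar>" for v x
    proof -
      have "norm (c + of_nat j + v) \<le> norm (c + of_nat j) + \<bar>x\<bar>"
        using norm_triangle_ineq[of "c + of_nat j" v] that by simp
      also have "\<dots> \<le> (norm (c + of_nat j) + 1) * (1 + \<bar>x\<bar>) ^ 1"
        by (simp add: algebra_simps)
      finally show ?thesis .
    qed
    from this[of "\<i> * of_real _"] this[of "- (\<i> * of_real _)"]
    show "bdd (\<lambda>x. c + of_nat j + \<i> * of_real x)" "bdd (\<lambda>x. c + of_nat j - \<i> * of_real x)"
      unfolding bdd_def
      by (intro exI[of _ "norm (c + of_nat j) + 1"] conjI exI[of _ 1] allI; simp add: norm_mult add_nonneg_pos)+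
  qed
  have mult: "bdd (\<lambda>x. g x * h x)" if gh: "bdd g" "bdd h" for g h
  proof -
    obtain C M D N where C: "C > 0" "\<And>x. norm (g x) \<le> C * (1 + \<bar>x\<bar>) ^ M"
      and D: "D > 0" "\<And>x. norm (h x) \<le> D * (1 + \<bar>x\<bar>) ^ N"
      using gh unfolding bdd_def by metis
    have "norm (g x * h x) \<le> (C * D) * (1 + \<bar>x\<bar>) ^ (M + N)" for x
    proof -
      have "norm (g x * h x) \<le> (C * (1 + \<bar>x\<bar>) ^ M) * (D * (1 + \<bar>x\<bar>) ^ N)"
        unfolding norm_mult using C D by (intro mult_mono) auto
      then show ?thesis by (simp only: power_add mult_ac)
    qed
    then show ?thesis unfolding bdd_def using C(1) D(1) by (metis mult_pos_pos)
  qed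
  have add: "bdd (\<lambda>x. g x + h x)" if gh: "bdd g" "bdd h" for g h
  proof -
    obtain C M D N where C: "C > 0" "\<And>x. norm (g x) \<le> C * (1 + \<bar>x\<bar>) ^ M"
      and D: "D > 0" "\<And>x. norm (h x) \<le> D * (1 + \<bar>x\<bar>) ^ N"
      using gh unfolding bdd_def by metis
    have "norm (g x + h x) \<le> (C + D) * (1 + \<bar>x\<bar>) ^ (M + N)" for x
    proof -
      have "norm (g x + h x) \<le> C * (1 + \<bar>x\<bar>) ^ M + D * (1 + \<bar>x\<bar>) ^ N"
        using norm_triangle_ineq[of "g x" "h x"] C(2)[of x] D(2)[of x] by linarith
      also have "\<dots> \<le> C * (1 + \<bar>x\<bar>) ^ (M + N) + D * (1 + \<bar>x\<bar>) ^ (M + N)"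
        using C(1) D(1) by (intro add_mono mult_left_mono power_increasing) auto
      finally show ?thesis by (simp only: distrib_right)
    qed
    then show ?thesis unfolding bdd_def using C(1) D(1) by (metis add_pos_pos)
  qed
  have poch: "bdd (\<lambda>x. pochhammer (c + \<i> * of_real x) j)" "bdd (\<lambda>x. pochhammer (c - \<i> * of_real x) j)" for c j
  proof (induction j)
    case (Suc j)
    case 1
    show ?case using mult[OF Suc(1) line(1)[of c j]] by (simp add: pochhammer_Suc add_ac)
    case 2
    show ?case using mult[OF Suc(2) line(2)[of c j]] by (simp add: pochhammer_Suc algebra_simps)
  qed (use const[of 1] in auto)
  have sum: "bdd (\<lambda>x. \<Sum>i\<in>I. g i x)" if "finite I" "\<And>i. i \<in> I \<Longrightarrow> bdd (g i)" for I :: "nat set" and g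
    using that by (induction rule: finite_induct) (auto intro: const add)
  have "bdd (\<lambda>x. dual_Hahn n a b d (\<i> * of_real x))"
    unfolding dual_Hahn_def by (intro sum mult poch const) auto
  then show ?thesis using that unfolding bdd_def by metis
qed


text \<open>A nonnegative weight with one real parameter, so that squared norms make sense even for
  complex a, d, f. Equal parameters reduce its comparison with other weights to one cubed
  estimate.\<close>

definition symmetric_weight :: "real \<Rightarrow> real \<Rightarrow> real" where
  "symmetric_weight \<alpha> = real_dual_Hahn_weight \<alpha> \<alpha> \<alpha>"

lemma symmetric_weight_nonneg: "0 \<le> symmetric_weight \<alpha> x"
  by (simp add: symmetric_weight_def real_dual_Hahn_weight_nonneg)

lemma of_real_symmetric_weight:
  "of_real (symmetric_weight \<alpha> x) = dual_Hahn_weight (of_real \<alpha>) (of_real \<alpha>) (of_real \<alpha>) x"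
  by (simp add: symmetric_weight_def dual_Hahn_weight_of_real)

lemma integrable_symmetric_weight: "\<alpha> > 0 \<Longrightarrow> integrable lborel (symmetric_weight \<alpha>)"
  unfolding symmetric_weight_def by (rule integrable_real_dual_Hahn_weight)

lemma integrable_dual_Hahn_sq:
  assumes "\<alpha> > 0"
  shows "integrable lborel (\<lambda>x. (norm (dual_Hahn n a b d (\<i> * of_real x)))\<^sup>2 * symmetric_weight \<alpha> x)"
proof -
  obtain C M where C: "C > 0" "\<And>x. norm (dual_Hahn n a b d (\<i> * of_real x)) \<le> C * (1 + \<bar>x\<bar>) ^ M"
    using dual_Hahn_poly_bound by metis
  obtain D N where D: "D > 0" "\<And>x. norm (dual_Hahn_weight (of_real \<alpha>) (of_real \<alpha>) (of_real \<alpha>) x) \<le>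
      D * (1 + \<bar>x\<bar>) ^ N * exp (- (pi * \<bar>x\<bar>))"
    using dual_Hahn_weight_bound_fixed[of "of_real \<alpha>" "of_real \<alpha>" "of_real \<alpha>", simplified, OF assms]
    by metis
  define g where "g x = (of_real ((norm (dual_Hahn n a b d (\<i> * of_real x)))\<^sup>2) :: complex) *
      dual_Hahn_weight (of_real \<alpha>) (of_real \<alpha>) (of_real \<alpha>) x" for x
  have "integrable lborel g"
  proof (rule integrable_poly_exp_decay)
    show "continuous_on UNIV g"
      unfolding g_def
      by (intro continuous_intros continuous_on_dual_Hahn continuous_on_dual_Hahn_weight) (use assms in auto)
    fix x
    have "norm (g x) \<le> (C * (1 + \<bar>x\<bar>) ^ M)\<^sup>2 * (D * (1 + \<bar>x\<bar>) ^ N * exp (- (pi * \<bar>x\<bar>)))"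
      unfolding g_def norm_mult norm_of_real abs_power2
      using C D by (intro mult_mono power_mono) auto
    also have "\<dots> = C\<^sup>2 * D * (1 + \<bar>x\<bar>) ^ (M * 2 + N) * exp (- (pi * \<bar>x\<bar>))"
      by (simp only: power_add power_mult power_mult_distrib mult_ac)
    finally show "norm (g x) \<le> C\<^sup>2 * D * (1 + \<bar>x\<bar>) ^ (M * 2 + N) * exp (- (pi * \<bar>x\<bar>))" .
  qed
  from integrable_Re[OF this] show ?thesis
    unfolding g_def of_real_symmetric_weight[symmetric] of_real_mult[symmetric] Re_complex_of_real .
qed

text \<open>The fourth power is the square of n!^2, the size, up to powers of n, of the divisor (a +
  b)_n n! in the generating function.\<close>

definition norm_growth :: "real \<Rightarrow> complex \<Rightarrow> complex \<Rightarrow> complex \<Rightarrow> bool" where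
  "norm_growth \<alpha> a b d \<longleftrightarrow> (\<exists>C\<ge>0. \<exists>p. \<forall>n.
    integral\<^sup>L lborel (\<lambda>x. (norm (dual_Hahn n a b d (\<i> * of_real x)))\<^sup>2 * symmetric_weight \<alpha> x) \<le>
      C * (real n + 1) ^ p * fact n ^ 4)"

lemma norm_growth_swap: "norm_growth \<alpha> a b d = norm_growth \<alpha> b a d" "norm_growth \<alpha> a b d = norm_growth \<alpha> a d b"
  by (simp add: norm_growth_def dual_Hahn_swap12[of _ a b d],
      simp add: norm_growth_def dual_Hahn_swap23[of _ a b d])

text \<open>The diagonal pairing is the norm formula 4 pi Gamma(2 \<alpha> + n)^3 n!, and each Gamma
  factor is at most n! times a power of n and a constant.\<close>

lemma norm_growth_base:
  assumes "\<alpha> > 0"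
  shows "norm_growth \<alpha> (of_real \<alpha>) (of_real \<alpha>) (of_real \<alpha>)"
proof -
  define A where "A = complex_of_real \<alpha>"
  define p where "p = nat \<lceil>2 * \<alpha>\<rceil>"
  define K where "K = norm (Gamma (A + A))"
  have A: "Re A > 0" using assms by (simp add: A_def)
  have p: "norm (A + A) \<le> real p"
  proof -
    have "norm (A + A) = 2 * \<alpha>"
      using assms unfolding A_def of_real_add[symmetric] norm_of_real by simp
    also have "\<dots> \<le> real p" unfolding p_def using assms by linarith
    finally show ?thesis .
  qed
  have "integral\<^sup>L lborel (\<lambda>x. (norm (dual_Hahn n A A A (\<i> * of_real x)))\<^sup>2 * symmetric_weight \<alpha> x) \<le>
      (4 * pi * K ^ 3) * (real n + 1) ^ (3 * p) * fact n ^ 4" for n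
  proof -
    \<comment> \<open>For real \<alpha> the polynomial is real on the line, so its squared modulus
      is its square and the pairing applies.\<close>
    have sq: "complex_of_real ((norm (dual_Hahn n A A A (\<i> * of_real x)))\<^sup>2 * symmetric_weight \<alpha> x) =
        dual_Hahn n A A A (\<i> * of_real x) * dual_Hahn n A A A (\<i> * of_real x) * dual_Hahn_weight A A A x" for x
    proof -
      have "of_real ((norm (dual_Hahn n A A A (\<i> * of_real x)))\<^sup>2) =
          dual_Hahn n A A A (\<i> * of_real x) * dual_Hahn n A A A (\<i> * of_real x)"
        unfolding complex_norm_square cnj_dual_Hahn by (simp add: A_def)
      then show ?thesis by (simp only: of_real_mult of_real_symmetric_weight A_def)
    qed
    have "of_real (integral\<^sup>L lborel (\<lambda>x. (norm (dual_Hahn n A A A (\<i> * of_real x)))\<^sup>2 * symmetric_weight \<alpha> x)) =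
        integral\<^sup>L lborel (\<lambda>x. dual_Hahn n A A A (\<i> * of_real x) * dual_Hahn n A A A (\<i> * of_real x) *
          dual_Hahn_weight A A A x)"
      unfolding sq[symmetric] by (rule integral_complex_of_real[symmetric])
    also have "\<dots> = 4 * of_real pi * Gamma (A + A + of_nat n) ^ 3 * fact n"
      using has_bochner_integral_integral_eq[OF dual_Hahn_pairing[OF A A A, of n A n]]
      by (simp add: power3_eq_cube)
    finally have "norm (complex_of_real (integral\<^sup>L lborel (\<lambda>x. (norm (dual_Hahn n A A A (\<i> * of_real x)))\<^sup>2 *
        symmetric_weight \<alpha> x))) = 4 * pi * norm (Gamma (A + A + of_nat n)) ^ 3 * fact n"
      by (simp only: norm_mult norm_power norm_of_real norm_fact norm_numeral abs_of_pos[OF pi_gt_zero])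
    then have "integral\<^sup>L lborel (\<lambda>x. (norm (dual_Hahn n A A A (\<i> * of_real x)))\<^sup>2 * symmetric_weight \<alpha> x) \<le>
        4 * pi * norm (Gamma (A + A + of_nat n)) ^ 3 * fact n"
      unfolding norm_of_real by linarith
    also have "\<dots> \<le> 4 * pi * (K * (fact n * (real n + 1) ^ p)) ^ 3 * fact n"
    proof (intro mult_right_mono mult_left_mono power_mono)
      have "Gamma (A + A + of_nat n) = Gamma (A + A) * pochhammer (A + A) n"
        by (rule Gamma_add_nat) (use A in simp)
      then have "norm (Gamma (A + A + of_nat n)) = K * norm (pochhammer (A + A) n)"
        by (simp only: norm_mult K_def)
      also have "\<dots> \<le> K * (fact n * (real n + 1) ^ p)"
        by (intro mult_left_mono norm_pochhammer_le p) (simp add: K_def)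
      finally show "norm (Gamma (A + A + of_nat n)) \<le> K * (fact n * (real n + 1) ^ p)" .
    qed auto
    also have "\<dots> = (4 * pi * K ^ 3) * ((real n + 1) ^ p) ^ 3 * (fact n ^ 3 * fact n)"
      by (simp only: power_mult_distrib mult_ac)
    also have "((real n + 1) ^ p) ^ 3 = (real n + 1) ^ (3 * p)"
      by (simp only: power_mult[symmetric] mult.commute)
    also have "fact n ^ 3 * fact n = (fact n :: real) ^ 4"
      by (simp add: eval_nat_numeral)
    finally show ?thesis .
  qed
  then show ?thesis
    unfolding norm_growth_def A_def[symmetric]
    by (intro exI[of _ "4 * pi * K ^ 3"] conjI exI[of _ "3 * p"] allI) (auto simp: K_def)
qed

text \<open>The connection coefficients \<kappa> between the two families are at most a power of n
  times n!^2 / (n - m)!^2, so the convolution preserves the growth class.\<close>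

lemma norm_growth_shift:
  assumes \<alpha>: "\<alpha> > 0" and growth: "norm_growth \<alpha> a b e"
  shows "norm_growth \<alpha> a b d"
proof -
  obtain C p where C: "C \<ge> 0" and bound: "\<And>n. integral\<^sup>L lborel
      (\<lambda>x. (norm (dual_Hahn n a b e (\<i> * of_real x)))\<^sup>2 * symmetric_weight \<alpha> x) \<le> C * (real n + 1) ^ p * fact n ^ 4"
    using growth unfolding norm_growth_def by metis
  \<comment> \<open>One exponent that serves for both Pochhammer symbols in \<kappa>.\<close>
  define q where "q = nat \<lceil>norm (d - e) + norm (a + b)\<rceil>"
  have q: "norm (d - e) + norm (a + b) \<le> real q" unfolding q_def by linarith
  define \<kappa> where "\<kappa> n m = of_nat (n choose m) * pochhammer (d - e) m * pochhammer (a + b + of_nat (n - m)) m" for n m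
  have \<kappa>: "norm (\<kappa> n m) * (fact (n - m))\<^sup>2 \<le> (real n + 1) ^ (2 * q) * (fact n)\<^sup>2" if m: "m \<le> n" for n m
  proof -
    have 1: "norm (pochhammer (d - e) m) \<le> fact m * (real n + 1) ^ q"
    proof -
      have "norm (d - e) \<le> real q" using q norm_ge_zero[of "a + b"] by linarith
      then have "norm (pochhammer (d - e) m) \<le> fact m * (real m + 1) ^ q" by (rule norm_pochhammer_le)
      also have "\<dots> \<le> fact m * (real n + 1) ^ q" using m by (intro mult_left_mono power_mono) auto
      finally show ?thesis .
    qed
    have 2: "norm (pochhammer (a + b + of_nat (n - m)) m) * fact (n - m) \<le> fact n * (real n + 1) ^ q"
    proof -
      have "norm (a + b + of_nat (n - m)) \<le> norm (a + b) + real (n - m)"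
        using norm_triangle_ineq[of "a + b" "of_nat (n - m)"] unfolding norm_of_nat .
      then have "norm (a + b + of_nat (n - m)) \<le> real q + real (n - m)"
        using q norm_ge_zero[of "d - e"] by linarith
      from norm_pochhammer_mult_fact_le[OF this, of m] m show ?thesis by simp
    qed
    have "norm (\<kappa> n m) * (fact (n - m))\<^sup>2 = (real (n choose m) * fact (n - m)) *
        (norm (pochhammer (d - e) m) * (norm (pochhammer (a + b + of_nat (n - m)) m) * fact (n - m)))"
      by (simp add: \<kappa>_def norm_mult power2_eq_square)
    also have "\<dots> \<le> (real (n choose m) * fact (n - m)) *
        ((fact m * (real n + 1) ^ q) * (fact n * (real n + 1) ^ q))"
      by (intro mult_left_mono mult_mono 1 2) auto
    also have "\<dots> = (real (n choose m) * fact m * fact (n - m)) * (fact n * ((real n + 1) ^ q * (real n + 1) ^ q))"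
      by (simp only: mult_ac)
    also have "real (n choose m) * fact m * fact (n - m) = fact n"
      using binomial_fact[OF m, where ?'a = real] by simp
    also have "fact n * (fact n * ((real n + 1) ^ q * (real n + 1) ^ q)) = (real n + 1) ^ (2 * q) * (fact n)\<^sup>2"
      by (simp add: power2_eq_square power_mult power_mult_distrib[symmetric])
    finally show ?thesis .
  qed
  define N where "N n c x = (norm (dual_Hahn n a b c (\<i> * of_real x)))\<^sup>2 * symmetric_weight \<alpha> x" for n c x
  have N: "integrable lborel (N n c)" for n c
    unfolding N_def by (rule integrable_dual_Hahn_sq[OF \<alpha>])
  have "integral\<^sup>L lborel (N n d) \<le> C * (real n + 1) ^ (2 + 4 * q + p) * fact n ^ 4" for n
  proof -
    have le: "N n d x \<le> (\<Sum>m\<le>n. (real n + 1) * (norm (\<kappa> n m))\<^sup>2 * N (n - m) e x)" for x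
    proof -
      have "norm (dual_Hahn n a b d (\<i> * of_real x)) \<le>
          (\<Sum>m\<le>n. norm (\<kappa> n m) * norm (dual_Hahn (n - m) a b e (\<i> * of_real x)))"
        unfolding dual_Hahn_shift3[of n a b d _ e] norm_mult[symmetric] \<kappa>_def by (rule norm_sum)
      then have "(norm (dual_Hahn n a b d (\<i> * of_real x)))\<^sup>2 \<le>
          (\<Sum>m\<le>n. norm (\<kappa> n m) * norm (dual_Hahn (n - m) a b e (\<i> * of_real x)))\<^sup>2"
        by (intro power_mono) auto
      \<comment> \<open>Cauchy-Schwarz with n + 1 terms; the number of terms is one more harmless
        power of n.\<close>
      also have "\<dots> \<le> (\<Sum>m\<le>n. (norm (\<kappa> n m) * norm (dual_Hahn (n - m) a b e (\<i> * of_real x)))\<^sup>2) * card {..n}"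
        by (rule sum_squared_le_sum_of_squares)
      finally have "N n d x \<le> (\<Sum>m\<le>n. (norm (\<kappa> n m) * norm (dual_Hahn (n - m) a b e (\<i> * of_real x)))\<^sup>2) *
          card {..n} * symmetric_weight \<alpha> x"
        unfolding N_def by (rule mult_right_mono) (rule symmetric_weight_nonneg)
      also have "\<dots> = (\<Sum>m\<le>n. (real n + 1) * (norm (\<kappa> n m))\<^sup>2 * N (n - m) e x)"
        unfolding sum_distrib_right N_def
        by (intro sum.cong refl) (simp add: power_mult_distrib mult_ac add_ac)
      finally show ?thesis .
    qed
    have "integral\<^sup>L lborel (N n d) \<le> integral\<^sup>L lborel (\<lambda>x. \<Sum>m\<le>n. (real n + 1) * (norm (\<kappa> n m))\<^sup>2 * N (n - m) e x)"
      using N le by (intro integral_mono Bochner_Integration.integrable_sum integrable_mult_right) auto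
    also have "\<dots> = (\<Sum>m\<le>n. (real n + 1) * (norm (\<kappa> n m))\<^sup>2 * integral\<^sup>L lborel (N (n - m) e))"
      using N by (subst Bochner_Integration.integral_sum) (auto intro!: integrable_mult_right)
    also have "\<dots> \<le> (\<Sum>m\<le>n. (real n + 1) * (C * (real n + 1) ^ p * ((real n + 1) ^ (2 * q) * (fact n)\<^sup>2)\<^sup>2))"
    proof (rule sum_mono)
      fix m assume "m \<in> {..n}"
      then have m: "m \<le> n" by simp
      have "integral\<^sup>L lborel (N (n - m) e) \<le> C * (real (n - m) + 1) ^ p * fact (n - m) ^ 4"
        unfolding N_def by (rule bound)
      also have "\<dots> \<le> C * (real n + 1) ^ p * fact (n - m) ^ 4"
        using C by (intro mult_right_mono mult_left_mono power_mono) auto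
      finally have "(norm (\<kappa> n m))\<^sup>2 * integral\<^sup>L lborel (N (n - m) e) \<le>
          (norm (\<kappa> n m))\<^sup>2 * (C * (real n + 1) ^ p * fact (n - m) ^ 4)"
        by (intro mult_left_mono) auto
      also have "\<dots> = C * (real n + 1) ^ p * (norm (\<kappa> n m) * (fact (n - m))\<^sup>2)\<^sup>2"
        by (simp add: power_mult_distrib)
      also have "\<dots> \<le> C * (real n + 1) ^ p * ((real n + 1) ^ (2 * q) * (fact n)\<^sup>2)\<^sup>2"
        using C \<kappa>[OF m] by (intro mult_left_mono power_mono) auto
      finally have "(real n + 1) * ((norm (\<kappa> n m))\<^sup>2 * integral\<^sup>L lborel (N (n - m) e)) \<le>
          (real n + 1) * (C * (real n + 1) ^ p * ((real n + 1) ^ (2 * q) * (fact n)\<^sup>2)\<^sup>2)"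
        by (intro mult_left_mono) auto
      then show "(real n + 1) * (norm (\<kappa> n m))\<^sup>2 * integral\<^sup>L lborel (N (n - m) e) \<le>
          (real n + 1) * (C * (real n + 1) ^ p * ((real n + 1) ^ (2 * q) * (fact n)\<^sup>2)\<^sup>2)"
        by (simp only: mult.assoc)
    qed
    also have "\<dots> = C * (real n + 1) ^ (2 + 4 * q + p) * fact n ^ 4"
    proof -
      have "((real n + 1) ^ (2 * q) * (fact n)\<^sup>2)\<^sup>2 = (real n + 1) ^ (4 * q) * fact n ^ 4"
        by (simp add: power_mult_distrib power_mult[symmetric])
      then have "(\<Sum>m\<le>n. (real n + 1) * (C * (real n + 1) ^ p * ((real n + 1) ^ (2 * q) * (fact n)\<^sup>2)\<^sup>2)) =
          (real n + 1) * ((real n + 1) * (C * (real n + 1) ^ p * ((real n + 1) ^ (4 * q) * fact n ^ 4)))"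
        by simp
      then show ?thesis by (simp only: power_add power2_eq_square mult_ac)
    qed
    finally show ?thesis .
  qed
  then show ?thesis
    unfolding norm_growth_def N_def using C by blast
qed

text \<open>Only the third parameter can be replaced, so permutations carry each of the three into
  that place in turn.\<close>

lemma norm_growth_all:
  assumes "\<alpha> > 0"
  shows "norm_growth \<alpha> a b d"
proof -
  define A where "A = complex_of_real \<alpha>"
  have "norm_growth \<alpha> A A A" unfolding A_def by (rule norm_growth_base[OF assms])
  then have "norm_growth \<alpha> A A d" by (rule norm_growth_shift[OF assms])
  then have "norm_growth \<alpha> A d A" by (simp only: norm_growth_swap(2)[of \<alpha> A d A])
  then have "norm_growth \<alpha> A d b" by (rule norm_growth_shift[OF assms])
  then have "norm_growth \<alpha> d A b" by (simp only: norm_growth_swap(1)[of \<alpha> d A b])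
  then have "norm_growth \<alpha> d b A" by (simp only: norm_growth_swap(2)[of \<alpha> d b A])
  then have "norm_growth \<alpha> d b a" by (rule norm_growth_shift[OF assms])
  then have "norm_growth \<alpha> b d a" by (simp only: norm_growth_swap(1)[of \<alpha> b d a])
  then have "norm_growth \<alpha> b a d" by (simp only: norm_growth_swap(2)[of \<alpha> b a d])
  then show ?thesis by (simp only: norm_growth_swap(1)[of \<alpha> a b d])
qed

text \<open>At half-integers a lower bound is elementary: the exact modulus on Re z = 1/2 times a
  Pochhammer symbol, which contributes as many powers of |x| as desired.\<close>

lemma norm_Gamma_half_integer_ge:
  "(norm (Gamma (of_real (real N + 1/2) + \<i> * of_real x)))\<^sup>2 \<ge> (1/4) ^ (2 * N) * (1 + \<bar>x\<bar>) ^ (2 * N) * exp (- (pi * \<bar>x\<bar>))"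
proof -
  define z where "z = 1/2 + \<i> * complex_of_real x"
  have z: "Re z > 0" by (simp add: z_def)
  \<comment> \<open>Real part at least 1/2 and imaginary part x give a modulus of at least max(1/2,
    |x|), hence at least (1 + |x|)/4.\<close>
  have poch: "((1 + \<bar>x\<bar>) / 4) ^ N \<le> norm (pochhammer z N)"
  proof (induction N)
    case (Suc N)
    have "(1 + \<bar>x\<bar>) / 4 \<le> norm (z + of_nat N)"
      using abs_Re_le_cmod[of "z + of_nat N"] abs_Im_le_cmod[of "z + of_nat N"] by (simp add: z_def)
    then have "((1 + \<bar>x\<bar>) / 4) ^ N * ((1 + \<bar>x\<bar>) / 4) \<le> norm (pochhammer z N) * norm (z + of_nat N)"
      by (intro mult_mono Suc.IH) auto
    then show ?case unfolding pochhammer_Suc norm_mult power_Suc2 .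
  qed simp
  have half: "exp (- (pi * \<bar>x\<bar> / 2)) \<le> norm (Gamma z)"
  proof -
    have "1 * exp (- (pi * \<bar>x\<bar> / 2)) \<le> sqrt pi * exp (- (pi * \<bar>x\<bar> / 2))"
      using pi_gt3 by (intro mult_right_mono) auto
    then show ?thesis using norm_Gamma_half_line_ge[of x] unfolding z_def by linarith
  qed
  have "of_real (real N + 1/2) + \<i> * of_real x = z + of_nat N" by (simp add: z_def)
  then have "norm (Gamma (of_real (real N + 1/2) + \<i> * of_real x)) = norm (Gamma z) * norm (pochhammer z N)"
    using Gamma_add_nat[OF z, of N] by (simp only: norm_mult)
  also have "\<dots> \<ge> exp (- (pi * \<bar>x\<bar> / 2)) * ((1 + \<bar>x\<bar>) / 4) ^ N"
    by (intro mult_mono half poch) auto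
  finally have "(exp (- (pi * \<bar>x\<bar> / 2)) * ((1 + \<bar>x\<bar>) / 4) ^ N)\<^sup>2 \<le>
      (norm (Gamma (of_real (real N + 1/2) + \<i> * of_real x)))\<^sup>2"
    by (intro power_mono) auto
  moreover have "(exp (- (pi * \<bar>x\<bar> / 2)))\<^sup>2 = exp (- (pi * \<bar>x\<bar>))"
    by (simp add: power2_eq_square exp_add[symmetric])
  ultimately show ?thesis
    by (simp add: power_mult_distrib power_divide power_mult[symmetric] mult_ac)
qed

text \<open>All Gamma pairs share the exponential rate e^(-pi |x|), so only powers of |x| are
  compared, and the symmetric weight gains powers as \<alpha> grows.\<close>

lemma dual_Hahn_weight_dominated:
  assumes pos: "Re a > 0" "Re d > 0" "Re f > 0"
  obtains \<alpha> C where "\<alpha> > 0" "C > 0"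
    "\<And>x. norm (dual_Hahn k a d f (\<i> * of_real x) * dual_Hahn_weight a d f x) \<le> C * symmetric_weight \<alpha> x"
proof -
  define \<sigma> where "\<sigma> = min (Re a) (min (Re d) (Re f))"
  define \<tau> where "\<tau> = max (Re a) (max (Re d) (Re f))"
  define T where "T = max \<bar>Im a\<bar> (max \<bar>Im d\<bar> \<bar>Im f\<bar>)"
  have \<sigma>: "\<sigma> > 0" using pos by (simp add: \<sigma>_def)
  obtain C M where C: "C > 0" and bound: "\<And>a x. \<sigma> \<le> Re a \<Longrightarrow> Re a \<le> \<tau> \<Longrightarrow> \<bar>Im a\<bar> \<le> T \<Longrightarrow>
      norm (Gamma_pair a x) \<le> C * (1 + \<bar>x\<bar>) ^ M * exp (- (pi * \<bar>x\<bar>))"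
    using Gamma_pair_bound[OF \<sigma>, of \<tau> T] by metis
  obtain D L where D: "D > 0" "\<And>x. norm (dual_Hahn k a d f (\<i> * of_real x)) \<le> D * (1 + \<bar>x\<bar>) ^ L"
    using dual_Hahn_poly_bound by metis
  \<comment> \<open>\<open>L\<close> powers pay for the polynomial and \<open>M\<close> for each
    Gamma pair: L + 3 M <= 6 N.\<close>
  define N where "N = L + M"
  define c where "c = ((1/4) ^ (2 * N) :: real)"
  have c: "c > 0" by (simp add: c_def)
  show ?thesis
  proof (rule that[of "real N + 1/2" "D * (C / c) ^ 3"])
    show "D * (C / c) ^ 3 > 0" using C D c by simp
    fix x :: real
    define y where "y = 1 + \<bar>x\<bar>"
    define e where "e = exp (- (pi * \<bar>x\<bar>))"
    \<comment> \<open>This factor vanishes at x = 0 and has no positive lower bound, so it is kept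
      exactly on both sides of the comparison.\<close>
    define K where "K = 2 * x * sinh (2 * pi * x) / pi"
    define G where "G = (norm (Gamma (of_real (real N + 1/2) + \<i> * of_real x)))\<^sup>2"
    have y: "y \<ge> 1" and e: "e > 0" and K: "K \<ge> 0"
      by (auto simp: y_def e_def K_def sinh_factor_nonneg)
    have G: "c * y ^ (2 * N) * e \<le> G"
      unfolding c_def y_def e_def G_def by (rule norm_Gamma_half_integer_ge)
    have g: "norm (Gamma_pair p x) \<le> C * y ^ M * e" if "p \<in> {a, d, f}" for p
      unfolding y_def e_def by (rule bound) (use that in \<open>auto simp: \<sigma>_def \<tau>_def T_def\<close>)
    have "norm (dual_Hahn k a d f (\<i> * of_real x) * dual_Hahn_weight a d f x) =
        norm (dual_Hahn k a d f (\<i> * of_real x)) *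
        (K * (norm (Gamma_pair a x) * norm (Gamma_pair d x) * norm (Gamma_pair f x)))"
      using K by (simp only: dual_Hahn_weight_def norm_mult norm_of_real K_def[symmetric] abs_of_nonneg)
    also have "\<dots> \<le> (D * y ^ L) * (K * ((C * y ^ M * e) * (C * y ^ M * e) * (C * y ^ M * e)))"
      unfolding y_def using C D K e y by (intro mult_mono g[unfolded y_def] D) (auto simp: y_def)
    also have "\<dots> = D * C ^ 3 * K * e ^ 3 * y ^ (L + 3 * M)"
      by (simp add: power_add power3_eq_cube mult_ac power_mult)
    also have "\<dots> \<le> D * C ^ 3 * K * e ^ 3 * y ^ (3 * (2 * N))"
      using C D K e y by (intro mult_left_mono power_increasing) (auto simp: N_def)
    also have "\<dots> = D * (C / c) ^ 3 * K * (c * y ^ (2 * N) * e) ^ 3"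
      using c by (simp add: power_mult_distrib power_divide power_mult[symmetric] mult_ac)
    also have "\<dots> \<le> D * (C / c) ^ 3 * K * G ^ 3"
      using C D c K e y G by (intro mult_left_mono power_mono) auto
    also have "\<dots> = D * (C / c) ^ 3 * symmetric_weight (real N + 1/2) x"
      by (simp add: symmetric_weight_def real_dual_Hahn_weight_def K_def G_def power3_eq_cube)
    finally show "norm (dual_Hahn k a d f (\<i> * of_real x) * dual_Hahn_weight a d f x) \<le>
        D * (C / c) ^ 3 * symmetric_weight (real N + 1/2) x" .
  qed simp
qed

subsection \<open>The generating function\<close>

lemma pochhammer_nonzero_Re_pos: "Re z > 0 \<Longrightarrow> pochhammer z n \<noteq> 0"
  by (auto simp: pochhammer_eq_0_iff)

lemma summable_norm_hypergeometric_2F1: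
  fixes A B D z :: complex
  assumes "Re D > 0" "norm z < 1"
  shows "summable (\<lambda>j. norm (pochhammer A j * pochhammer B j / pochhammer D j * (z ^ j / fact j)))"
proof -
  define p where "p = nat \<lceil>norm A + norm B\<rceil>"
  have p: "norm A \<le> real p" "norm B \<le> real p"
    unfolding p_def using norm_ge_zero[of A] norm_ge_zero[of B] by linarith+
  define \<mu> where "\<mu> = min 1 (Re D)"
  have \<mu>: "\<mu> > 0" using assms by (simp add: \<mu>_def)
  show ?thesis
  proof (rule summable_comparison_test')
    show "summable (\<lambda>j. 1 / \<mu> * (norm z ^ j * (real j + 1) ^ (2 * p + 1)))"
      using assms by (intro summable_mult summable_poly_geometric) auto
    fix j
    define F where "F = (fact j :: real)"
    have F: "F > 0" by (simp add: F_def)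
    have D: "\<mu> * F \<le> (real j + 1) * norm (pochhammer D j)"
      unfolding \<mu>_def F_def by (rule fact_le_norm_pochhammer[OF assms(1)])
    moreover have "\<mu> * F > 0" using \<mu> F by simp
    ultimately have D0: "norm (pochhammer D j) > 0"
      by (metis less_le_trans mult_eq_0_iff norm_ge_zero order_le_less not_less_iff_gr_or_eq)
    have iD: "1 / norm (pochhammer D j) \<le> (real j + 1) / (\<mu> * F)"
      using D D0 \<mu> F by (simp add: field_simps)
    have "norm (pochhammer A j * pochhammer B j / pochhammer D j * (z ^ j / fact j)) =
        (norm (pochhammer A j) * norm (pochhammer B j)) * (1 / norm (pochhammer D j)) * (norm z ^ j / F)"
      by (simp add: norm_mult norm_divide norm_power F_def)
    also have "\<dots> \<le> ((F * (real j + 1) ^ p) * (F * (real j + 1) ^ p)) * ((real j + 1) / (\<mu> * F)) * (norm z ^ j / F)"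
      unfolding F_def using \<mu> p
      by (intro mult_right_mono mult_mono norm_pochhammer_le iD[unfolded F_def]) auto
    also have "\<dots> = 1 / \<mu> * (norm z ^ j * (real j + 1) ^ (2 * p + 1))"
    proof -
      have "(real j + 1) ^ (2 * p + 1) = (real j + 1) ^ p * (real j + 1) ^ p * (real j + 1)"
        by (simp add: mult_2 power_add)
      then show ?thesis using F \<mu> by (simp add: field_simps)
    qed
    finally show "norm (norm (pochhammer A j * pochhammer B j / pochhammer D j * (z ^ j / fact j))) \<le>
        1 / \<mu> * (norm z ^ j * (real j + 1) ^ (2 * p + 1))"
      by simp
  qed
qed

lemma hypergeometric_2F1_sums:
  assumes "Re D > 0" "norm z < 1"
  shows "(\<lambda>j. pochhammer A j * pochhammer B j / pochhammer D j * (z ^ j / fact j)) sums hypergeometric [A, B] [D] z"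
  using summable_sums[OF summable_norm_cancel[OF summable_norm_hypergeometric_2F1[OF assms, of A B]]]
  by (simp add: hypergeometric_eq_suminf)

lemma binomial_series_pochhammer:
  fixes z e :: complex
  assumes "norm z < 1"
  shows "(\<lambda>n. pochhammer e n / fact n * z ^ n) sums (1 - z) powr (- e)"
proof -
  have "(\<lambda>n. ((- e) gchoose n) * (- z) ^ n) sums (1 + (- z)) powr (- e)"
    using assms by (intro gen_binomial_complex) simp
  also have "(\<lambda>n. ((- e) gchoose n) * (- z) ^ n) = (\<lambda>n. pochhammer e n / fact n * z ^ n)"
  proof
    fix n
    have "((- e) gchoose n) * (- z) ^ n = ((-1) ^ n * (-1) ^ n) * (pochhammer e n / fact n * z ^ n)"
      unfolding power_minus[of z n] by (simp add: gbinomial_pochhammer)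
    also have "(-1) ^ n * (-1) ^ n = (1 :: complex)" by (simp add: power_mult_distrib[symmetric])
    finally show "((- e) gchoose n) * (- z) ^ n = pochhammer e n / fact n * z ^ n" by simp
  qed
  finally show ?thesis by simp
qed

definition dual_Hahn_coeff :: "nat \<Rightarrow> complex \<Rightarrow> complex \<Rightarrow> complex \<Rightarrow> complex \<Rightarrow> complex" where
  "dual_Hahn_coeff n a b d s = dual_Hahn n a b d s / (pochhammer (a + b) n * fact n)"

text \<open>The convolution form is the Cauchy product of the 2F1 series with the binomial series
  for (1 - z)^(s - d). The principal power is the right one, since 1 - z has positive real
  part.\<close>

lemma dual_Hahn_generating_function:
  assumes ab: "Re (a + b) > 0" and z: "norm z < 1"
  shows "(\<lambda>n. dual_Hahn_coeff n a b d s * z ^ n) sums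
    ((1 - z) powr (- d + s) * hypergeometric [a + s, b + s] [a + b] z)"
proof -
  define A where "A j = pochhammer (a + s) j * pochhammer (b + s) j / pochhammer (a + b) j * (z ^ j / fact j)" for j
  define B where "B m = pochhammer (d - s) m / fact m * z ^ m" for m
  have nz: "pochhammer (a + b) m \<noteq> 0" for m
    using ab by (rule pochhammer_nonzero_Re_pos)
  have A: "summable (\<lambda>j. norm (A j))" "(\<Sum>j. A j) = hypergeometric [a + s, b + s] [a + b] z"
    unfolding A_def using summable_norm_hypergeometric_2F1[OF ab z] hypergeometric_2F1_sums[OF ab z]
    by (auto simp: sums_iff)
  have B: "summable (\<lambda>m. norm (B m))" "(\<Sum>m. B m) = (1 - z) powr (- d + s)"
  proof -
    \<comment> \<open>Convergence at a radius strictly between |z| and 1 gives absolute convergence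
      at z.\<close>
    define \<rho> where "\<rho> = complex_of_real ((norm z + 1) / 2)"
    have \<rho>: "norm \<rho> = (norm z + 1) / 2"
      unfolding \<rho>_def norm_of_real by (rule abs_of_nonneg) simp
    have "norm \<rho> < 1" "norm z < norm \<rho>" using z unfolding \<rho> by auto
    from sums_summable[OF binomial_series_pochhammer[OF this(1)]] this(2)
    show "summable (\<lambda>m. norm (B m))" unfolding B_def by (rule powser_insidea)
    show "(\<Sum>m. B m) = (1 - z) powr (- d + s)"
      using sums_unique[OF binomial_series_pochhammer[OF z, of "d - s"]] by (simp add: B_def)
  qed
  have "(\<lambda>n. \<Sum>j\<le>n. A j * B (n - j)) sums ((\<Sum>j. A j) * (\<Sum>m. B m))"
    by (rule Cauchy_product_sums[OF A(1) B(1)])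
  also have "(\<lambda>n. \<Sum>j\<le>n. A j * B (n - j)) = (\<lambda>n. dual_Hahn_coeff n a b d s * z ^ n)"
  proof
    fix n
    have "A j * B (n - j) = of_nat (n choose j) * (pochhammer (a + s) j * pochhammer (b + s) j) *
      pochhammer (a + b + of_nat j) (n - j) * pochhammer (d - s) (n - j) * (z ^ n / (pochhammer (a + b) n * fact n))"
      if "j \<le> n" for j
    proof -
      have 1: "of_nat (n choose j) = (fact n / (fact j * fact (n - j)) :: complex)"
        using that by (rule binomial_fact)
      have 2: "pochhammer (a + b) n = pochhammer (a + b) j * pochhammer (a + b + of_nat j) (n - j)"
        using that by (rule pochhammer_product)
      have 3: "z ^ n = z ^ j * z ^ (n - j)" using that by (simp add: power_add[symmetric])
      have 4: "pochhammer (a + b + of_nat j) (n - j) \<noteq> 0" using nz[of n] unfolding 2 by simp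
      show ?thesis unfolding A_def B_def 1 2 3 using 4 nz[of j] by (simp add: field_simps)
    qed
    then have "(\<Sum>j\<le>n. A j * B (n - j)) = (\<Sum>j\<le>n. of_nat (n choose j) * (pochhammer (a + s) j * pochhammer (b + s) j) *
      pochhammer (a + b + of_nat j) (n - j) * pochhammer (d - s) (n - j) * (z ^ n / (pochhammer (a + b) n * fact n)))"
      by (intro sum.cong) auto
    also have "\<dots> = dual_Hahn n a b d s * (z ^ n / (pochhammer (a + b) n * fact n))"
      by (simp only: dual_Hahn_eq_convolution sum_distrib_right)
    finally show "(\<Sum>j\<le>n. A j * B (n - j)) = dual_Hahn_coeff n a b d s * z ^ n"
      by (simp add: dual_Hahn_coeff_def)
  qed
  finally show ?thesis unfolding A(2) B(2) by (simp only: mult.commute)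
qed

text \<open>For purely imaginary z the conjugate is -z, so |Gamma(z)|^2 = Gamma(z) Gamma(-z) =
  -Gamma(z) Gamma(1 - z) / z, and reflection applies.\<close>

lemma Gamma_2ix_norm_square:
  assumes "x > 0"
  shows "(norm (Gamma (2 * \<i> * of_real x)))\<^sup>2 = pi / (2 * x * sinh (2 * pi * x))"
proof -
  define z where "z = 2 * \<i> * complex_of_real x"
  have z: "z \<noteq> 0" "cnj z = - z" using assms by (auto simp: z_def)
  have nonpole: "- z \<notin> \<int>\<^sub>\<le>\<^sub>0"
    using assms by (auto simp: z_def complex_eq_iff elim!: nonpos_Ints_cases)
  have sn: "sin (of_real pi * z) = \<i> * of_real (sinh (2 * pi * x))"
  proof -
    have "of_real pi * z = \<i> * of_real (2 * pi * x)" by (simp add: z_def)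
    then show ?thesis
      by (simp add: sinh_def sin_exp_eq scaleR_conv_of_real exp_of_real[symmetric] field_simps)
  qed
  have "sinh (2 * pi * x) > 0" using assms by simp
  then have s0: "complex_of_real (sinh (2 * pi * x)) \<noteq> 0" by (metis of_real_eq_0_iff less_irrefl)
  have "of_real ((norm (Gamma z))\<^sup>2) = Gamma z * Gamma (- z)"
    unfolding complex_norm_square cnj_Gamma z(2) ..
  then have "- z * of_real ((norm (Gamma z))\<^sup>2) = Gamma z * (- z * Gamma (- z))"
    by (simp only: mult_ac)
  also have "- z * Gamma (- z) = Gamma (1 - z)"
    using Gamma_plus1[OF nonpole] by simp
  also have "Gamma z * Gamma (1 - z) = of_real pi / (\<i> * of_real (sinh (2 * pi * x)))"
    unfolding Gamma_reflection_complex sn ..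
  finally have "- z * of_real ((norm (Gamma z))\<^sup>2) = of_real pi / (\<i> * of_real (sinh (2 * pi * x)))" .
  then have "complex_of_real ((norm (Gamma z))\<^sup>2 * (2 * x * sinh (2 * pi * x))) = of_real pi"
    using s0 by (simp add: z_def field_simps)
  then have "(norm (Gamma z))\<^sup>2 * (2 * x * sinh (2 * pi * x)) = pi"
    by (simp only: of_real_eq_iff)
  then show ?thesis
    using \<open>sinh (2 * pi * x) > 0\<close> assms by (simp add: z_def field_simps)
qed

text \<open>Conjugation merely permutes the three parameters, and the product is symmetric in
  them.\<close>

lemma conjugate_pair_Gamma_prod:
  assumes "positive_up_to_conjugate_pair [a, d, f]"
  shows "Gamma (cnj a - s) * Gamma (cnj d - s) * Gamma (cnj f - s) = Gamma (a - s) * Gamma (d - s) * Gamma (f - s)"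
proof -
  have real: "cnj p = p" if "p \<in> \<real>" for p using that by (auto simp: Reals_cnj_iff)
  consider "a \<in> \<real>" "d \<in> \<real>" "f \<in> \<real>" | "d = cnj a" "f \<in> \<real>" | "f = cnj a" "d \<in> \<real>" | "f = cnj d" "a \<in> \<real>"
  proof (cases "a \<in> \<real> \<and> d \<in> \<real> \<and> f \<in> \<real>")
    case False
    then obtain i j where ij: "i < 3" "j < 3" "i \<noteq> j" "[a, d, f] ! j = cnj ([a, d, f] ! i)"
      and rest: "\<And>l. l < 3 \<Longrightarrow> l \<noteq> i \<Longrightarrow> l \<noteq> j \<Longrightarrow> [a, d, f] ! l \<in> \<real>"
      using assms unfolding positive_up_to_conjugate_pair_def by (auto simp: numeral_3_eq_3)
    have "i = 0 \<or> i = 1 \<or> i = 2" "j = 0 \<or> j = 1 \<or> j = 2" using ij by auto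
    then show ?thesis
      using ij rest[of 0] rest[of 1] rest[of 2] that by (elim disjE) auto
  qed auto
  then show ?thesis
    by cases (simp_all add: real mult_ac)
qed

text \<open>The modulus is not holomorphic in the parameters, whereas the weight is. They agree when
  the triple is closed under conjugation, because then Gamma(cnj p - s) may be replaced by Gamma(p -
  s) in the product.\<close>

lemma norm_square_eq_dual_Hahn_weight:
  assumes "x > 0" "positive_up_to_conjugate_pair [a, d, f]"
  shows "of_real ((norm (Gamma (a + \<i> * of_real x) * Gamma (d + \<i> * of_real x) *
    Gamma (f + \<i> * of_real x) / Gamma (2 * \<i> * of_real x)))\<^sup>2) = dual_Hahn_weight a d f x"
proof -
  define s where "s = \<i> * complex_of_real x"
  define N where "N = Gamma (a + s) * Gamma (d + s) * Gamma (f + s)"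
  have "cnj N = Gamma (cnj a - s) * Gamma (cnj d - s) * Gamma (cnj f - s)"
    by (simp add: N_def cnj_Gamma s_def)
  also have "\<dots> = Gamma (a - s) * Gamma (d - s) * Gamma (f - s)"
    by (rule conjugate_pair_Gamma_prod[OF assms(2)])
  finally have N: "of_real ((norm N)\<^sup>2) = Gamma_pair a x * Gamma_pair d x * Gamma_pair f x"
    unfolding complex_norm_square by (simp add: N_def Gamma_pair_def s_def mult_ac)
  have "(norm (N / Gamma (2 * \<i> * of_real x)))\<^sup>2 = (2 * x * sinh (2 * pi * x) / pi) * (norm N)\<^sup>2"
    by (simp add: norm_divide power_divide Gamma_2ix_norm_square[OF assms(1)])
  then show ?thesis
    unfolding N_def[symmetric] s_def[symmetric] by (simp only: of_real_mult N dual_Hahn_weight_def)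
qed

text \<open>After domination by a symmetric weight, each integral is bounded by its mass plus a
  normalised squared norm, both of at most polynomial growth in n; the factor |\<rho>|^n then
  sums.\<close>

lemma summable_integral_norm_dual_Hahn_series:
  assumes pos: "Re a > 0" "Re d > 0" "Re f > 0" "Re (a + b) > 0" and \<rho>: "norm \<rho> < 1"
  shows "summable (\<lambda>n. integral\<^sup>L lborel (\<lambda>x. norm (dual_Hahn_coeff n a b d (\<i> * of_real x) * \<rho> ^ n *
    (dual_Hahn k a d f (\<i> * of_real x) * dual_Hahn_weight a d f x))))"
proof -
  obtain \<alpha> C where \<alpha>: "\<alpha> > 0" and C: "C > 0" and
    dom: "\<And>x. norm (dual_Hahn k a d f (\<i> * of_real x) * dual_Hahn_weight a d f x) \<le> C * symmetric_weight \<alpha> x"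
    using dual_Hahn_weight_dominated[OF pos(1-3)] by metis
  obtain D p where D: "D \<ge> 0" and growth: "\<And>n. integral\<^sup>L lborel
      (\<lambda>x. (norm (dual_Hahn n a b d (\<i> * of_real x)))\<^sup>2 * symmetric_weight \<alpha> x) \<le> D * (real n + 1) ^ p * fact n ^ 4"
    using norm_growth_all[OF \<alpha>] unfolding norm_growth_def by metis
  define \<mu> where "\<mu> = min 1 (Re (a + b))"
  have \<mu>: "\<mu> > 0" using pos by (simp add: \<mu>_def)
  define I where "I = integral\<^sup>L lborel (symmetric_weight \<alpha>)"
  have I: "I \<ge> 0"
    unfolding I_def by (intro Bochner_Integration.integral_nonneg) (rule symmetric_weight_nonneg)
  define g where "g n x = dual_Hahn_coeff n a b d (\<i> * of_real x) * \<rho> ^ n *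
    (dual_Hahn k a d f (\<i> * of_real x) * dual_Hahn_weight a d f x)" for n x
  define N where "N n x = (norm (dual_Hahn n a b d (\<i> * of_real x)))\<^sup>2 * symmetric_weight \<alpha> x" for n x
  \<comment> \<open>The square of an upper bound for 1 / |(a + b)_n n!|.\<close>
  define E where "E n = ((real n + 1) / (\<mu> * (fact n)\<^sup>2))\<^sup>2" for n
  have gle: "norm (g n x) \<le> norm \<rho> ^ n * C * (symmetric_weight \<alpha> x + E n * N n x)" for n x
  proof -
    define u where "u = norm (dual_Hahn_coeff n a b d (\<i> * of_real x))"
    have "u = norm (dual_Hahn n a b d (\<i> * of_real x)) / (norm (pochhammer (a + b) n) * fact n)"
      by (simp add: u_def dual_Hahn_coeff_def norm_divide norm_mult)
    also have "\<dots> \<le> norm (dual_Hahn n a b d (\<i> * of_real x)) * ((real n + 1) / (\<mu> * (fact n)\<^sup>2))"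
    proof -
      define F where "F = (fact n :: real)"
      define P where "P = norm (pochhammer (a + b) n)"
      have F: "F > 0" by (simp add: F_def)
      have "pochhammer (a + b) n \<noteq> 0" using pos(4) by (rule pochhammer_nonzero_Re_pos)
      then have P: "P > 0" by (simp add: P_def)
      have "\<mu> * F \<le> (real n + 1) * P"
        unfolding \<mu>_def F_def P_def by (rule fact_le_norm_pochhammer[OF pos(4)])
      then have "1 / (P * F) \<le> (real n + 1) / (\<mu> * F\<^sup>2)"
        using F P \<mu> by (simp add: field_simps power2_eq_square)
      then have "norm (dual_Hahn n a b d (\<i> * of_real x)) * (1 / (P * F)) \<le>
          norm (dual_Hahn n a b d (\<i> * of_real x)) * ((real n + 1) / (\<mu> * F\<^sup>2))"
        by (rule mult_left_mono) simp
      then show ?thesis by (simp add: P_def F_def)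
    qed
    finally have "u\<^sup>2 \<le> (norm (dual_Hahn n a b d (\<i> * of_real x)) * ((real n + 1) / (\<mu> * (fact n)\<^sup>2)))\<^sup>2"
      by (intro power_mono) (simp_all add: u_def)
    then have u2: "u\<^sup>2 \<le> E n * (norm (dual_Hahn n a b d (\<i> * of_real x)))\<^sup>2"
      by (simp only: E_def power_mult_distrib mult.commute)
    \<comment> \<open>The inequality u <= 1 + u^2 takes the place of Cauchy-Schwarz for integrals:
      it leaves only the mass and the squared norm.\<close>
    have "0 \<le> (u - 1/2)\<^sup>2" by simp
    then have "u \<le> 1 + u\<^sup>2" by (simp add: power2_eq_square algebra_simps)
    with u2 have u: "u \<le> 1 + E n * (norm (dual_Hahn n a b d (\<i> * of_real x)))\<^sup>2" by linarith
    have "norm (g n x) = u * norm \<rho> ^ n *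
        norm (dual_Hahn k a d f (\<i> * of_real x) * dual_Hahn_weight a d f x)"
      by (simp only: g_def norm_mult norm_power u_def)
    also have "\<dots> \<le> (1 + E n * (norm (dual_Hahn n a b d (\<i> * of_real x)))\<^sup>2) * norm \<rho> ^ n *
        (C * symmetric_weight \<alpha> x)"
      by (intro mult_mono mult_right_mono u dom) (auto simp: u_def E_def)
    also have "\<dots> = norm \<rho> ^ n * C * (symmetric_weight \<alpha> x + E n * N n x)"
      by (simp add: N_def algebra_simps)
    finally show ?thesis .
  qed
  have intW: "integrable lborel (symmetric_weight \<alpha>)" by (rule integrable_symmetric_weight[OF \<alpha>])
  have intN: "integrable lborel (N n)" for n unfolding N_def by (rule integrable_dual_Hahn_sq[OF \<alpha>])
  have "summable (\<lambda>n. C * (I + D / \<mu>\<^sup>2) * (norm \<rho> ^ n * (real n + 1) ^ (p + 2)))"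
    using \<rho> by (intro summable_mult summable_poly_geometric) auto
  then have "summable (\<lambda>n. integral\<^sup>L lborel (\<lambda>x. norm (g n x)))"
  proof (rule summable_comparison_test')
    fix n
    have "integral\<^sup>L lborel (\<lambda>x. norm (g n x)) \<le>
        integral\<^sup>L lborel (\<lambda>x. norm \<rho> ^ n * C * (symmetric_weight \<alpha> x + E n * N n x))"
    proof (rule integral_mono')
      show "integrable lborel (\<lambda>x. norm \<rho> ^ n * C * (symmetric_weight \<alpha> x + E n * N n x))"
        using intW intN by (intro integrable_mult_right Bochner_Integration.integrable_add) auto
    qed (use gle order_trans[OF norm_ge_zero gle] in auto)
    also have "\<dots> = norm \<rho> ^ n * C * (I + E n * integral\<^sup>L lborel (N n))"
      using intW intN[of n] by (simp add: I_def)
    also have "\<dots> \<le> norm \<rho> ^ n * C * (I * (real n + 1) ^ (p + 2) + D / \<mu>\<^sup>2 * (real n + 1) ^ (p + 2))"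
    proof (intro mult_left_mono add_mono)
      show "I \<le> I * (real n + 1) ^ (p + 2)"
        using mult_left_mono[OF one_le_power[of "real n + 1" "p + 2"] I] by simp
      have "E n * integral\<^sup>L lborel (N n) \<le> E n * (D * (real n + 1) ^ p * fact n ^ 4)"
        unfolding N_def by (intro mult_left_mono growth) (simp add: E_def)
      also have "\<dots> = D / \<mu>\<^sup>2 * (real n + 1) ^ (p + 2)"
      proof -
        have "(fact n :: real) ^ 4 = ((fact n)\<^sup>2)\<^sup>2" by simp
        then show ?thesis
          using \<mu> by (simp add: E_def power_divide power_mult_distrib power_add power2_eq_square)
      qed
      finally show "E n * integral\<^sup>L lborel (N n) \<le> D / \<mu>\<^sup>2 * (real n + 1) ^ (p + 2)" .
    qed (use C in auto)
    also have "\<dots> = C * (I + D / \<mu>\<^sup>2) * (norm \<rho> ^ n * (real n + 1) ^ (p + 2))"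
      by (simp only: distrib_right distrib_left mult_ac)
    finally show "norm (integral\<^sup>L lborel (\<lambda>x. norm (g n x))) \<le>
        C * (I + D / \<mu>\<^sup>2) * (norm \<rho> ^ n * (real n + 1) ^ (p + 2))"
      by simp
  qed
  then show ?thesis by (simp only: g_def)
qed

text \<open>The integrand is extended to the whole line, where the pairings are known. The factor n!
  of the pairing cancels the one in the generating function, and n = k + i turns the remaining
  series into a 2F1.\<close>

lemma dual_Hahn_generating_function_integral:
  fixes k :: nat and G :: "real \<Rightarrow> complex"
  assumes pos: "Re a > 0" "Re d > 0" "Re f > 0" "Re b > 0" and \<rho>: "norm \<rho> < 1"
    and G_def: "\<And>x. G x = (1 - \<rho>) powr (- d + \<i> * of_real x) *
      hypergeometric [a + \<i> * of_real x, b + \<i> * of_real x] [a + b] \<rho> *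
      (dual_Hahn k a d f (\<i> * of_real x) * dual_Hahn_weight a d f x)"
  shows "integrable lborel G" "G (- x) = G x"
    "integral\<^sup>L lborel G = 4 * of_real pi * \<rho> ^ k *
      (Gamma (of_nat k + a + d) * Gamma (of_nat k + a + f) * Gamma (of_nat k + d + f) / pochhammer (a + b) k) *
      hypergeometric [b - f, of_nat k + a + d] [of_nat k + a + b] \<rho>"
proof -
  have ab: "Re (a + b) > 0" using pos by simp
  have nz: "pochhammer (a + b) n \<noteq> 0" for n using ab by (rule pochhammer_nonzero_Re_pos)
  define H where "H x = dual_Hahn k a d f (\<i> * of_real x) * dual_Hahn_weight a d f x" for x
  define g where "g n x = dual_Hahn_coeff n a b d (\<i> * of_real x) * \<rho> ^ n * H x" for n x
  define v where "v n = (if k \<le> n then 4 * of_real pi * Gamma (a + d + of_nat n) * Gamma (a + f + of_nat k) *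
      Gamma (d + f + of_nat k) * (fact n / fact (n - k)) * pochhammer (b - f) (n - k) else 0)" for n
  define t where "t n = \<rho> ^ n / (pochhammer (a + b) n * fact n) * v n" for n
  have gsums: "(\<lambda>n. g n x) sums G x" for x
    using sums_mult2[OF dual_Hahn_generating_function[OF ab \<rho>]] by (simp add: g_def G_def H_def)
  have gen: "G x = (\<Sum>n. g n x)" for x using sums_unique[OF gsums] .
  \<comment> \<open>In closed form this evenness would be Euler's transformation of the 2F1; term by
    term it is immediate.\<close>
  show "G (- x) = G x"
  proof -
    have "g n (- x) = g n x" for n
      using dual_Hahn_minus[of _ _ _ _ "\<i> * of_real x"] by (simp add: g_def H_def dual_Hahn_coeff_def)
    then show ?thesis by (simp add: gen)
  qed
  have gint: "has_bochner_integral lborel (g n) (\<rho> ^ n / (pochhammer (a + b) n * fact n) * v n)" for n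
  proof -
    have "has_bochner_integral lborel (\<lambda>x. \<rho> ^ n / (pochhammer (a + b) n * fact n) *
        (dual_Hahn n a b d (\<i> * of_real x) * dual_Hahn k a d f (\<i> * of_real x) * dual_Hahn_weight a d f x))
        (\<rho> ^ n / (pochhammer (a + b) n * fact n) * v n)"
      unfolding v_def by (intro has_bochner_integral_mult_right dual_Hahn_pairing pos)
    then show ?thesis by (simp add: g_def[abs_def] H_def dual_Hahn_coeff_def mult_ac)
  qed
  \<comment> \<open>Integrating termwise also requires absolute convergence at each point, again
    obtained from a larger radius.\<close>
  have norm_sum: "summable (\<lambda>n. norm (g n x))" for x
  proof -
    define r where "r = complex_of_real ((norm \<rho> + 1) / 2)"
    have r: "norm r = (norm \<rho> + 1) / 2"
      unfolding r_def norm_of_real by (rule abs_of_nonneg) simp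
    have "norm r < 1" "norm \<rho> < norm r" using \<rho> unfolding r by auto
    from sums_summable[OF dual_Hahn_generating_function[OF ab this(1)]] this(2)
    have "summable (\<lambda>n. norm (dual_Hahn_coeff n a b d (\<i> * of_real x) * \<rho> ^ n))"
      by (rule powser_insidea)
    then show ?thesis unfolding g_def norm_mult[of _ "H x"] by (rule summable_mult2)
  qed
  have int_sum: "summable (\<lambda>n. integral\<^sup>L lborel (\<lambda>x. norm (g n x)))"
    unfolding g_def H_def by (rule summable_integral_norm_dual_Hahn_series[OF pos(1-3) ab \<rho>])
  have gi: "integrable lborel (g n)" for n using gint[of n] by (rule integrable.intros)
  have G: "G = (\<lambda>x. \<Sum>n. g n x)" using gen by blast
  show "integrable lborel G"
    unfolding G by (rule integrable_suminf[OF gi _ int_sum]) (simp add: norm_sum)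
  have "(\<lambda>n. integral\<^sup>L lborel (g n)) sums integral\<^sup>L lborel G"
    unfolding G by (rule sums_integral[OF gi _ int_sum]) (simp add: norm_sum)
  then have S1: "t sums integral\<^sup>L lborel G"
    using has_bochner_integral_integral_eq[OF gint] by (simp add: t_def[abs_def])
  define K where "K = 4 * of_real pi * \<rho> ^ k *
      (Gamma (of_nat k + a + d) * Gamma (of_nat k + a + f) * Gamma (of_nat k + d + f) / pochhammer (a + b) k)"
  have kab: "Re (of_nat k + a + b) > 0" using pos by simp
  have "(\<lambda>i. K * (pochhammer (b - f) i * pochhammer (of_nat k + a + d) i / pochhammer (of_nat k + a + b) i *
      (\<rho> ^ i / fact i))) sums (K * hypergeometric [b - f, of_nat k + a + d] [of_nat k + a + b] \<rho>)"
    by (intro sums_mult hypergeometric_2F1_sums[OF kab \<rho>])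
  also have "(\<lambda>i. K * (pochhammer (b - f) i * pochhammer (of_nat k + a + d) i / pochhammer (of_nat k + a + b) i *
      (\<rho> ^ i / fact i))) = (\<lambda>i. \<rho> ^ (i + k) / (pochhammer (a + b) (i + k) * fact (i + k)) * v (i + k))"
  proof
    fix i
    have 1: "Gamma (a + d + of_nat (i + k)) = Gamma (of_nat k + a + d) * pochhammer (of_nat k + a + d) i"
      using Gamma_add_nat[of "of_nat k + a + d" i] pos by (simp add: add_ac)
    have 2: "pochhammer (a + b) (i + k) = pochhammer (a + b) k * pochhammer (of_nat k + a + b) i"
      using pochhammer_product'[of "a + b" k i] by (simp add: add_ac)
    have 3: "pochhammer (of_nat k + a + b) i \<noteq> 0" using nz[of "i + k"] unfolding 2 by simp
    have 4: "v (i + k) = 4 * of_real pi * (Gamma (of_nat k + a + d) * pochhammer (of_nat k + a + d) i) *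
      Gamma (of_nat k + a + f) * Gamma (of_nat k + d + f) * (fact (i + k) / fact i) * pochhammer (b - f) i"
      unfolding v_def 1 by (simp add: add_ac)
    show "K * (pochhammer (b - f) i * pochhammer (of_nat k + a + d) i / pochhammer (of_nat k + a + b) i *
      (\<rho> ^ i / fact i)) = \<rho> ^ (i + k) / (pochhammer (a + b) (i + k) * fact (i + k)) * v (i + k)"
      unfolding 2 4 K_def power_add using 3 nz[of k] by (simp add: field_simps)
  qed
  finally have "(\<lambda>i. t (i + k)) sums
      (K * hypergeometric [b - f, of_nat k + a + d] [of_nat k + a + b] \<rho>)"
    unfolding t_def .
  then have "t sums (K * hypergeometric [b - f, of_nat k + a + d] [of_nat k + a + b] \<rho> +
       (\<Sum>n<k. t n))"
    by (simp only: sums_iff_shift)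
  \<comment> \<open>The triangular pairing kills the first \<open>k\<close> terms, which is the
    origin of the factor \<rho>^k.\<close>
  moreover have "(\<Sum>n<k. t n) = 0"
    by (rule sum.neutral) (simp add: t_def v_def)
  ultimately have "integral\<^sup>L lborel G = K * hypergeometric [b - f, of_nat k + a + d] [of_nat k + a + b] \<rho>"
    using sums_unique2[OF S1] by simp
  then show "integral\<^sup>L lborel G = 4 * of_real pi * \<rho> ^ k *
      (Gamma (of_nat k + a + d) * Gamma (of_nat k + a + f) * Gamma (of_nat k + d + f) / pochhammer (a + b) k) *
      hypergeometric [b - f, of_nat k + a + d] [of_nat k + a + b] \<rho>"
    by (simp only: K_def)
qed

text \<open>On the right \<rho>^k appears because the series starts at n = k, and no k! remains
  because it cancels there. The separate condition on a, d, f excludes that one of them is non-real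
  and conjugate only to b or c, when the squared modulus would no longer be the analytic weight.
  Integrability is asserted along with the value because a divergent integral has the default value
  0.\<close>

theorem corollary6p3:
  fixes k :: nat and \<rho> a b c d f :: complex
  assumes "norm \<rho> < 1"
    and "positive_up_to_conjugate_pair [a, b, c, d, f]"
    and "positive_up_to_conjugate_pair [a, d, f]"
  defines "F \<equiv> (\<lambda>x::real.
      (1 - \<rho>) powr (- d + \<i> * of_real x) *
      hypergeometric [a + \<i> * of_real x, b + \<i> * of_real x] [a + b] \<rho> *
      of_real ((norm (Gamma (a + \<i> * of_real x) * Gamma (d + \<i> * of_real x) *
                      Gamma (f + \<i> * of_real x) / Gamma (2 * \<i> * of_real x)))\<^sup>2) *
      continuous_dual_Hahn k x a d f)"
  shows "set_integrable lborel {0<..} F \<and>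
    (LINT x:{0<..}|lborel. F x) =
      2 * of_real pi * \<rho> ^ k *
      (Gamma (of_nat k + a + d) * Gamma (of_nat k + a + f) * Gamma (of_nat k + d + f) /
        pochhammer (a + b) k) *
      hypergeometric [b - f, of_nat k + a + d] [of_nat k + a + b] \<rho>"
proof -
  have pos: "Re a > 0" "Re d > 0" "Re f > 0" "Re b > 0"
    using assms(2) by (auto simp: positive_up_to_conjugate_pair_def)
  define G where "G x = (1 - \<rho>) powr (- d + \<i> * of_real x) *
    hypergeometric [a + \<i> * of_real x, b + \<i> * of_real x] [a + b] \<rho> *
    (dual_Hahn k a d f (\<i> * of_real x) * dual_Hahn_weight a d f x)" for x
  note G = dual_Hahn_generating_function_integral[OF pos assms(1) G_def]
  have FG: "F x = G x" if "x \<in> {0<..}" for x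
  proof -
    have "x > 0" using that by simp
    moreover have "continuous_dual_Hahn k x a d f = dual_Hahn k a d f (\<i> * of_real x)"
      using pos by (intro continuous_dual_Hahn_eq) auto
    ultimately show ?thesis
      unfolding F_def G_def norm_square_eq_dual_Hahn_weight[OF \<open>x > 0\<close> assms(3)]
      by (simp only: mult_ac)
  qed
  have "set_integrable lborel {0<..} F \<longleftrightarrow> set_integrable lborel {0<..} G"
    by (rule set_integrable_cong) (use FG in auto)
  moreover have "(LINT x:{0<..}|lborel. F x) = (LINT x:{0<..}|lborel. G x)"
    by (rule set_lebesgue_integral_cong) (use FG in auto)
  \<comment> \<open>Evenness halves the integral over the line, turning 4 pi into 2 pi.\<close>
  moreover have "(LINT x:{0<..}|lborel. G x) = integral\<^sup>L lborel G / 2"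
    using even_half_line_integral(2)[OF G(1,2)] by (simp add: scaleR_conv_of_real)
  ultimately show ?thesis
    using even_half_line_integral(1)[OF G(1,2)] unfolding G(3) by simp
qed

end
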